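(* Let $\varphi:M\to\mathbb{CP}^2$ be minimal Lagrangian with horizontal lift $f:M\to S^5$. Then we can choose $f$ (among the horizontal lifts of $\varphi$) so that the lift $\psi_2=(f,\ell_0\oplus\ell_1):M\to FL_2$ is primitive harmonic; that is, $d\psi_2^{1,0}\in\Omega_M^{1,0}\otimes\psi_2^*[\mathfrak{g}_1]$ for the 6-symmetric space structure on $FL_2$ given by $\sigma$. Conversely, any primitive harmonic $\psi_2:M\to FL_2$ projects by $pr_1:FL_2\to S^5$ to a minimal Legendrian surface in $S^5$ and thence by the Hopf map to a minimal Lagrangian surface in $\mathbb{CP}^2$.
   Context: In the first assertion $\varphi$ is an immersion of a connected oriented surface $M$, which carries the complex structure given by its orientation and induced metric; in the converse $M$ is a Riemann surface. $\pi:S^5\to\mathbb{CP}^2$ is the Hopf fibration; a lift $f:M\to S^5$ of $\varphi$ is horizontal if it is orthogonal to the Hopf fibres, equivalently Legendrian for the standard contact structure; it is unique up to $f\mapsto e^{i\theta}f$ with $\theta$ constant. $\ell_0\subset M\times\mathbb{C}^3$ is the pullback by $\varphi$ of the tautological line bundle, and $\ell_1$ is the line subbundle of $\ell_0^\perp$ spanned by the orthogonal projections to $\ell_0^\perp$ of $\partial s/\partial z$, for $s$ a local section of $\ell_0$ and $z$ a local complex coordinate on $M$ (so $\ell_1$ is locally spanned by $f_z$). $FL_2=\{(w,W)\in S^5\times Gr_{\mathbb{C}}(2,\mathbb{C}^3):w\in W\}$ is the $SU_3$-orbit of $(e_1,\mathrm{Sp}_{\mathbb{C}}\{e_1,e_2\})$,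 where $e_1,e_2,e_3$ is the standard unitary basis of $\mathbb{C}^3$, so $FL_2\cong SU_3/K_2$ with $K_2=\{\mathrm{diag}(1,a,a^{-1})\in SU_3\}$. $pr_1:FL_2\to S^5$ is $(w,W)\mapsto w$. It is the 6-symmetric space for the order six automorphism $\sigma=\mu\nu$ of $SU_3$, with fixed point group $K_2$, where $\nu(g)=SgS^{-1}$, $S=\mathrm{diag}(1,\epsilon,\epsilon^2)$, $\epsilon=e^{2\pi i/3}$, and $\mu(g)=T(g^{-1})^tT^{-1}$ with $Te_1=e_1$, $Te_2=e_3$, $Te_3=e_2$. The $(-\epsilon)$-eigenspace of $\sigma$ on $\mathfrak{sl}_3(\mathbb{C})$ is $$\mathfrak{g}_1=\left\{\begin{pmatrix}0&0&\alpha\\ \alpha&0&0\\0&\beta&0\end{pmatrix}:\alpha,\beta\in\mathbb{C}\right\}.$$ $[\mathfrak{g}_1]\subset T^{\mathbb{C}}FL_2$ is the subbundle whose fibre at $gK_2$ is the image of $\mathfrak{g}_1$ under the complex linear extension of $X\mapsto\frac{d}{dt}\big|_{t=0}ge^{tX}K_2$. A smoothly immersed surface $\psi:M\to FL_2$, with $M$ a Riemann surface, is primitive if $d\psi(\partial/\partial z)$ takes values in $[\mathfrak{g}_1]$; every primitive map is harmonic for any $SU_3$-invariant metric for which $[\mathfrak{g}_1]$ is isotropic, and "primitive harmonic" refers to this.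
   Formalization: In the converse, the projections to S^5 and CP^2 need not be immersions (they can even be constant), so they are shown to be Legendrian/Lagrangian, weakly conformal and harmonic on all of M, and minimal immersions only at points where the projection to S^5 is immersed. *)

theory Defs
  imports "HOL-Analysis.Analysis"
begin

section \<open>Smooth surfaces and Riemann surfaces\<close>

text \<open>For maps defined on finite-dimensional spaces this is the usual class \<open>C\<^sup>k\<close>:
  all iterated directional derivatives up to order \<open>k\<close> exist and are continuous.\<close>

primrec Ck_on :: "nat \<Rightarrow> 'a::real_normed_vector set \<Rightarrow> ('a \<Rightarrow> 'b::real_normed_vector) \<Rightarrow> bool" where
  "Ck_on 0 S f \<longleftrightarrow> continuous_on S f"
| "Ck_on (Suc k) S f \<longleftrightarrow> (\<forall>x\<in>S. f differentiable (at x)) \<and>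
     (\<forall>v. Ck_on k S (\<lambda>x. frechet_derivative f (at x) v))"

definition smooth_on :: "'a::real_normed_vector set \<Rightarrow> ('a \<Rightarrow> 'b::real_normed_vector) \<Rightarrow> bool" where
  "smooth_on S f \<longleftrightarrow> (\<forall>k. Ck_on k S f)"

text \<open>A chart is a pair of an open domain and a coordinate \<open>x + iy\<close>; real coordinates
  \<open>(x, y)\<close> on an oriented surface are also written in this form, \<open>\<complex>\<close> having its standard
  orientation.\<close>

type_synonym 'm chart = "'m set \<times> ('m \<Rightarrow> complex)"

definition chart_inv :: "'m chart \<Rightarrow> complex \<Rightarrow> 'm" where
  "chart_inv c = inv_into (fst c) (snd c)"

definition is_chart :: "'m::topological_space chart \<Rightarrow> bool" where
  "is_chart c \<longleftrightarrow> open (fst c) \<and> open (snd c ` fst c) \<and>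
     homeomorphism (fst c) (snd c ` fst c) (snd c) (chart_inv c)"

definition transition :: "'m chart \<Rightarrow> 'm chart \<Rightarrow> complex \<Rightarrow> complex" where
  "transition c d = snd d \<circ> chart_inv c"

text \<open>For a real linear \<open>D\<close> on \<open>\<complex> = \<real>\<^sup>2\<close> one has \<open>det D = Im (cnj (D 1) * D \<i>)\<close>.\<close>

definition oriented_compatible :: "'m chart \<Rightarrow> 'm chart \<Rightarrow> bool" where
  "oriented_compatible c d \<longleftrightarrow>
     smooth_on (snd c ` (fst c \<inter> fst d)) (transition c d) \<and>
     (\<forall>x \<in> snd c ` (fst c \<inter> fst d).
        let D = frechet_derivative (transition c d) (at x) in Im (cnj (D 1) * D \<i>) > 0)"

text \<open>A maximal oriented smooth atlas.\<close>

definition oriented_surface :: "'m::topological_space chart set \<Rightarrow> bool" where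
  "oriented_surface S \<longleftrightarrow>
     (\<forall>c\<in>S. is_chart c) \<and> (\<Union>c\<in>S. fst c) = UNIV \<and>
     (\<forall>c\<in>S. \<forall>d\<in>S. oriented_compatible c d) \<and>
     (\<forall>c. is_chart c \<and> (\<forall>d\<in>S. oriented_compatible c d \<and> oriented_compatible d c) \<longrightarrow> c \<in> S)"

definition complex_atlas :: "'m::topological_space chart set \<Rightarrow> bool" where
  "complex_atlas A \<longleftrightarrow>
     (\<forall>c\<in>A. is_chart c) \<and> (\<Union>c\<in>A. fst c) = UNIV \<and>
     (\<forall>c\<in>A. \<forall>d\<in>A. transition c d holomorphic_on snd c ` (fst c \<inter> fst d))"


section \<open>Maps from a surface into a Euclidean space\<close>

definition smooth_map :: "'m chart set \<Rightarrow> ('m \<Rightarrow> 'e::real_normed_vector) \<Rightarrow> bool" where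
  "smooth_map A h \<longleftrightarrow> (\<forall>c\<in>A. smooth_on (snd c ` fst c) (h \<circ> chart_inv c))"

text \<open>The differential of \<open>h\<close> at \<open>p\<close> in the chart \<open>c\<close>; the vectors \<open>1\<close> and \<open>\<i>\<close> give
  \<open>\<partial>/\<partial>x\<close> and \<open>\<partial>/\<partial>y\<close>.\<close>

definition dchart :: "'m chart \<Rightarrow> ('m \<Rightarrow> 'e::real_normed_vector) \<Rightarrow> 'm \<Rightarrow> complex \<Rightarrow> 'e" where
  "dchart c h p v = frechet_derivative (h \<circ> chart_inv c) (at (snd c p)) v"

abbreviation dx :: "'m chart \<Rightarrow> ('m \<Rightarrow> 'e::real_normed_vector) \<Rightarrow> 'm \<Rightarrow> 'e" where
  "dx c h p \<equiv> dchart c h p 1"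

abbreviation dy :: "'m chart \<Rightarrow> ('m \<Rightarrow> 'e::real_normed_vector) \<Rightarrow> 'm \<Rightarrow> 'e" where
  "dy c h p \<equiv> dchart c h p \<i>"

definition immersed_at :: "'m chart set \<Rightarrow> ('m \<Rightarrow> 'e::real_normed_vector) \<Rightarrow> 'm \<Rightarrow> bool" where
  "immersed_at A h p \<longleftrightarrow> (\<forall>c\<in>A. p \<in> fst c \<longrightarrow> inj (dchart c h p))"

text \<open>The chart \<open>c\<close> is isothermal for the metric induced by \<open>h\<close>.\<close>

definition conformal_chart :: "('m \<Rightarrow> 'e::real_inner) \<Rightarrow> 'm chart \<Rightarrow> bool" where
  "conformal_chart h c \<longleftrightarrow> (\<forall>p\<in>fst c.
     dx c h p \<bullet> dx c h p = dy c h p \<bullet> dy c h p \<and> dx c h p \<bullet> dy c h p = 0)"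

text \<open>\<open>A\<close> is the complex structure given by the orientation and the metric induced by \<open>h\<close>.\<close>

definition induced_complex_structure ::
  "'m::topological_space chart set \<Rightarrow> ('m \<Rightarrow> 'e::real_inner) \<Rightarrow> 'm chart set \<Rightarrow> bool" where
  "induced_complex_structure S h A \<longleftrightarrow>
     complex_atlas A \<and> A \<subseteq> S \<and> (\<forall>c\<in>A. conformal_chart h c)"


section \<open>Minimal surfaces in embedded submanifolds\<close>

text \<open>For an embedded submanifold \<open>N\<close> of a Euclidean space this is its tangent space at \<open>q\<close>.\<close>

definition tangent_space :: "'e::real_normed_vector set \<Rightarrow> 'e \<Rightarrow> 'e set" where
  "tangent_space N q =
     {v. \<exists>\<gamma>. (\<forall>t::real. \<gamma> t \<in> N) \<and> \<gamma> 0 = q \<and> (\<gamma> has_vector_derivative v) (at 0)}"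

text \<open>The mean curvature vector of an immersed surface in \<open>N\<close>, half the trace of the second
  fundamental form. The Levi-Civita connection of \<open>N\<close> is the tangential part of the flat
  connection, so the second fundamental form is the part of the second derivative that is
  tangent to \<open>N\<close> and normal to the surface; \<open>closest_point\<close> onto a linear subspace is the
  orthogonal projection.\<close>

definition mean_curvature ::
  "'e::euclidean_space set \<Rightarrow> 'm chart \<Rightarrow> ('m \<Rightarrow> 'e) \<Rightarrow> 'm \<Rightarrow> 'e" where
  "mean_curvature N c h p =
     (let hx = dx c h p; hy = dy c h p;
          E = hx \<bullet> hx; F = hx \<bullet> hy; G = hy \<bullet> hy
      in closest_point {n \<in> tangent_space N (h p). n \<bullet> hx = 0 \<and> n \<bullet> hy = 0}
           ((1 / (2 * (E * G - F\<^sup>2))) *\<^sub>R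
              (G *\<^sub>R dx c (dx c h) p - (2 * F) *\<^sub>R dx c (dy c h) p + E *\<^sub>R dy c (dy c h) p)))"

definition minimal_immersion_on ::
  "'m chart set \<Rightarrow> 'm set \<Rightarrow> 'e::euclidean_space set \<Rightarrow> ('m \<Rightarrow> 'e) \<Rightarrow> bool" where
  "minimal_immersion_on A U N h \<longleftrightarrow> smooth_map A h \<and> range h \<subseteq> N \<and>
     (\<forall>p\<in>U. immersed_at A h p \<and> (\<forall>c\<in>A. p \<in> fst c \<longrightarrow> mean_curvature N c h p = 0))"

text \<open>Minimal surfaces in the generalized sense that allows points where the differential
  vanishes: weakly conformal harmonic maps of a Riemann surface.\<close>

definition conformal_harmonic ::
  "'m chart set \<Rightarrow> 'e::euclidean_space set \<Rightarrow> ('m \<Rightarrow> 'e) \<Rightarrow> bool" where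
  "conformal_harmonic A N h \<longleftrightarrow> smooth_map A h \<and> range h \<subseteq> N \<and>
     (\<forall>c\<in>A. conformal_chart h c \<and>
        (\<forall>p\<in>fst c. closest_point (tangent_space N (h p)) (dx c (dx c h) p + dy c (dy c h) p) = 0))"


section \<open>The projective plane and the Hopf fibration\<close>

definition adj :: "complex^3^3 \<Rightarrow> complex^3^3" where
  "adj A = (\<chi> i j. cnj (A $ j $ i))"

definition CP2 :: "(complex^3) set set" where
  "CP2 = {L. vec.subspace L \<and> vec.dim L = 1}"

abbreviation S5 :: "(complex^3) set" where
  "S5 \<equiv> sphere 0 1"

definition hopf :: "complex^3 \<Rightarrow> (complex^3) set" where
  "hopf w = vec.span {w}"

text \<open>The matrix of the Hermitian orthogonal projection of \<open>\<complex>\<^sup>3\<close> onto a complex subspace.\<close>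

definition orthproj :: "(complex^3) set \<Rightarrow> complex^3^3" where
  "orthproj W = (THE P. adj P = P \<and> P ** P = P \<and> range ((*v) P) = W)"

text \<open>The manifold structure of \<open>\<complex>\<P>\<^sup>2\<close> is the one for which \<open>orthproj\<close> is an embedding into the
  real Euclidean space \<open>complex^3^3\<close>, with inner product \<open>Re (trace (A ** adj B))\<close>. A horizontal
  vector \<open>v\<close> at \<open>w\<close> in the unit sphere is mapped by \<open>d(orthproj \<circ> hopf)\<close> to \<open>X = v w* + w v*\<close>,
  which has \<open>X \<bullet> X = 2 (v \<bullet> v)\<close>, so the induced metric is twice the Fubini-Study metric that
  makes \<open>hopf\<close> a Riemannian submersion; this constant factor affects none of the notions used
  below. In the same way multiplication of \<open>v\<close> by \<open>\<i>\<close> turns into the complex structure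
  \<open>X \<mapsto> \<i> (X P - P X)\<close> on the tangent space at \<open>P\<close>.\<close>

definition CP2_emb :: "(complex^3^3) set" where
  "CP2_emb = orthproj ` CP2"

definition kaehler_form :: "complex^3^3 \<Rightarrow> complex^3^3 \<Rightarrow> complex^3^3 \<Rightarrow> real" where
  "kaehler_form P X Y = (mat \<i> ** (X ** P - P ** X)) \<bullet> Y"

text \<open>\<open>\<phi>\<close> pulls the Kaehler form back to \<open>0\<close>; for an immersed surface in \<open>\<complex>\<P>\<^sup>2\<close> this is the
  Lagrangian condition.\<close>

definition lagrangian :: "'m chart set \<Rightarrow> ('m \<Rightarrow> (complex^3) set) \<Rightarrow> bool" where
  "lagrangian A \<phi> \<longleftrightarrow> (\<forall>c\<in>A. \<forall>p\<in>fst c. \<forall>u v.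
     kaehler_form (orthproj (\<phi> p)) (dchart c (orthproj \<circ> \<phi>) p u) (dchart c (orthproj \<circ> \<phi>) p v) = 0)"

definition minimal_lagrangian_on ::
  "'m chart set \<Rightarrow> 'm set \<Rightarrow> ('m \<Rightarrow> (complex^3) set) \<Rightarrow> bool" where
  "minimal_lagrangian_on A U \<phi> \<longleftrightarrow> range \<phi> \<subseteq> CP2 \<and>
     minimal_immersion_on A U CP2_emb (orthproj \<circ> \<phi>) \<and> lagrangian A \<phi>"

text \<open>The Hopf fibre through \<open>w\<close> is \<open>{e\<^sup>i\<^sup>\<theta> w}\<close>, with tangent line spanned by \<open>\<i> w\<close>.\<close>

definition horizontal :: "'m chart set \<Rightarrow> ('m \<Rightarrow> complex^3) \<Rightarrow> bool" where
  "horizontal A f \<longleftrightarrow> (\<forall>c\<in>A. \<forall>p\<in>fst c. \<forall>v. dchart c f p v \<bullet> (\<i> *s f p) = 0)"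

definition horizontal_lift ::
  "'m chart set \<Rightarrow> ('m \<Rightarrow> (complex^3) set) \<Rightarrow> ('m \<Rightarrow> complex^3) \<Rightarrow> bool" where
  "horizontal_lift A \<phi> f \<longleftrightarrow>
     smooth_map A f \<and> range f \<subseteq> S5 \<and> (\<forall>p. hopf (f p) = \<phi> p) \<and> horizontal A f"

definition minimal_legendrian_on ::
  "'m chart set \<Rightarrow> 'm set \<Rightarrow> ('m \<Rightarrow> complex^3) \<Rightarrow> bool" where
  "minimal_legendrian_on A U f \<longleftrightarrow> minimal_immersion_on A U S5 f \<and> horizontal A f"


section \<open>The 6-symmetric space\<close>

definition FL2 :: "((complex^3) \<times> (complex^3) set) set" where
  "FL2 = {(w, W). w \<in> S5 \<and> vec.subspace W \<and> vec.dim W = 2 \<and> w \<in> W}"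

definition pr1 :: "(complex^3) \<times> (complex^3) set \<Rightarrow> complex^3" where
  "pr1 = fst"

definition fl_emb :: "(complex^3) \<times> (complex^3) set \<Rightarrow> (complex^3) \<times> (complex^3^3)" where
  "fl_emb q = (fst q, orthproj (snd q))"

definition SU3 :: "(complex^3^3) set" where
  "SU3 = {g. adj g ** g = mat 1 \<and> det g = 1}"

definition su3 :: "(complex^3^3) set" where
  "su3 = {X. adj X = - X \<and> trace X = 0}"

definition sl3 :: "(complex^3^3) set" where
  "sl3 = {X. trace X = 0}"

definition act :: "complex^3^3 \<Rightarrow> (complex^3) \<times> (complex^3) set \<Rightarrow> (complex^3) \<times> (complex^3) set" where
  "act g q = (g *v fst q, (*v) g ` snd q)"

definition base_point :: "(complex^3) \<times> (complex^3) set" where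
  "base_point = (axis 1 1, vec.span {axis 1 1, axis 2 1})"

definition mat_exp :: "complex^3^3 \<Rightarrow> complex^3^3" where
  "mat_exp X = (\<Sum>k. (1 / fact k) *\<^sub>R (((**) X ^^ k) (mat 1)))"

definition eps :: complex where
  "eps = exp (2 * of_real pi * \<i> / 3)"

definition S_mat :: "complex^3^3" where
  "S_mat = vector [vector [1, 0, 0], vector [0, eps, 0], vector [0, 0, eps\<^sup>2]]"

definition T_mat :: "complex^3^3" where
  "T_mat = vector [vector [1, 0, 0], vector [0, 0, 1], vector [0, 1, 0]]"

definition nu :: "complex^3^3 \<Rightarrow> complex^3^3" where
  "nu g = S_mat ** g ** matrix_inv S_mat"

definition mu :: "complex^3^3 \<Rightarrow> complex^3^3" where
  "mu g = T_mat ** transpose (matrix_inv g) ** matrix_inv T_mat"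

definition sigma :: "complex^3^3 \<Rightarrow> complex^3^3" where
  "sigma = mu \<circ> nu"

text \<open>The \<open>(-eps)\<close>-eigenspace on \<open>sl3\<close> of the differential of \<open>sigma\<close> at the identity.\<close>

definition g1 :: "(complex^3^3) set" where
  "g1 = {X \<in> sl3.
     ((\<lambda>t::real. sigma (mat_exp (t *\<^sub>R X))) has_vector_derivative (mat (- eps) ** X)) (at 0)}"

text \<open>The next lemmas compute the differential of \<open>sigma\<close> and lead to the explicit form
  \<open>g1_explicit\<close> of this eigenspace.\<close>

lemma matrix_mul_bilinear: "bounded_bilinear ((**) :: complex^3^3 \<Rightarrow> complex^3^3 \<Rightarrow> complex^3^3)"
proof -
  have "bilinear ((**) :: complex^3^3 \<Rightarrow> complex^3^3 \<Rightarrow> complex^3^3)"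
    unfolding bilinear_def
    by (auto intro!: linearI simp: matrix_matrix_mult_def vec_eq_iff sum.distrib algebra_simps scaleR_sum_right)
  then show ?thesis by (simp add: bilinear_conv_bounded_bilinear)
qed

lemma mat_exp_0: "mat_exp 0 = mat 1"
proof -
  have "(((**) (0::complex^3^3) ^^ k) (mat 1)) = (if k = 0 then mat 1 else 0)" for k
    by (cases k) (auto simp: matrix_matrix_mult_def vec_eq_iff)
  then have "mat_exp 0 = (\<Sum>k. if k = 0 then mat 1 else 0)"
    unfolding mat_exp_def by (intro suminf_cong) auto
  also have "\<dots> = mat 1" using suminf_finite[of "{0}" "\<lambda>k. if k = 0 then mat 1 else (0::complex^3^3)"] by simp
  finally show ?thesis .
qed

lemma mat_pow_scaleR:
  fixes X :: "complex^3^3" and t :: real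
  shows "((**) (t *\<^sub>R X) ^^ k) (mat 1) = t ^ k *\<^sub>R (((**) X ^^ k) (mat 1))"
proof (induction k)
  case (Suc k)
  interpret M: bounded_bilinear "(**) :: complex^3^3 \<Rightarrow> complex^3^3 \<Rightarrow> complex^3^3" by (rule matrix_mul_bilinear)
  have "((**) (t *\<^sub>R X) ^^ Suc k) (mat 1) = (t *\<^sub>R X) ** (t ^ k *\<^sub>R (((**) X ^^ k) (mat 1)))"
    by (simp flip: Suc)
  also have "\<dots> = t ^ Suc k *\<^sub>R (X ** (((**) X ^^ k) (mat 1)))"
    by (simp only: M.scaleR_left M.scaleR_right scaleR_scaleR power_Suc mult.commute)
  finally show ?case by simp
qed simp

lemma has_vector_derivative_0_iff:
  fixes k :: "real \<Rightarrow> 'a::real_normed_vector"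
  shows "(k has_vector_derivative Y) (at 0) \<longleftrightarrow> ((\<lambda>t. (1 / t) *\<^sub>R (k t - k 0)) \<longlongrightarrow> Y) (at 0)"
proof -
  have e: "norm ((1 / norm (t - 0)) *\<^sub>R (k t - (k 0 + (t - 0) *\<^sub>R Y))) = norm ((1 / t) *\<^sub>R (k t - k 0) - Y)"
    if "t \<noteq> 0" for t :: real
  proof -
    have "(1 / t) *\<^sub>R (k t - k 0) - Y = (1 / t) *\<^sub>R (k t - (k 0 + t *\<^sub>R Y))"
      using that by (simp add: scaleR_diff_right scaleR_add_right)
    then show ?thesis by simp
  qed
  have "(k has_vector_derivative Y) (at 0) \<longleftrightarrow>
      ((\<lambda>t. norm ((1 / norm (t - 0)) *\<^sub>R (k t - (k 0 + (t - 0) *\<^sub>R Y)))) \<longlongrightarrow> 0) (at 0)"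
    unfolding has_vector_derivative_def has_derivative_at_within tendsto_norm_zero_iff
    by (simp add: bounded_linear_scaleR_left diff_diff_add inverse_eq_divide)
  also have "\<dots> \<longleftrightarrow> ((\<lambda>t. norm ((1 / t) *\<^sub>R (k t - k 0) - Y)) \<longlongrightarrow> 0) (at 0)"
    by (intro tendsto_cong) (subst eventually_at_filter, intro always_eventually allI impI e)
  also have "\<dots> \<longleftrightarrow> ((\<lambda>t. (1 / t) *\<^sub>R (k t - k 0)) \<longlongrightarrow> Y) (at 0)"
    unfolding tendsto_norm_zero_iff by (rule Lim_null[symmetric])
  finally show ?thesis .
qed

lemma mat_exp_has_vector_derivative:
  "((\<lambda>t::real. mat_exp (t *\<^sub>R X)) has_vector_derivative X) (at 0)"
proof -
  interpret M: bounded_bilinear "(**) :: complex^3^3 \<Rightarrow> complex^3^3 \<Rightarrow> complex^3^3" by (rule matrix_mul_bilinear)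
  obtain K where K: "K \<ge> 0" "\<And>(a::complex^3^3) (b::complex^3^3). norm (a ** b) \<le> norm a * norm b * K"
    using M.nonneg_bounded by auto
  define c where "c k = (1 / fact k) *\<^sub>R (((**) X ^^ k) (mat 1 :: complex^3^3))" for k
  define B where "B k = norm (mat 1 :: complex^3^3) * ((norm X * K) ^ k / fact k)" for k
  have pw: "norm (((**) X ^^ k) (mat 1 :: complex^3^3)) \<le> norm (mat 1 :: complex^3^3) * (norm X * K) ^ k" for k
  proof (induction k)
    case (Suc k)
    have "norm (((**) X ^^ Suc k) (mat 1 :: complex^3^3)) \<le> norm X * norm (((**) X ^^ k) (mat 1 :: complex^3^3)) * K"
      using K(2) by simp
    also have "\<dots> \<le> norm X * (norm (mat 1 :: complex^3^3) * (norm X * K) ^ k) * K"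
      by (intro mult_right_mono mult_left_mono Suc K) auto
    finally show ?case by (simp add: mult_ac)
  qed simp
  have cB: "norm (c k) \<le> B k" for k
    using pw[of k] by (simp add: c_def B_def divide_right_mono)
  have sB: "summable B" unfolding B_def
    by (intro summable_mult) (use summable_exp[of "norm X * K"] in \<open>simp add: field_simps\<close>)
  have sc: "summable (\<lambda>k. norm (c k))"
    by (rule summable_comparison_test'[OF sB, of 0]) (use cB in auto)
  have ex: "mat_exp (t *\<^sub>R X) = (\<Sum>k. t ^ k *\<^sub>R c k)" for t
    unfolding mat_exp_def c_def by (simp add: mat_pow_scaleR mult.commute)
  define C where "C = (\<Sum>k. norm (c (k + 2)))"
  have sc2: "summable (\<lambda>k. norm (c (k + 2)))" using summable_ignore_initial_segment[OF sc] .
  have C0: "C \<ge> 0" unfolding C_def by (intro suminf_nonneg sc2) auto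
  have est: "norm (mat_exp (t *\<^sub>R X) - mat 1 - t *\<^sub>R X) \<le> C * t\<^sup>2" if t: "\<bar>t\<bar> \<le> 1" for t
  proof -
    have le: "norm (t ^ k *\<^sub>R c k) \<le> norm (c k)" for k
      using t by (simp add: power_abs power_le_one mult_left_le_one_le)
    have s: "summable (\<lambda>k. t ^ k *\<^sub>R c k)"
      by (rule summable_norm_cancel, rule summable_comparison_test'[OF sc, of 0]) (use le in auto)
    have "mat_exp (t *\<^sub>R X) = (\<Sum>k. t ^ (k + 2) *\<^sub>R c (k + 2)) + (\<Sum>k<2. t ^ k *\<^sub>R c k)"
      unfolding ex by (rule suminf_split_initial_segment[OF s])
    moreover have "(\<Sum>k<2. t ^ k *\<^sub>R c k) = mat 1 + t *\<^sub>R X"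
      by (simp add: numeral_2_eq_2 c_def)
    ultimately have e: "mat_exp (t *\<^sub>R X) - mat 1 - t *\<^sub>R X = (\<Sum>k. t ^ (k + 2) *\<^sub>R c (k + 2))" by simp
    have b: "norm (t ^ (k + 2) *\<^sub>R c (k + 2)) \<le> norm (c (k+2)) * t\<^sup>2" for k
    proof -
      have "\<bar>t\<bar> ^ (k + 2) \<le> t\<^sup>2"
        using power_decreasing[of 2 "k + 2" "\<bar>t\<bar>"] t by simp
      then have "\<bar>t\<bar> ^ (k + 2) * norm (c (k + 2)) \<le> t\<^sup>2 * norm (c (k + 2))" by (rule mult_right_mono) simp
      then show ?thesis by (simp only: norm_scaleR power_abs mult.commute)
    qed
    have "norm (\<Sum>k. t ^ (k + 2) *\<^sub>R c (k + 2)) \<le> (\<Sum>k. norm (c (k+2)) * t\<^sup>2)"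
      by (rule norm_suminf_le[OF b summable_mult2[OF sc2]])
    also have "\<dots> = C * t\<^sup>2" unfolding C_def by (rule suminf_mult2[OF sc2, symmetric])
    finally show ?thesis using e by simp
  qed
  have "((\<lambda>y::real. C * \<bar>y\<bar>) \<longlongrightarrow> C * \<bar>0\<bar>) (at 0)" by (intro tendsto_intros)
  then have lim: "((\<lambda>y::real. C * \<bar>y\<bar>) \<longlongrightarrow> 0) (at 0)" by simp
  have ev: "\<forall>\<^sub>F y::real in at 0. norm ((1 / y) *\<^sub>R (mat_exp (y *\<^sub>R X) - mat 1) - X) \<le> C * \<bar>y\<bar>"
    unfolding eventually_at
  proof (rule exI[of _ 1], safe)
    fix y :: real assume y: "y \<noteq> 0" "dist y 0 < 1"
    have "(1 / y) *\<^sub>R (mat_exp (y *\<^sub>R X) - mat 1) - X = (1 / y) *\<^sub>R (mat_exp (y *\<^sub>R X) - mat 1 - y *\<^sub>R X)"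
      using y by (simp add: scaleR_diff_right)
    then have "norm ((1 / y) *\<^sub>R (mat_exp (y *\<^sub>R X) - mat 1) - X) = norm (mat_exp (y *\<^sub>R X) - mat 1 - y *\<^sub>R X) / \<bar>y\<bar>"
      by simp
    also have "\<dots> \<le> C * y\<^sup>2 / \<bar>y\<bar>"
      by (intro divide_right_mono est) (use y in auto)
    also have "\<dots> = C * \<bar>y\<bar>" using y power2_abs[of y] by (simp add: power2_eq_square field_simps)
    finally show "norm ((1 / y) *\<^sub>R (mat_exp (y *\<^sub>R X) - mat 1) - X) \<le> C * \<bar>y\<bar>" .
  qed simp
  show ?thesis
    unfolding has_vector_derivative_0_iff
    using Lim_null_comparison[OF ev lim] by (subst Lim_null) (simp add: mat_exp_0)
qed

lemma matrix_inv_eqI: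
  fixes A B :: "complex^3^3"
  assumes "A ** B = mat 1" shows "matrix_inv A = B"
proof -
  have BA: "B ** A = mat 1" using assms matrix_left_right_inverse by blast
  then have "A ** matrix_inv A = mat 1 \<and> matrix_inv A ** A = mat 1"
    unfolding matrix_inv_def using assms by (intro someI[of "\<lambda>C. A ** C = mat 1 \<and> C ** A = mat 1" B]) auto
  then show ?thesis using BA by (metis matrix_mul_assoc matrix_mul_lid matrix_mul_rid)
qed

lemma matrix_inv_has_vector_derivative:
  fixes k :: "real \<Rightarrow> complex^3^3"
  assumes k0: "k 0 = mat 1" and dk: "(k has_vector_derivative Y) (at 0)"
  shows "((\<lambda>t. matrix_inv (k t)) has_vector_derivative - Y) (at 0)"
proof -
  interpret M: bounded_bilinear "(**) :: complex^3^3 \<Rightarrow> complex^3^3 \<Rightarrow> complex^3^3" by (rule matrix_mul_bilinear)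
  define I where "I = (mat 1 :: complex^3^3)"
  define h where "h t = matrix_inv (k t)" for t
  obtain K where K: "K > 0" "\<And>(a::complex^3^3) (b::complex^3^3). norm (a ** b) \<le> norm a * norm b * K"
    using M.pos_bounded by auto
  have lk: "(k \<longlongrightarrow> I) (at 0)"
    using has_vector_derivative_continuous[OF dk] k0 by (simp add: continuous_within I_def)
  have "((\<lambda>t. det (k t)) \<longlongrightarrow> det I) (at 0)"
    unfolding det_3 by (intro tendsto_intros lk)
  then have "\<forall>\<^sub>F t in at 0. det (k t) \<noteq> 0"
    by (rule tendsto_imp_eventually_ne) (simp add: I_def)
  then have inv: "\<forall>\<^sub>F t in at 0. h t ** k t = I"
  proof (rule eventually_mono)
    fix t assume "det (k t) \<noteq> 0"
    then obtain B where "k t ** B = mat 1" using invertible_det_nz invertible_def by blast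
    then show "h t ** k t = I" using matrix_inv_eqI matrix_left_right_inverse I_def h_def by metis
  qed
  have dk': "((\<lambda>t. (1 / t) *\<^sub>R (k t - I)) \<longlongrightarrow> Y) (at 0)"
    using dk k0 by (simp add: has_vector_derivative_0_iff I_def) 
  have small: "\<forall>\<^sub>F t in at 0. norm (k t - I) < 1 / (2 * K)"
    using lk K(1) by (auto simp: tendsto_iff dist_norm)
  have id: "\<forall>\<^sub>F t in at 0. h t - I = - (h t ** (k t - I))"
    using inv by (rule eventually_mono) (simp add: M.diff_right I_def)
  have bd: "\<forall>\<^sub>F t in at 0. norm (h t) \<le> 2 * norm I"
    using id small
  proof eventually_elim
    case (elim t)
    have "norm (h t - I) \<le> norm (h t) * norm (k t - I) * K" using K(2) elim by simp
    also have "\<dots> \<le> norm (h t) * (1 / (2 * K)) * K"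
      by (intro mult_right_mono mult_left_mono) (use elim K in auto)
    also have "\<dots> = norm (h t) / 2" using K by simp
    finally have "norm (h t - I) \<le> norm (h t) / 2" .
    moreover have "norm (h t) \<le> norm (h t - I) + norm I" using norm_triangle_sub[of "h t" I] by simp
    ultimately show ?case by linarith
  qed
  have lh: "(h \<longlongrightarrow> I) (at 0)"
  proof (rule Lim_null[THEN iffD2], rule Lim_null_comparison)
    show "\<forall>\<^sub>F t in at 0. norm (h t - I) \<le> 2 * norm I * norm (k t - I) * K"
      using id bd
    proof eventually_elim
      case (elim t)
      have "norm (h t - I) \<le> norm (h t) * norm (k t - I) * K" using K(2) elim by simp
      also have "\<dots> \<le> 2 * norm I * norm (k t - I) * K"
        by (intro mult_right_mono) (use elim K in auto)
      finally show ?case .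
    qed
    have "((\<lambda>t. 2 * norm I * norm (k t - I) * K) \<longlongrightarrow> 2 * norm I * norm (I - I) * K) (at 0)"
      by (intro tendsto_intros lk)
    then show "((\<lambda>t. 2 * norm I * norm (k t - I) * K) \<longlongrightarrow> 0) (at 0)" by simp
  qed
  have "((\<lambda>t. - (h t ** ((1 / t) *\<^sub>R (k t - I)))) \<longlongrightarrow> - (I ** Y)) (at 0)"
    by (intro tendsto_minus M.tendsto lh dk')
  moreover have "\<forall>\<^sub>F t in at 0. - (h t ** ((1 / t) *\<^sub>R (k t - I))) = (1 / t) *\<^sub>R (h t - I)"
    using id by (rule eventually_mono) (simp add: M.scaleR_right)
  ultimately have "((\<lambda>t. (1 / t) *\<^sub>R (h t - I)) \<longlongrightarrow> - Y) (at 0)"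
    by (simp add: I_def tendsto_cong)
  moreover have "h 0 = I" unfolding h_def k0 I_def by (rule matrix_inv_eqI) simp
  ultimately show ?thesis unfolding h_def
    by (simp add: has_vector_derivative_0_iff)
qed

lemma eps_props: "eps ^ 3 = 1" "1 + eps + eps\<^sup>2 = 0" "eps \<noteq> 1"
proof -
  have "eps = cis (2 * pi / 3)" by (simp add: eps_def cis_conv_exp mult_ac)
  then have e: "eps = Complex (- 1 / 2) (sqrt 3 / 2)"
    by (simp add: complex_eq_iff cos_120 sin_120)
  have q: "sqrt 3 * sqrt 3 = (3::real)" by simp
  show "eps ^ 3 = 1" "1 + eps + eps\<^sup>2 = 0" "eps \<noteq> 1" unfolding e
    by (auto simp: complex_eq_iff power3_eq_cube power2_eq_square q field_simps)
qed

lemma matrix_inv_S_T: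
  "matrix_inv S_mat = vector [vector [1, 0, 0], vector [0, eps\<^sup>2, 0], vector [0, 0, eps]]"
  "matrix_inv T_mat = T_mat"
  using eps_props(1)
  by (rule_tac [!] matrix_inv_eqI) (simp_all add: S_mat_def T_mat_def matrix_matrix_mult_def vec_eq_iff mat_def
      forall_3 sum_3 power2_eq_square power3_eq_cube mult_ac)

lemma sigma_has_vector_derivative:
  "((\<lambda>t::real. sigma (mat_exp (t *\<^sub>R X))) has_vector_derivative
     - (T_mat ** transpose (S_mat ** X ** matrix_inv S_mat) ** matrix_inv T_mat)) (at 0)"
proof -
  interpret M: bounded_bilinear "(**) :: complex^3^3 \<Rightarrow> complex^3^3 \<Rightarrow> complex^3^3" by (rule matrix_mul_bilinear)
  have tr: "bounded_linear (transpose :: complex^3^3 \<Rightarrow> complex^3^3)"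
    unfolding linear_conv_bounded_linear[symmetric]
    by (auto intro!: linearI simp: transpose_def vec_eq_iff)
  have "((\<lambda>t::real. nu (mat_exp (t *\<^sub>R X))) has_vector_derivative (S_mat ** X ** matrix_inv S_mat)) (at 0)"
    unfolding nu_def
    by (intro bounded_linear.has_vector_derivative[OF M.bounded_linear_left]
        bounded_linear.has_vector_derivative[OF M.bounded_linear_right] mat_exp_has_vector_derivative)
  moreover have "nu (mat_exp (0 *\<^sub>R X)) = mat 1"
    unfolding nu_def matrix_inv_S_T using eps_props(1)
    by (simp add: mat_exp_0) (simp add: S_mat_def matrix_matrix_mult_def vec_eq_iff mat_def forall_3 sum_3
      power2_eq_square power3_eq_cube mult_ac)
  ultimately have "((\<lambda>t::real. matrix_inv (nu (mat_exp (t *\<^sub>R X)))) has_vector_derivative - (S_mat ** X ** matrix_inv S_mat)) (at 0)"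
    by (intro matrix_inv_has_vector_derivative)
  then have "((\<lambda>t::real. mu (nu (mat_exp (t *\<^sub>R X)))) has_vector_derivative
     (T_mat ** transpose (- (S_mat ** X ** matrix_inv S_mat)) ** matrix_inv T_mat)) (at 0)"
    unfolding mu_def
    by (intro bounded_linear.has_vector_derivative[OF M.bounded_linear_left]
        bounded_linear.has_vector_derivative[OF M.bounded_linear_right]
        bounded_linear.has_vector_derivative[OF tr])
  then show ?thesis
    by (simp add: sigma_def linear_neg[OF bounded_linear.linear[OF tr]] M.minus_left M.minus_right)
qed

lemma dsigma_entries:
  "- (T_mat ** transpose (S_mat ** X ** matrix_inv S_mat) ** matrix_inv T_mat) =
   vector [vector [- X$1$1, - (eps\<^sup>2 * X$3$1), - (eps * X$2$1)],
           vector [- (eps * X$1$3), - X$3$3, - (eps\<^sup>2 * X$2$3)],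
           vector [- (eps\<^sup>2 * X$1$2), - (eps * X$3$2), - X$2$2]]"
proof -
  have e: "eps * eps\<^sup>2 = 1" "eps\<^sup>2 * eps\<^sup>2 = eps" "eps * eps = eps\<^sup>2"
    using eps_props(1) by (simp_all add: power2_eq_square power3_eq_cube mult.assoc)
  have e': "eps * (x * eps\<^sup>2) = x" "eps\<^sup>2 * (x * eps\<^sup>2) = eps * x"  "eps\<^sup>2 * (x * eps) = x" "eps * (x * eps) = eps\<^sup>2 * x" for x
    using e by (simp_all add: mult.left_commute[of _ x] mult.commute[of "eps\<^sup>2" eps] mult.commute[of _ x])
  have e4: "eps ^ 4 = eps" using e(2) by (simp flip: power_add)
  show ?thesis
    unfolding matrix_inv_S_T
    by (simp add: e4 S_mat_def T_mat_def matrix_matrix_mult_def vec_eq_iff forall_3 sum_3 transpose_def e e' mult.assoc mult.commute)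
qed

lemma g1_explicit:
  "g1 = {vector [vector [0, 0, \<alpha>], vector [\<alpha>, 0, 0], vector [0, \<beta>, 0]] | \<alpha> \<beta>. True}"
proof -
  have g: "X \<in> g1 \<longleftrightarrow> trace X = 0 \<and>
     vector [vector [- X$1$1, - (eps\<^sup>2 * X$3$1), - (eps * X$2$1)],
           vector [- (eps * X$1$3), - X$3$3, - (eps\<^sup>2 * X$2$3)],
           vector [- (eps\<^sup>2 * X$1$2), - (eps * X$3$2), - X$2$2]] = mat (- eps) ** X" for X
    unfolding g1_def sl3_def dsigma_entries[symmetric]
    using sigma_has_vector_derivative[of X] vector_derivative_unique_at by auto
  have "eps \<noteq> - 1"
  proof
    assume "eps = - 1"
    then have "eps ^ 3 = (- 1) ^ 3" by (simp only:)
    then show False using eps_props(1) by simp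
  qed
  then have e0: "eps \<noteq> 0" "eps \<noteq> 1" "eps \<noteq> -1" "eps\<^sup>2 \<noteq> 1"
    using eps_props by (auto simp: power2_eq_1_iff power3_eq_cube)
  show ?thesis
  proof (intro set_eqI iffI)
    fix X :: "complex^3^3"
    assume "X \<in> g1"
    then have t: "trace X = 0" and
      e: "vector [vector [- X$1$1, - (eps\<^sup>2 * X$3$1), - (eps * X$2$1)],
           vector [- (eps * X$1$3), - X$3$3, - (eps\<^sup>2 * X$2$3)],
           vector [- (eps\<^sup>2 * X$1$2), - (eps * X$3$2), - X$2$2]] = mat (- eps) ** X"
      by (simp_all add: g)
    have c: "vector [vector [- X$1$1, - (eps\<^sup>2 * X$3$1), - (eps * X$2$1)],
           vector [- (eps * X$1$3), - X$3$3, - (eps\<^sup>2 * X$2$3)],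
           vector [- (eps\<^sup>2 * X$1$2), - (eps * X$3$2), - X$2$2]] $ i $ j = - eps * X $ i $ j" for i j
    proof -
      have "(mat (- eps) ** X) $ i $ j = - eps * X $ i $ j"
        by (simp add: matrix_matrix_mult_def mat_def if_distrib[of "\<lambda>a. a * _"] sum.delta' cong: if_cong)
      then show ?thesis using e by simp
    qed
    have 11: "X$1$1 = 0" using c[of 1 1] e0 by simp
    have 13: "X$1$3 = X$2$1" using c[of 1 3] e0 by simp
    have a: "eps * X$3$1 = X$1$2" using c[of 1 2] e0 by (simp add: power2_eq_square mult.assoc)
    have b: "eps * X$1$2 = X$3$1" using c[of 3 1] e0 by (simp add: power2_eq_square mult.assoc)
    have "eps\<^sup>2 * X$1$2 = X$1$2" using a b by (simp add: power2_eq_square mult.assoc)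
    then have 12: "X$1$2 = 0" using e0 by simp
    have 31: "X$3$1 = 0" using b 12 by simp
    have 23: "X$2$3 = 0" using c[of 2 3] e0 by (simp add: power2_eq_square mult.assoc)
    have a: "X$3$3 = eps * X$2$2" using c[of 2 2] by simp
    have b: "X$2$2 = eps * X$3$3" using c[of 3 3] by simp
    have "eps\<^sup>2 * X$2$2 = X$2$2" using a b by (simp add: power2_eq_square mult.assoc)
    then have 22: "X$2$2 = 0" using e0 by simp
    have 33: "X$3$3 = 0" using a 22 by simp
    have "X = vector [vector [0, 0, X$2$1], vector [X$2$1, 0, 0], vector [0, X$3$2, 0]]"
      by (simp add: vec_eq_iff forall_3 11 12 13 22 23 31 33)
    then show "X \<in> {vector [vector [0, 0, \<alpha>], vector [\<alpha>, 0, 0], vector [0, \<beta>, 0]] | \<alpha> \<beta>. True}" by blast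
  next
    fix X :: "complex^3^3"
    assume "X \<in> {vector [vector [0, 0, \<alpha>], vector [\<alpha>, 0, 0], vector [0, \<beta>, 0]] | \<alpha> \<beta>. True}"
    then obtain \<alpha> \<beta> where X: "X = vector [vector [0, 0, \<alpha>], vector [\<alpha>, 0, 0], vector [0, \<beta>, 0]]" by blast
    show "X \<in> g1" unfolding g X
      by (simp add: matrix_matrix_mult_def vec_eq_iff mat_def forall_3 sum_3 trace_def)
  qed
qed

text \<open>The complexification of the real ambient space \<open>E = complex^3 \<times> complex^3^3\<close> of \<open>fl_emb\<close> is
  \<open>E \<times> E\<close>, the pair \<open>(u, v)\<close> standing for \<open>u + iv\<close> with the new imaginary unit (and not the one
  inside \<open>complex^3\<close>). Likewise each element of \<open>sl3\<close>, the complexification of \<open>su3\<close>, is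
  \<open>X + \<i> Y\<close> with \<open>X, Y\<close> in \<open>su3\<close>, and the complex linear extension of the infinitesimal action
  sends it to the pair of the images of \<open>X\<close> and \<open>Y\<close>. \<open>orbit_velocity g X u\<close> says that \<open>u\<close> is the
  velocity at \<open>t = 0\<close> of \<open>g e\<^sup>t\<^sup>X\<close> applied to the base point.\<close>

definition orbit_velocity ::
  "complex^3^3 \<Rightarrow> complex^3^3 \<Rightarrow> (complex^3) \<times> (complex^3^3) \<Rightarrow> bool" where
  "orbit_velocity g X u \<longleftrightarrow>
     ((\<lambda>t::real. fl_emb (act (g ** mat_exp (t *\<^sub>R X)) base_point)) has_vector_derivative u) (at 0)"

definition g1_bundle ::
  "(complex^3) \<times> (complex^3) set \<Rightarrow>
   (((complex^3) \<times> (complex^3^3)) \<times> ((complex^3) \<times> (complex^3^3))) set" where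
  "g1_bundle q = {(u, v). \<exists>g\<in>SU3. \<exists>X\<in>su3. \<exists>Y\<in>su3. act g base_point = q \<and>
     X + mat \<i> ** Y \<in> g1 \<and> orbit_velocity g X u \<and> orbit_velocity g Y v}"

text \<open>A smoothly immersed surface in \<open>FL2\<close> for which
  \<open>d\<psi>(\<partial>/\<partial>z) = (1/2) d\<psi>(\<partial>/\<partial>x) + i (-1/2) d\<psi>(\<partial>/\<partial>y)\<close> takes values in \<open>[g1]\<close>.\<close>

definition primitive :: "'m chart set \<Rightarrow> ('m \<Rightarrow> (complex^3) \<times> (complex^3) set) \<Rightarrow> bool" where
  "primitive A \<psi> \<longleftrightarrow> range \<psi> \<subseteq> FL2 \<and> smooth_map A (fl_emb \<circ> \<psi>) \<and>
     (\<forall>p. immersed_at A (fl_emb \<circ> \<psi>) p) \<and>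
     (\<forall>c\<in>A. \<forall>p\<in>fst c.
        ((1/2) *\<^sub>R dx c (fl_emb \<circ> \<psi>) p, (-1/2) *\<^sub>R dy c (fl_emb \<circ> \<psi>) p) \<in> g1_bundle (\<psi> p))"


section \<open>The lift of a surface in the projective plane\<close>

text \<open>The fibre at \<open>p\<close> of the pullback of the tautological bundle is \<open>\<phi> p\<close> itself.\<close>

definition ell0 :: "('m \<Rightarrow> (complex^3) set) \<Rightarrow> 'm \<Rightarrow> (complex^3) set" where
  "ell0 \<phi> p = \<phi> p"

definition local_section ::
  "'m::topological_space chart \<Rightarrow> ('m \<Rightarrow> (complex^3) set) \<Rightarrow> 'm set \<Rightarrow> ('m \<Rightarrow> complex^3) \<Rightarrow> bool" where
  "local_section c \<phi> V s \<longleftrightarrow> open V \<and> V \<subseteq> fst c \<and>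
     smooth_on (snd c ` V) (s \<circ> chart_inv c) \<and> (\<forall>q\<in>V. s q \<in> ell0 \<phi> q)"

text \<open>Here the values of \<open>s\<close> are vectors in the complex vector space \<open>complex^3\<close>, unlike those of
  \<open>fl_emb \<circ> \<psi>\<close> above.\<close>

definition dz :: "'m chart \<Rightarrow> ('m \<Rightarrow> complex^3) \<Rightarrow> 'm \<Rightarrow> complex^3" where
  "dz c s p = (1/2) *s (dx c s p - \<i> *s dy c s p)"

definition ell1 :: "'m::topological_space chart set \<Rightarrow> ('m \<Rightarrow> (complex^3) set) \<Rightarrow> 'm \<Rightarrow> (complex^3) set" where
  "ell1 A \<phi> p = vec.span
     {(mat 1 - orthproj (ell0 \<phi> p)) *v dz c s p | c V s.
        c \<in> A \<and> p \<in> V \<and> local_section c \<phi> V s}"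

definition psi2 ::
  "'m::topological_space chart set \<Rightarrow> ('m \<Rightarrow> (complex^3) set) \<Rightarrow> ('m \<Rightarrow> complex^3) \<Rightarrow>
   'm \<Rightarrow> (complex^3) \<times> (complex^3) set" where
  "psi2 A \<phi> f p = (f p, {u + v | u v. u \<in> ell0 \<phi> p \<and> v \<in> ell1 A \<phi> p})"

end

theory Submission
  imports Defs
begin

text \<open>Let \<open>f\<close> be a horizontal lift of a Lagrangian surface and \<open>z = x + iy\<close> a conformal coordinate. Differentiating
the horizontality of \<open>f\<close> and using the symmetry of second derivatives shows that the Hermitian products of
\<open>f\<^sub>x\<close> and \<open>f\<^sub>y\<close> are real (\<open>legendrian_patch.herm_derivatives_real\<close>), so conformality makes \<open>f, f\<^sub>x, f\<^sub>y\<close>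
Hermitian orthogonal. Hence \<open>f, d_z f / r, - d_zbar f / r\<close> with \<open>r = |d_z f|\<close> is a unitary frame \<open>g\<close> adapted to the flag
\<open>\<psi>\<^sub>2\<close>. In \<open>g* d_z g\<close> the entries \<open>(2,1)\<close> and \<open>(1,3)\<close> are both equal to \<open>r\<close>, thanks to the minus sign, the entry \<open>(1,1)\<close>
vanishes because \<open>f\<close> is horizontal, \<open>(3,1)\<close> and \<open>(1,2)\<close> vanish because the frame is orthogonal, and \<open>(2,3)\<close> vanishes because minimality says that
\<open>d_z d_zbar f\<close> is a multiple of \<open>f\<close>. Up to diagonal terms, which do not move the flag, \<open>g* d_z g\<close> therefore lies in
\<open>g1\<close> (\<open>minimal_legendrian_patch.flag_projection_derivative\<close>). What remains is that \<open>g\<close> should have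
determinant one. The determinant is, up to the factor \<open>-i\<close>, the phase
\<open>det (f, f\<^sub>x, f\<^sub>y) / |f\<^sub>x|\<^sup>2\<close>. It does not depend on the holomorphic coordinate, it is locally constant for a minimal
surface (\<open>minimal_legendrian_patch.frame_phase_stationary\<close>), hence constant on a connected one, and it gets
multiplied by \<open>u\<^sup>3\<close> when \<open>f\<close> is replaced by \<open>u f\<close>; so a cube root provides the required choice of \<open>f\<close>.

Minimality is assumed in \<open>\<complex>\<P>\<^sup>2\<close>, that is for the matrices \<open>P = f f*\<close>. The tangent space of \<open>\<complex>\<P>\<^sup>2\<close> at \<open>P\<close> consists of
the \<open>v f* + f v*\<close> with \<open>v\<close> orthogonal to \<open>f\<close> (\<open>tangent_space_CP2\<close>), and the product of the Laplacian of \<open>P\<close> with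
such a vector is \<open>2 Re \<langle>\<Delta>f, v\<rangle>\<close> (\<open>legendrian_patch.lap_H_tangent\<close>); this translates between the two
notions of minimality.

Conversely, the shape of \<open>g1\<close> says that a primitive \<open>(f, W)\<close> has \<open>d_z f\<close> in \<open>W\<close> and orthogonal to \<open>f\<close>, and \<open>d_zbar f\<close> orthogonal
to \<open>W\<close> and of the same length. So \<open>f\<close> is Legendrian and conformal, and the projection \<open>Q\<close> onto \<open>W\<close> satisfies
\<open>Q (d_z f) = d_z f\<close> and \<open>Q (d_zbar f) = 0\<close>. Differentiating these two equations, with the derivative of \<open>Q\<close> again given by \<open>g1\<close>, yields
that \<open>d_z d_zbar f\<close> is a real multiple of \<open>f\<close> (\<open>flag_patch_laplacian\<close>), so \<open>f\<close> is harmonic into the sphere, and so is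
its projection to \<open>\<complex>\<P>\<^sup>2\<close> (\<open>legendrian_harmonic_conclusion\<close>).\<close>

section \<open>Calculus of smooth maps on open sets\<close>

definition pd :: "'a::real_normed_vector \<Rightarrow> ('a \<Rightarrow> 'b::real_normed_vector) \<Rightarrow> 'a \<Rightarrow> 'b" where
  "pd v F z = frechet_derivative F (at z) v"

lemma pd_eqI: "(F has_derivative F') (at z) \<Longrightarrow> pd v F z = F' v"
  unfolding pd_def using frechet_derivative_at by fastforce

lemma has_derivative_pd: "F differentiable (at z) \<Longrightarrow> (F has_derivative (\<lambda>v. pd v F z)) (at z)"
  unfolding pd_def using frechet_derivative_works by metis

lemma Ck_on_Suc_pd:
  "Ck_on (Suc k) S F \<longleftrightarrow> (\<forall>x\<in>S. F differentiable (at x)) \<and> (\<forall>v. Ck_on k S (pd v F))"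
  by (simp add: pd_def[abs_def])

lemma differentiable_cong_open:
  assumes "open S" "z \<in> S" "\<And>x. x \<in> S \<Longrightarrow> F x = G x" "G differentiable (at z)"
  shows "F differentiable (at z)"
  using has_derivative_transform_within_open[of G _ z UNIV S F] assms unfolding differentiable_def
  by metis

lemma pd_cong:
  assumes "open S" "z \<in> S" "\<And>x. x \<in> S \<Longrightarrow> F x = G x"
  shows "pd v F z = pd v G z"
proof -
  have "(F has_derivative D) (at z) \<longleftrightarrow> (G has_derivative D) (at z)" for D
    using has_derivative_transform_within_open[of G D z UNIV S F]
      has_derivative_transform_within_open[of F D z UNIV S G] assms by metis
  then show ?thesis by (simp add: pd_def frechet_derivative_def)
qed

lemma Ck_on_cong:
  assumes S: "open S" and eq: "\<And>x. x \<in> S \<Longrightarrow> F x = G x"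
  shows "Ck_on k S F \<longleftrightarrow> Ck_on k S G"
  using eq
proof (induction k arbitrary: F G)
  case 0
  then show ?case using continuous_on_cong by auto
next
  case (Suc k)
  have "(\<forall>x\<in>S. F differentiable at x) \<longleftrightarrow> (\<forall>x\<in>S. G differentiable at x)"
    using differentiable_cong_open[OF S] Suc.prems by metis
  moreover have "Ck_on k S (pd v F) \<longleftrightarrow> Ck_on k S (pd v G)" for v
    by (rule Suc.IH) (rule pd_cong[OF S _ Suc.prems])
  ultimately show ?case unfolding Ck_on_Suc_pd by simp
qed

lemma Ck_on_SucD: "Ck_on (Suc k) S F \<Longrightarrow> Ck_on k S F"
proof (induction k arbitrary: F)
  case 0
  then show ?case
    by (auto simp: continuous_on_eq_continuous_at intro!: continuous_at_imp_continuous_on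
        differentiable_imp_continuous_within)
qed (auto simp: Ck_on_Suc_pd simp del: Ck_on.simps)

lemma Ck_on_const: "Ck_on k S (\<lambda>x. c)"
  by (induction k arbitrary: c) (auto)

lemma (in bounded_linear) pd_linear:
  assumes "F differentiable (at z)"
  shows "pd v (\<lambda>x. f (F x)) z = f (pd v F z)"
  by (rule pd_eqI) (rule has_derivative[OF has_derivative_pd[OF assms]])

lemma (in bounded_linear) Ck_on_linear:
  assumes "open S" "Ck_on k S F"
  shows "Ck_on k S (\<lambda>x. f (F x))"
  using assms(2)
proof (induction k arbitrary: F)
  case 0
  then show ?case by (auto intro: continuous_on)
next
  case (Suc k)
  have d: "F differentiable at x" if "x \<in> S" for x using Suc.prems that by auto
  then have "(\<lambda>x. f (F x)) differentiable at x" if "x \<in> S" for x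
    using has_derivative[OF has_derivative_pd[OF d[OF that]]] unfolding differentiable_def by blast
  moreover have "Ck_on k S (pd v (\<lambda>x. f (F x)))" for v
    using Suc.IH[of "pd v F"] Suc.prems Ck_on_cong[OF assms(1), of "pd v (\<lambda>x. f (F x))" "\<lambda>x. f (pd v F x)"]
      pd_linear[OF d] by (simp add: Ck_on_Suc_pd del: Ck_on.simps)
  ultimately show ?case by (simp add: Ck_on_Suc_pd del: Ck_on.simps)
qed

lemma pd_add:
  "F differentiable (at z) \<Longrightarrow> G differentiable (at z) \<Longrightarrow>
    pd v (\<lambda>x. F x + G x) z = pd v F z + pd v G z"
  by (rule pd_eqI) (intro has_derivative_add has_derivative_pd)

lemma Ck_on_add:
  assumes "open S" "Ck_on k S F" "Ck_on k S G"
  shows "Ck_on k S (\<lambda>x. F x + G x)"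
  using assms(2,3)
proof (induction k arbitrary: F G)
  case (Suc k)
  have "pd v (\<lambda>x. F x + G x) x = pd v F x + pd v G x" if "x \<in> S" for v x
    by (rule pd_add) (use Suc.prems that in auto)
  then have "Ck_on k S (pd v (\<lambda>x. F x + G x)) \<longleftrightarrow> Ck_on k S (\<lambda>x. pd v F x + pd v G x)" for v
    by (rule Ck_on_cong[OF assms(1)])
  then have "Ck_on k S (pd v (\<lambda>x. F x + G x))" for v
    using Suc.IH[of "pd v F" "pd v G"] Suc.prems by (simp add: Ck_on_Suc_pd del: Ck_on.simps)
  then show ?case using Suc.prems by (simp add: Ck_on_Suc_pd del: Ck_on.simps)
qed (auto intro: continuous_on_add)

lemma (in bounded_bilinear) pd_bilinear:
  assumes "F differentiable (at z)" "G differentiable (at z)"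
  shows "pd v (\<lambda>x. prod (F x) (G x)) z = prod (F z) (pd v G z) + prod (pd v F z) (G z)"
  by (rule pd_eqI) (rule FDERIV[OF assms[THEN has_derivative_pd]])

lemma (in bounded_bilinear) differentiable_bilinear:
  assumes "F differentiable (at z)" "G differentiable (at z)"
  shows "(\<lambda>x. prod (F x) (G x)) differentiable (at z)"
  using FDERIV[OF assms[THEN has_derivative_pd]] unfolding differentiable_def by blast

lemma (in bounded_bilinear) Ck_on_bilinear:
  assumes "open S" "Ck_on k S F" "Ck_on k S G"
  shows "Ck_on k S (\<lambda>x. prod (F x) (G x))"
  using assms(2,3)
proof (induction k arbitrary: F G)
  case 0
  then show ?case by (auto intro: continuous_on)
next
  case (Suc k)
  have d: "F differentiable at x" "G differentiable at x" if "x \<in> S" for x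
    using Suc.prems that by auto
  have "Ck_on k S (\<lambda>x. prod (F x) (pd v G x) + prod (pd v F x) (G x))" for v
    using Suc.IH[of F "pd v G"] Suc.IH[of "pd v F" G] Suc.prems[THEN Ck_on_SucD] Suc.prems
    by (intro Ck_on_add assms) (simp_all add: Ck_on_Suc_pd del: Ck_on.simps)
  then have "Ck_on k S (pd v (\<lambda>x. prod (F x) (G x)))" for v
    using Ck_on_cong[OF assms(1), of "pd v (\<lambda>x. prod (F x) (G x))" "\<lambda>x. prod (F x) (pd v G x) + prod (pd v F x) (G x)"]
      pd_bilinear[OF d] by blast
  then show ?case using differentiable_bilinear[OF d] by (simp add: Ck_on_Suc_pd del: Ck_on.simps)
qed

lemma Ck_on_inverse:
  fixes F :: "'a::real_normed_vector \<Rightarrow> real"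
  assumes "open S" "Ck_on k S F" "\<And>x. x \<in> S \<Longrightarrow> F x \<noteq> 0"
  shows "Ck_on k S (\<lambda>x. inverse (F x))"
  using assms(2)
proof (induction k)
  case 0
  then show ?case using assms(3) by (auto intro: continuous_on_inverse)
next
  case (Suc k)
  have IH: "Ck_on k S (\<lambda>x. inverse (F x))" using Suc Ck_on_SucD by blast
  have d: "((\<lambda>x. inverse (F x)) has_derivative (\<lambda>v. - (inverse (F x) * pd v F x * inverse (F x)))) (at x)"
    if "x \<in> S" for x
    using Deriv.has_derivative_inverse[where f = F and f' = "\<lambda>v. pd v F x"] Suc.prems that assms(3) has_derivative_pd[of F x]
    by auto
  have "Ck_on k S (\<lambda>x. - (inverse (F x) * pd v F x * inverse (F x)))" for v
    by (intro bounded_linear.Ck_on_linear[OF bounded_linear_minus[OF bounded_linear_ident]]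
        bounded_bilinear.Ck_on_bilinear[OF bounded_bilinear_mult] IH assms)
      (use Suc.prems in \<open>auto simp add: Ck_on_Suc_pd simp del: Ck_on.simps\<close>)
  then have "Ck_on k S (pd v (\<lambda>x. inverse (F x)))" for v
    using Ck_on_cong[OF assms(1), of "pd v (\<lambda>x. inverse (F x))" "\<lambda>x. - (inverse (F x) * pd v F x * inverse (F x))"]
      pd_eqI[OF d] by blast
  moreover have "(\<lambda>x. inverse (F x)) differentiable at x" if "x \<in> S" for x
    using d[OF that] unfolding differentiable_def by blast
  ultimately show ?case by (simp add: Ck_on_Suc_pd del: Ck_on.simps)
qed

lemma smooth_onD:
  assumes "smooth_on S F"
  shows "x \<in> S \<Longrightarrow> F differentiable (at x)" and "smooth_on S (pd v F)" and "continuous_on S F"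
proof -
  have "Ck_on (Suc k) S F" "Ck_on k S F" for k using assms by (auto simp: smooth_on_def simp del: Ck_on.simps)
  from this(1)[of 0] this(1) this(2)[of 0]
  show "x \<in> S \<Longrightarrow> F differentiable (at x)" "smooth_on S (pd v F)" "continuous_on S F"
    unfolding Ck_on_Suc_pd smooth_on_def by auto
qed

lemma smooth_on_cong:
  "open S \<Longrightarrow> (\<And>x. x \<in> S \<Longrightarrow> F x = G x) \<Longrightarrow> smooth_on S F \<longleftrightarrow> smooth_on S G"
  unfolding smooth_on_def using Ck_on_cong by blast

lemma smooth_on_const: "smooth_on S (\<lambda>x. c)"
  by (simp add: smooth_on_def Ck_on_const)

lemma smooth_on_add:
  "open S \<Longrightarrow> smooth_on S F \<Longrightarrow> smooth_on S G \<Longrightarrow> smooth_on S (\<lambda>x. F x + G x)"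
  by (simp add: smooth_on_def Ck_on_add)

lemma (in bounded_linear) smooth_on_linear:
  "open S \<Longrightarrow> smooth_on S F \<Longrightarrow> smooth_on S (\<lambda>x. f (F x))"
  by (simp add: smooth_on_def Ck_on_linear)

lemma (in bounded_bilinear) smooth_on_bilinear:
  "open S \<Longrightarrow> smooth_on S F \<Longrightarrow> smooth_on S G \<Longrightarrow> smooth_on S (\<lambda>x. prod (F x) (G x))"
  by (simp add: smooth_on_def Ck_on_bilinear)

lemma smooth_on_inverse:
  fixes F :: "'a::real_normed_vector \<Rightarrow> real"
  shows "open S \<Longrightarrow> smooth_on S F \<Longrightarrow> (\<And>x. x \<in> S \<Longrightarrow> F x \<noteq> 0) \<Longrightarrow> smooth_on S (\<lambda>x. inverse (F x))"
  by (simp add: smooth_on_def Ck_on_inverse)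

lemma smooth_on_Pair:
  assumes "open S" "smooth_on S F" "smooth_on S G"
  shows "smooth_on S (\<lambda>x. (F x, G x))"
proof -
  have "smooth_on S (\<lambda>x. (F x, 0) + (0, G x))"
    by (intro smooth_on_add assms bounded_linear.smooth_on_linear[of "\<lambda>x. (x, 0)"]
      bounded_linear.smooth_on_linear[of "\<lambda>x. (0, x)"] bounded_linear_Pair bounded_linear_ident bounded_linear_zero)
  then show ?thesis by simp
qed

lemma second_difference_mean_value:
  fixes g :: "'a::real_normed_vector \<Rightarrow> real"
  assumes t: "0 < t"
    and S: "\<And>a b. \<lbrakk>0 \<le> a; a \<le> t; 0 \<le> b; b \<le> t\<rbrakk> \<Longrightarrow> z + a *\<^sub>R u + b *\<^sub>R v \<in> S"
    and g: "\<And>x. x \<in> S \<Longrightarrow> g differentiable (at x)" "\<And>x. x \<in> S \<Longrightarrow> pd u g differentiable (at x)"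
  shows "\<exists>a b. 0 < a \<and> a < t \<and> 0 < b \<and> b < t \<and>
    g (z + t *\<^sub>R u + t *\<^sub>R v) - g (z + t *\<^sub>R u) - g (z + t *\<^sub>R v) + g z
      = t\<^sup>2 * pd v (pd u g) (z + a *\<^sub>R u + b *\<^sub>R v)"
proof -
  have 1: "((\<lambda>s. g (z + s *\<^sub>R u + b *\<^sub>R v)) has_real_derivative pd u g (z + s *\<^sub>R u + b *\<^sub>R v)) (at s)"
    if "0 \<le> s" "s \<le> t" "0 \<le> b" "b \<le> t" for s b
  proof -
    have "((\<lambda>s. g (z + s *\<^sub>R u + b *\<^sub>R v)) has_derivative (\<lambda>h. pd (h *\<^sub>R u) g (z + s *\<^sub>R u + b *\<^sub>R v))) (at s)"
      by (rule has_derivative_compose[where f = "\<lambda>s. z + s *\<^sub>R u + b *\<^sub>R v" and f' = "\<lambda>h. h *\<^sub>R u" and g = g,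
          OF _ has_derivative_pd[OF g(1)[OF S[OF that]]]]) (auto intro!: derivative_eq_intros)
    moreover have "pd (h *\<^sub>R u) g x = h * pd u g x" if "g differentiable (at x)" for h x
      using linear_scale[OF has_derivative_linear[OF has_derivative_pd[OF that]], of h u] by simp
    ultimately show ?thesis using g(1)[OF S[OF that]] by (simp add: has_field_derivative_def mult.commute[of _ "pd _ _ _"])
  qed
  have 2: "((\<lambda>b. pd u g (z + s *\<^sub>R u + b *\<^sub>R v)) has_real_derivative pd v (pd u g) (z + s *\<^sub>R u + b *\<^sub>R v)) (at b)"
    if "0 \<le> s" "s \<le> t" "0 \<le> b" "b \<le> t" for s b
  proof -
    have "((\<lambda>b. pd u g (z + s *\<^sub>R u + b *\<^sub>R v)) has_derivative (\<lambda>h. pd (h *\<^sub>R v) (pd u g) (z + s *\<^sub>R u + b *\<^sub>R v))) (at b)"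
      by (rule has_derivative_compose[where f = "\<lambda>b. z + s *\<^sub>R u + b *\<^sub>R v" and f' = "\<lambda>h. h *\<^sub>R v" and g = "pd u g",
          OF _ has_derivative_pd[OF g(2)[OF S[OF that]]]]) (auto intro!: derivative_eq_intros)
    moreover have "pd (h *\<^sub>R v) (pd u g) x = h * pd v (pd u g) x" if "pd u g differentiable (at x)" for h x
      using linear_scale[OF has_derivative_linear[OF has_derivative_pd[OF that]], of h v] by simp
    ultimately show ?thesis using g(2)[OF S[OF that]] by (simp add: has_field_derivative_def mult.commute[of _ "pd _ _ _"])
  qed
  have "((\<lambda>s. g (z + s *\<^sub>R u + t *\<^sub>R v) - g (z + s *\<^sub>R u + 0 *\<^sub>R v)) has_real_derivative
     (pd u g (z + s *\<^sub>R u + t *\<^sub>R v) - pd u g (z + s *\<^sub>R u + 0 *\<^sub>R v))) (at s)" if "0 \<le> s" "s \<le> t" for s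
    by (intro DERIV_diff 1) (use that t in auto)
  from MVT2[OF t this] obtain a where a: "0 < a" "a < t" 
    "(g (z + t *\<^sub>R u + t *\<^sub>R v) - g (z + t *\<^sub>R u + 0 *\<^sub>R v)) - (g (z + 0 *\<^sub>R u + t *\<^sub>R v) - g (z + 0 *\<^sub>R u + 0 *\<^sub>R v))
      = (t - 0) * (pd u g (z + a *\<^sub>R u + t *\<^sub>R v) - pd u g (z + a *\<^sub>R u + 0 *\<^sub>R v))" by blast
  from a have "\<And>b. 0 \<le> b \<Longrightarrow> b \<le> t \<Longrightarrow>
     ((\<lambda>b. pd u g (z + a *\<^sub>R u + b *\<^sub>R v)) has_real_derivative pd v (pd u g) (z + a *\<^sub>R u + b *\<^sub>R v)) (at b)"
    by (intro 2) auto
  from MVT2[OF t this] obtain b where "0 < b" "b < t"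
     "pd u g (z + a *\<^sub>R u + t *\<^sub>R v) - pd u g (z + a *\<^sub>R u + 0 *\<^sub>R v) = (t - 0) * pd v (pd u g) (z + a *\<^sub>R u + b *\<^sub>R v)" by blast
  with a show ?thesis
    by (intro exI[of _ a] exI[of _ b]) (simp add: power2_eq_square algebra_simps)
qed

text \<open>The second difference of \<open>g\<close> over the parallelogram with sides \<open>t u\<close> and \<open>t v\<close> is symmetric in \<open>u\<close> and \<open>v\<close>. By the
mean value theorem it is \<open>t\<^sup>2\<close> times either mixed derivative at nearby points, and both mixed
derivatives are continuous.\<close>

lemma pd_commute_real:
  fixes g :: "'a::real_normed_vector \<Rightarrow> real"
  assumes S: "open S" "z \<in> S" and g: "smooth_on S g"
  shows "pd v (pd u g) z = pd u (pd v g) z"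
proof (rule ccontr)
  assume ne: "pd v (pd u g) z \<noteq> pd u (pd v g) z"
  define e where "e = \<bar>pd v (pd u g) z - pd u (pd v g) z\<bar> / 2"
  have e: "e > 0" using ne by (simp add: e_def)
  note d = smooth_onD(1)[OF g] smooth_onD(1)[OF smooth_onD(2)[OF g]]
  have c: "isCont (pd v (pd u g)) z" for u v
    using smooth_onD(3)[OF smooth_onD(2)[OF smooth_onD(2)[OF g]]] S by (simp add: continuous_on_eq_continuous_at)
  have "\<forall>\<^sub>F x in nhds z. x \<in> S \<and> dist (pd v (pd u g) x) (pd v (pd u g) z) < e \<and>
      dist (pd u (pd v g) x) (pd u (pd v g) z) < e"
    using c[of v u] c[of u v] e S
    by (intro eventually_conj) (auto simp: eventually_nhds_in_open isCont_def tendsto_at_iff_tendsto_nhds intro: tendstoD)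
  then obtain r where r: "r > 0" "\<And>x. dist x z < r \<Longrightarrow> x \<in> S \<and> dist (pd v (pd u g) x) (pd v (pd u g) z) < e \<and>
      dist (pd u (pd v g) x) (pd u (pd v g) z) < e"
    unfolding eventually_nhds_metric by blast
  define t where "t = r / (norm u + norm v + 1)"
  have n: "norm u + norm v + 1 > 0" by (smt (verit) norm_ge_zero)
  have t: "t > 0" using r n by (simp add: t_def)
  have near: "dist (z + a *\<^sub>R u + b *\<^sub>R v) z < r" if "0 \<le> a" "a \<le> t" "0 \<le> b" "b \<le> t" for a b
  proof -
    have "norm (a *\<^sub>R u + b *\<^sub>R v) \<le> a * norm u + b * norm v"
      using norm_triangle_ineq[of "a *\<^sub>R u" "b *\<^sub>R v"] that by simp
    also have "\<dots> \<le> t * norm u + t * norm v" by (intro add_mono mult_right_mono that) auto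
    also have "\<dots> < t * (norm u + norm v + 1)" using t by (simp add: algebra_simps)
    also have "\<dots> = r" using n by (simp add: t_def)
    finally show ?thesis by (simp add: dist_norm add.assoc)
  qed
  obtain a b where ab: "0 < a" "a < t" "0 < b" "b < t"
    "g (z + t *\<^sub>R u + t *\<^sub>R v) - g (z + t *\<^sub>R u) - g (z + t *\<^sub>R v) + g z
      = t\<^sup>2 * pd v (pd u g) (z + a *\<^sub>R u + b *\<^sub>R v)"
    using second_difference_mean_value[OF t, of z u v S g] near r(2) d by blast
  have near': "dist (z + a *\<^sub>R v + b *\<^sub>R u) z < r" if "0 \<le> a" "a \<le> t" "0 \<le> b" "b \<le> t" for a b
    using near[of b a] that by (simp add: add_ac)
  obtain a' b' where ab': "0 < a'" "a' < t" "0 < b'" "b' < t"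
    "g (z + t *\<^sub>R v + t *\<^sub>R u) - g (z + t *\<^sub>R v) - g (z + t *\<^sub>R u) + g z
      = t\<^sup>2 * pd u (pd v g) (z + a' *\<^sub>R v + b' *\<^sub>R u)"
    using second_difference_mean_value[OF t, of z v u S g] near' r(2) d by blast
  have "t\<^sup>2 * pd v (pd u g) (z + a *\<^sub>R u + b *\<^sub>R v) = t\<^sup>2 * pd u (pd v g) (z + a' *\<^sub>R v + b' *\<^sub>R u)"
    using ab(5) ab'(5) by (simp only: add.assoc add.commute[of "t *\<^sub>R v" "t *\<^sub>R u"])
  then have "pd v (pd u g) (z + a *\<^sub>R u + b *\<^sub>R v) = pd u (pd v g) (z + a' *\<^sub>R v + b' *\<^sub>R u)" using t by simp
  moreover have "dist (pd v (pd u g) (z + a *\<^sub>R u + b *\<^sub>R v)) (pd v (pd u g) z) < e"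
    using r(2)[OF near[of a b]] ab by simp
  moreover have "dist (pd u (pd v g) (z + a' *\<^sub>R v + b' *\<^sub>R u)) (pd u (pd v g) z) < e"
    using r(2)[OF near'[of a' b']] ab' by simp
  ultimately show False by (simp add: e_def dist_real_def abs_if split: if_splits)
qed

lemma pd_commute:
  fixes F :: "'a::real_normed_vector \<Rightarrow> 'b::euclidean_space"
  assumes S: "open S" "z \<in> S" and F: "smooth_on S F"
  shows "pd v (pd u F) z = pd u (pd v F) z"
proof (rule euclidean_eqI)
  fix b :: 'b
  note lin = bounded_linear_inner_left[of b]
  have sm: "smooth_on S (\<lambda>x. F x \<bullet> b)" by (rule bounded_linear.smooth_on_linear[OF lin S(1) F])
  have "pd w (\<lambda>x. F x \<bullet> b) x = pd w F x \<bullet> b" if "x \<in> S" for x w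
    by (rule bounded_linear.pd_linear[OF lin smooth_onD(1)[OF F that]])
  then have "pd w' (pd w (\<lambda>x. F x \<bullet> b)) z = pd w' (pd w F) z \<bullet> b" for w w'
    using pd_cong[OF S, of "pd w (\<lambda>x. F x \<bullet> b)" "\<lambda>x. pd w F x \<bullet> b" w']
      bounded_linear.pd_linear[OF lin smooth_onD(1)[OF smooth_onD(2)[OF F] S(2)]] by auto
  then show "pd v (pd u F) z \<bullet> b = pd u (pd v F) z \<bullet> b"
    using pd_commute_real[OF S sm, of v u] by simp
qed

section \<open>Hermitian algebra in three dimensions\<close>

definition herm :: "complex^3 \<Rightarrow> complex^3 \<Rightarrow> complex" where
  "herm u v = (\<Sum>i\<in>UNIV. u $ i * cnj (v $ i))"

definition outer :: "complex^3 \<Rightarrow> complex^3 \<Rightarrow> complex^3^3" where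
  "outer u v = (\<chi> i j. u $ i * cnj (v $ j))"

definition frame :: "complex^3 \<Rightarrow> complex^3 \<Rightarrow> complex^3 \<Rightarrow> complex^3^3" where
  "frame a b c = (\<chi> i j. if j = 1 then a $ i else if j = 2 then b $ i else c $ i)"

lemma herm_simps:
  "herm (u + w) v = herm u v + herm w v" "herm u (v + w) = herm u v + herm u w"
  "herm (u - w) v = herm u v - herm w v" "herm u (v - w) = herm u v - herm u w"
  "herm (- u) v = - herm u v" "herm u (- v) = - herm u v"
  "herm (k *s u) v = k * herm u v" "herm u (k *s v) = cnj k * herm u v"
  "herm (r *\<^sub>R u) v = of_real r * herm u v" "herm u (r *\<^sub>R v) = of_real r * herm u v"
  "herm 0 v = 0" "herm u 0 = 0"
  by (simp_all add: herm_def sum_3 algebra_simps scaleR_conv_of_real[where 'a=complex])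

lemma mat_mult_component: "(mat k ** (A :: complex^3^3)) $ i $ j = k * A $ i $ j"
  by (simp add: matrix_matrix_mult_def mat_def if_distrib[of "\<lambda>a. a * _"] cong: if_cong)

lemma outer_simps:
  "outer (u + w) v = outer u v + outer w v" "outer u (v + w) = outer u v + outer u w"
  "outer (u - w) v = outer u v - outer w v" "outer u (v - w) = outer u v - outer u w"
  "outer (- u) v = - outer u v" "outer u (- v) = - outer u v"
  "outer (k *s u) v = mat k ** outer u v" "outer u (k *s v) = mat (cnj k) ** outer u v"
  "outer (r *\<^sub>R u) v = r *\<^sub>R outer u v" "outer u (r *\<^sub>R v) = r *\<^sub>R outer u v"
  "outer 0 v = 0" "outer u 0 = 0"
  by (simp_all add: outer_def vec_eq_iff algebra_simps scaleR_conv_of_real[where 'a=complex] mat_mult_component)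

lemma cnj_herm: "cnj (herm u v) = herm v u"
  by (simp add: herm_def mult.commute)

lemma inner_eq_Re_herm: "u \<bullet> v = Re (herm u v)"
  by (simp add: inner_vec_def herm_def inner_complex_def)

lemma herm_self: "herm u u = of_real (u \<bullet> u)"
  by (simp add: complex_eq_iff inner_eq_Re_herm) (use cnj_herm[of u u] in \<open>simp add: complex_eq_iff\<close>)

lemma herm_eq_0_commute: "herm u v = 0 \<Longrightarrow> herm v u = 0"
  using cnj_herm[of u v] by simp

lemma inner_outer: "A \<bullet> outer u v = Re (herm (A *v v) u)"
  by (simp add: inner_vec_def herm_def outer_def inner_complex_def matrix_vector_mult_def sum_3 algebra_simps)

lemma outer_mult_vec: "outer u v *v w = herm w v *s u"
  by (simp add: herm_def outer_def matrix_vector_mult_def vec_eq_iff sum_3 algebra_simps)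

lemma mat_mult_vec: "mat k *v (w :: complex^3) = k *s w"
  by (simp add: matrix_vector_mult_def vec_eq_iff mat_def if_distrib[of "\<lambda>a. a * _"] cong: if_cong)

lemma matrix_mult_outer: "A ** outer u v = outer (A *v u) v"
  by (simp add: outer_def matrix_vector_mult_def matrix_matrix_mult_def vec_eq_iff sum_3 algebra_simps)

lemma outer_mult_matrix: "outer u v ** A = outer u (adj A *v v)"
  by (simp add: outer_def adj_def matrix_vector_mult_def matrix_matrix_mult_def vec_eq_iff sum_3 algebra_simps)

lemma adj_outer: "adj (outer u v) = outer v u"
  by (simp add: adj_def outer_def vec_eq_iff mult.commute)

lemma adj_simps:
  "adj (A + B) = adj A + adj B" "adj (A - B) = adj A - adj B" "adj (- A) = - adj A" "adj (r *\<^sub>R A) = r *\<^sub>R adj A"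
  "adj (A ** B) = adj B ** adj A" "adj (adj A) = A" "adj (mat k) = mat (cnj k)"
  by (simp_all add: adj_def vec_eq_iff matrix_matrix_mult_def mult.commute mat_def)

lemma matrix_vec_simps:
  fixes A B :: "complex^3^3"
  shows "(A + B) *v w = A *v w + B *v w" "(A - B) *v w = A *v w - B *v w" "(- A) *v w = - (A *v w)"
    "(r *\<^sub>R A) *v w = r *\<^sub>R (A *v w)" "A *v (r *\<^sub>R w) = r *\<^sub>R (A *v w)"
    "A *v (u + w) = A *v u + A *v w" "A *v (u - w) = A *v u - A *v w" "A *v (- w) = - (A *v w)"
    "A *v (k *s w) = k *s (A *v w)" "A *v 0 = 0"
  by (simp_all add: matrix_vector_mult_def vec_eq_iff sum_3 algebra_simps scaleR_conv_of_real[where 'a=complex])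

lemma bounded_bilinear_herm: "bounded_bilinear herm"
  unfolding bilinear_conv_bounded_bilinear[symmetric] bilinear_def
  by (auto intro!: linearI simp: herm_simps scaleR_conv_of_real[where 'a=complex])

lemma bounded_bilinear_outer: "bounded_bilinear outer"
  unfolding bilinear_conv_bounded_bilinear[symmetric] bilinear_def
  by (auto intro!: linearI simp: outer_simps)

lemma bounded_bilinear_matrix_vec: "bounded_bilinear ((*v) :: complex^3^3 \<Rightarrow> complex^3 \<Rightarrow> complex^3)"
  unfolding bilinear_conv_bounded_bilinear[symmetric] bilinear_def
  by (auto intro!: linearI simp: matrix_vec_simps)

lemma bounded_linear_adj: "bounded_linear adj"
  unfolding linear_conv_bounded_linear[symmetric] by (auto intro!: linearI simp: adj_simps)

lemma bounded_linear_cscale: "bounded_linear (\<lambda>v :: complex^3. k *s v)"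
  unfolding linear_conv_bounded_linear[symmetric]
  by (auto intro!: linearI simp: vec_eq_iff algebra_simps)

lemma frame_simps:
  "frame a b c *v w = w $ 1 *s a + w $ 2 *s b + w $ 3 *s c"
  "frame a b c *v axis 1 1 = a" "frame a b c *v axis 2 1 = b" "frame a b c *v axis 3 1 = c"
  by (simp_all add: frame_def matrix_vector_mult_def vec_eq_iff sum_3 axis_def algebra_simps)

lemma frame_axes: "frame (g *v axis 1 1) (g *v axis 2 1) (g *v axis 3 1) = g"
  by (simp add: frame_def matrix_vector_mult_def vec_eq_iff sum_3 axis_def forall_3)

lemma det_frame:
  "det (frame a b c) =
     a$1 * b$2 * c$3 + b$1 * c$2 * a$3 + c$1 * a$2 * b$3
     - a$1 * c$2 * b$3 - b$1 * a$2 * c$3 - c$1 * b$2 * a$3"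
  by (simp add: det_3 frame_def)

lemma unitary_frame_iff:
  "adj (frame a b c) ** frame a b c = mat 1 \<longleftrightarrow>
     herm a a = 1 \<and> herm b b = 1 \<and> herm c c = 1 \<and> herm a b = 0 \<and> herm a c = 0 \<and> herm b c = 0"
proof -
  have "adj (frame a b c) ** frame a b c = mat 1 \<longleftrightarrow>
      herm a a = 1 \<and> herm b b = 1 \<and> herm c c = 1 \<and> herm a b = 0 \<and> herm a c = 0 \<and> herm b c = 0 \<and>
      herm b a = 0 \<and> herm c a = 0 \<and> herm c b = 0"
    by (auto simp add: frame_def adj_def matrix_matrix_mult_def vec_eq_iff forall_3 mat_def herm_def mult.commute)
  then show ?thesis using herm_eq_0_commute by blast
qed

lemma unitary_frame_expand:
  assumes "adj (frame a b c) ** frame a b c = mat 1"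
  shows "w = herm w a *s a + herm w b *s b + herm w c *s c"
proof -
  have "frame a b c ** adj (frame a b c) = mat 1" using assms matrix_left_right_inverse by blast
  then have "w = frame a b c *v (adj (frame a b c) *v w)" by (simp add: matrix_vector_mul_assoc)
  then show ?thesis
    by (simp add: frame_simps) (simp add: frame_def adj_def matrix_vector_mult_def herm_def mult.commute)
qed

lemma unitary_frame_resolution:
  assumes "adj (frame a b c) ** frame a b c = mat 1"
  shows "outer a a + outer b b + outer c c = mat 1"
proof -
  have "(outer a a + outer b b + outer c c) *v w = mat 1 *v w" for w
    using unitary_frame_expand[OF assms, of w] by (simp add: matrix_vec_simps outer_mult_vec)
  then show ?thesis by (simp add: matrix_eq)
qed

lemma span_pair: "vec.span {a, b :: complex^3} = {x *s a + y *s b | x y. True}"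
proof -
  have "w - k *s a = m *s b \<longleftrightarrow> w = k *s a + m *s b" for w k m by (auto simp: algebra_simps)
  then show ?thesis by (auto simp: vec.span_insert vec.span_singleton)
qed

section \<open>Orthogonal projections and tangent spaces\<close>

text \<open>An orthogonal projection is determined by its range: two of them with the same range fix each other's values,
so \<open>P R = R\<close> and \<open>R P = P\<close>, and the adjoint of the first equation is \<open>R P = R\<close>.\<close>

lemma orthproj_eqI:
  assumes "adj P = P" "P ** P = P" "range ((*v) P) = W"
  shows "orthproj W = P"
  unfolding orthproj_def
proof (rule the_equality)
  fix R assume R: "adj R = R \<and> R ** R = R \<and> range ((*v) R) = W"
  have 1: "A ** B = B" if "A ** A = A" "range ((*v) A) = W" "range ((*v) B) = W" for A B :: "complex^3^3"
  proof -
    have "A *v (B *v w) = B *v w" for w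
    proof -
      have "B *v w \<in> range ((*v) A)" using that by auto
      then obtain x where "B *v w = A *v x" by auto
      then show ?thesis using that(1) by (simp add: matrix_vector_mul_assoc)
    qed
    then show ?thesis by (simp add: matrix_eq matrix_vector_mul_assoc)
  qed
  have "R = adj (P ** R)" using 1[of P R] assms R by simp
  also have "\<dots> = R ** P" using assms R by (simp add: adj_simps)
  also have "\<dots> = P" using 1[of R P] assms R by simp
  finally show "R = P" .
qed (use assms in auto)

lemma orthproj_line:
  assumes "herm w w = 1" shows "orthproj (vec.span {w}) = outer w w"
proof (rule orthproj_eqI)
  have "herm (k *s w) w = k" for k using assms by (simp add: herm_simps)
  then show "range ((*v) (outer w w)) = vec.span {w}"
    by (auto simp: vec.span_singleton outer_mult_vec) (metis rangeI)
qed (simp_all add: adj_outer matrix_mult_outer outer_mult_vec assms)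

lemma orthproj_plane:
  assumes u: "adj (frame a b c) ** frame a b c = mat 1"
  shows "orthproj (vec.span {a, b}) = mat 1 - outer c c"
proof (rule orthproj_eqI)
  note o = u[unfolded unitary_frame_iff]
  have e: "mat 1 - outer c c = outer a a + outer b b" using unitary_frame_resolution[OF u] by (simp add: algebra_simps)
  have "w \<in> range ((*v) (outer a a + outer b b)) \<longleftrightarrow> w \<in> vec.span {a, b}" for w
  proof
    assume "w \<in> vec.span {a, b}"
    then obtain x y where w: "w = x *s a + y *s b" by (auto simp: span_pair)
    have "(outer a a + outer b b) *v w = w"
      using o by (simp add: w matrix_vec_simps outer_mult_vec herm_simps herm_eq_0_commute)
    then show "w \<in> range ((*v) (outer a a + outer b b))" by (metis rangeI)
  qed (auto simp: matrix_vec_simps outer_mult_vec span_pair)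
  then show "range ((*v) (mat 1 - outer c c)) = vec.span {a, b}" unfolding e by blast
  interpret M: bounded_bilinear "(**) :: complex^3^3 \<Rightarrow> complex^3^3 \<Rightarrow> complex^3^3" by (rule matrix_mul_bilinear)
  show "(mat 1 - outer c c) ** (mat 1 - outer c c) = mat 1 - outer c c"
    using o by (simp add: M.diff_left M.diff_right matrix_mult_outer outer_mult_vec matrix_vec_simps outer_simps)
qed (simp add: adj_simps adj_outer)

text \<open>By Pythagoras every point of \<open>S\<close> has at least the distance of \<open>0\<close> from \<open>a\<close>, with equality only at \<open>0\<close>. In this form
harmonicity can be checked with just an upper bound for the tangent space.\<close>

lemma closest_point_eq_0I:
  assumes "0 \<in> S" "\<And>n. n \<in> S \<Longrightarrow> a \<bullet> n = 0"
  shows "closest_point S a = (0 :: 'a::euclidean_space)"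
proof -
  have *: "(dist a n)\<^sup>2 = (dist a 0)\<^sup>2 + n \<bullet> n" if "n \<in> S" for n
    using assms(2)[OF that] by (simp add: dist_norm power2_norm_eq_inner inner_diff_left inner_diff_right inner_commute)
  have le: "dist a 0 \<le> dist a n" if "n \<in> S" for n
    using *[OF that] by - (rule power2_le_imp_le, simp_all)
  have "closest_point S a \<in> S \<and> (\<forall>n\<in>S. dist a (closest_point S a) \<le> dist a n)"
    unfolding closest_point_def
    by (rule someI[of "\<lambda>x. x \<in> S \<and> (\<forall>n\<in>S. dist a x \<le> dist a n)" 0]) (use assms(1) le in blast)
  then have "closest_point S a \<in> S" "(dist a (closest_point S a))\<^sup>2 \<le> (dist a 0)\<^sup>2"
    using assms(1) by (auto intro!: power_mono simp del: dist_0_norm)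
  then have "closest_point S a \<bullet> closest_point S a \<le> 0" using *[of "closest_point S a"] by linarith
  then show ?thesis using inner_gt_zero_iff[of "closest_point S a"] by linarith
qed

lemma closest_point_eq_0D:
  fixes S :: "'a::euclidean_space set"
  assumes S: "subspace S" and 0: "closest_point S a = 0" and n: "n \<in> S"
  shows "a \<bullet> n = 0"
proof -
  note cc = subspace_imp_convex[OF S] closed_subspace[OF S]
  have "a \<bullet> n \<le> 0" using closest_point_dot[OF cc n, of a] 0 by simp
  moreover have "a \<bullet> (- n) \<le> 0" using closest_point_dot[OF cc subspace_neg[OF S n], of a] 0 by simp
  ultimately show ?thesis by simp
qed

lemma zero_in_tangent_space: "q \<in> N \<Longrightarrow> 0 \<in> tangent_space N q"
  unfolding tangent_space_def by (auto intro!: exI[of _ "\<lambda>_. q"])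

lemma tangent_space_S5: "v \<in> tangent_space S5 w \<Longrightarrow> w \<bullet> v = 0"
proof -
  assume "v \<in> tangent_space S5 w"
  then obtain \<gamma> where \<gamma>: "\<And>t::real. norm (\<gamma> t) = 1" "\<gamma> 0 = w" "(\<gamma> has_vector_derivative v) (at 0)"
    by (auto simp: tangent_space_def)
  have "((\<lambda>t. \<gamma> t \<bullet> \<gamma> t) has_vector_derivative (\<gamma> 0 \<bullet> v + v \<bullet> \<gamma> 0)) (at 0)"
    by (rule bounded_bilinear.has_vector_derivative[OF bounded_bilinear_inner \<gamma>(3) \<gamma>(3)])
  moreover have "(\<lambda>t. \<gamma> t \<bullet> \<gamma> t) = (\<lambda>t. 1)" using \<gamma>(1) by (simp flip: power2_norm_eq_inner)
  ultimately have "\<gamma> 0 \<bullet> v + v \<bullet> \<gamma> 0 = 0"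
    using vector_derivative_unique_at has_vector_derivative_const by metis
  then show ?thesis using \<gamma>(2) by (simp add: inner_commute)
qed

lemma CP2_iff: "L \<in> CP2 \<longleftrightarrow> (\<exists>w. herm w w = 1 \<and> L = vec.span {w})"
proof
  assume "L \<in> CP2"
  then have L: "vec.subspace L" "vec.dim L = 1" by (auto simp: CP2_def)
  obtain B where B: "B \<subseteq> L" "vec.independent B" "L \<subseteq> vec.span B" "card B = vec.dim L"
    using vec.basis_exists by blast
  then obtain u where u: "B = {u}" using L(2) card_1_singletonE by metis
  have u0: "u \<noteq> 0" using B(2) u vec.dependent_zero by blast
  define w where "w = of_real (inverse (norm u)) *s u"
  have "herm w w = 1" using u0
    by (simp add: w_def herm_simps herm_self[of u] flip: power2_norm_eq_inner) (simp add: field_simps power2_eq_square)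
  moreover have "vec.span {w} = vec.span {u}"
  proof -
    have "u = of_real (norm u) *s w" using u0 by (simp add: w_def)
    then have "u \<in> vec.span {w}" "w \<in> vec.span {u}"
      by (auto simp: vec.span_singleton w_def)
    then show ?thesis by (simp add: vec.span_eq)
  qed
  moreover have "L = vec.span {u}" using B u L(1) vec.span_minimal by blast
  ultimately show "\<exists>w. herm w w = 1 \<and> L = vec.span {w}" by metis
next
  assume "\<exists>w. herm w w = 1 \<and> L = vec.span {w}"
  then obtain w where w: "herm w w = 1" "L = vec.span {w}" by blast
  have "w \<noteq> 0" using w by (auto simp: herm_simps)
  then show "L \<in> CP2" by (simp add: w CP2_def)
qed

lemma CP2_emb_eq: "CP2_emb = {outer w w | w. herm w w = 1}"
proof -
  have "x \<in> CP2_emb \<longleftrightarrow> (\<exists>L. L \<in> CP2 \<and> x = orthproj L)" for x unfolding CP2_emb_def by blast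
  also have "(\<exists>L. L \<in> CP2 \<and> x = orthproj L) \<longleftrightarrow> (\<exists>w. herm w w = 1 \<and> x = outer w w)" for x
    unfolding CP2_iff using orthproj_line by metis
  finally show ?thesis by blast
qed

text \<open>Differentiating \<open>\<gamma>\<^sup>2 = \<gamma>\<close> and \<open>adj \<gamma> = \<gamma>\<close> along a curve \<open>\<gamma>\<close> shows that a tangent vector \<open>V\<close> is Hermitian with
\<open>V = P V + V P\<close>, which forces the stated form with \<open>v = V w\<close>. Conversely the vector given by \<open>v\<close> is the velocity of the curve of projections onto the
lines spanned by \<open>w + t v\<close>.\<close>

lemma tangent_space_CP2:
  assumes w: "herm w w = 1"
  shows "tangent_space CP2_emb (outer w w) = {outer v w + outer w v | v. herm v w = 0}"
proof (intro set_eqI iffI)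
  interpret M: bounded_bilinear "(**) :: complex^3^3 \<Rightarrow> complex^3^3 \<Rightarrow> complex^3^3" by (rule matrix_mul_bilinear)
  fix V assume "V \<in> tangent_space CP2_emb (outer w w)"
  then obtain \<gamma> where \<gamma>: "\<And>t::real. \<gamma> t \<in> CP2_emb" "\<gamma> 0 = outer w w" "(\<gamma> has_vector_derivative V) (at 0)"
    by (auto simp: tangent_space_def)
  have "\<gamma> t ** \<gamma> t = \<gamma> t" "adj (\<gamma> t) = \<gamma> t" for t
    using \<gamma>(1)[of t] by (auto simp: CP2_emb_eq matrix_mult_outer outer_mult_vec adj_outer)
  then have g2: "(\<lambda>t. \<gamma> t ** \<gamma> t) = \<gamma>" and ga: "(\<lambda>t. adj (\<gamma> t)) = \<gamma>" by auto
  have V: "V = outer w w ** V + V ** outer w w"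
    using vector_derivative_unique_at[OF M.has_vector_derivative[OF \<gamma>(3) \<gamma>(3), unfolded g2] \<gamma>(3)] \<gamma>(2) by simp
  have Va: "adj V = V"
    using vector_derivative_unique_at[OF bounded_linear.has_vector_derivative[OF bounded_linear_adj \<gamma>(3), unfolded ga] \<gamma>(3)] .
  have V': "V = outer (V *v w) w + outer w (V *v w)"
    using V Va by (simp add: outer_mult_matrix matrix_mult_outer add.commute)
  have "herm (V *v w) w = herm (V *v w) w + herm w (V *v w)"
    by (subst V') (simp add: matrix_vec_simps outer_mult_vec herm_simps w)
  then have "herm (V *v w) w = 0" using herm_eq_0_commute by simp
  then show "V \<in> {outer v w + outer w v | v. herm v w = 0}" using V' by blast
next
  fix V assume "V \<in> {outer v w + outer w v | v. herm v w = 0}"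
  then obtain v where V: "V = outer v w + outer w v" and vw: "herm v w = 0" by blast
  \<comment> \<open>\<open>1 / k t\<close> is the squared norm of \<open>w + t v\<close>\<close>
  define k where "k t = inverse (1 + t\<^sup>2 * (v \<bullet> v))" for t :: real
  define \<gamma> where "\<gamma> t = k t *\<^sub>R outer (w + t *\<^sub>R v) (w + t *\<^sub>R v)" for t
  have pos: "1 + t\<^sup>2 * (v \<bullet> v) > 0" for t :: real
    by (intro add_pos_nonneg mult_nonneg_nonneg) auto
  have "\<gamma> t \<in> CP2_emb" for t
  proof -
    define u where "u = sqrt (k t) *\<^sub>R (w + t *\<^sub>R v)"
    have k: "sqrt (k t) * sqrt (k t) = k t" using pos[of t] by (simp add: k_def)
    have "outer u u = (sqrt (k t) * sqrt (k t)) *\<^sub>R outer (w + t *\<^sub>R v) (w + t *\<^sub>R v)"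
      unfolding u_def outer_simps(9,10) by simp
    then have "outer u u = \<gamma> t" by (simp only: k \<gamma>_def)
    have "herm (w + t *\<^sub>R v) (w + t *\<^sub>R v) = of_real (1 + t\<^sup>2 * (v \<bullet> v))"
      by (simp add: herm_simps w vw herm_eq_0_commute herm_self[of v] power2_eq_square)
    then have "herm u u = of_real (sqrt (k t) * sqrt (k t) * (1 + t\<^sup>2 * (v \<bullet> v)))"
      unfolding u_def herm_simps(9,10) by (simp only: of_real_mult mult.assoc)
    moreover have "sqrt (k t) * sqrt (k t) * (1 + t\<^sup>2 * (v \<bullet> v)) = 1"
      unfolding k using pos[of t] by (simp add: k_def)
    ultimately have "herm u u = of_real 1" by (simp only:)
    then have "herm u u = 1" by simp
    then show ?thesis unfolding CP2_emb_eq using \<open>outer u u = \<gamma> t\<close> by (auto intro!: exI[of _ u])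
  qed
  moreover have "\<gamma> 0 = outer w w" by (simp add: \<gamma>_def k_def)
  moreover have "(\<gamma> has_vector_derivative V) (at 0)"
  proof -
    have 1: "(k has_real_derivative 0) (at 0)" unfolding k_def
      by (auto intro!: derivative_eq_intros)
    have 2: "((\<lambda>t. w + t *\<^sub>R v) has_vector_derivative v) (at 0)"
      by (auto intro!: derivative_eq_intros)
    show ?thesis unfolding \<gamma>_def
      using has_vector_derivative_scaleR[OF 1 bounded_bilinear.has_vector_derivative[OF bounded_bilinear_outer 2 2]]
      by (simp add: k_def V add.commute)
  qed
  ultimately show "V \<in> tangent_space CP2_emb (outer w w)" by (auto simp: tangent_space_def)
qed

section \<open>Orbit velocities and the bundle of the eigenspace\<close>

text \<open>Entry by entry, the exponential is a complex power series in \<open>t\<close> and can be differentiated termwise. Away from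
\<open>t = 0\<close> the derivative is needed for the unitarity of \<open>mat_exp\<close> on skew-Hermitian matrices.\<close>

lemma mat_exp_has_vector_derivative_at:
  "((\<lambda>t. mat_exp (t *\<^sub>R X)) has_vector_derivative X ** mat_exp (t *\<^sub>R X)) (at t)"
proof -
  interpret M: bounded_bilinear "(**) :: complex^3^3 \<Rightarrow> complex^3^3 \<Rightarrow> complex^3^3" by (rule matrix_mul_bilinear)
  obtain K where K: "K \<ge> 0" "\<And>(a::complex^3^3) (b::complex^3^3). norm (a ** b) \<le> norm a * norm b * K"
    using M.nonneg_bounded by auto
  define c where "c k = (1 / fact k) *\<^sub>R (((**) X ^^ k) (mat 1 :: complex^3^3))" for k
  have pw: "norm (((**) X ^^ k) (mat 1 :: complex^3^3)) \<le> norm (mat 1 :: complex^3^3) * (norm X * K) ^ k" for k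
  proof (induction k)
    case (Suc k)
    have "norm (((**) X ^^ Suc k) (mat 1 :: complex^3^3)) \<le> norm X * norm (((**) X ^^ k) (mat 1 :: complex^3^3)) * K"
      using K(2) by simp
    also have "\<dots> \<le> norm X * (norm (mat 1 :: complex^3^3) * (norm X * K) ^ k) * K"
      by (intro mult_right_mono mult_left_mono Suc K) auto
    finally show ?case by (simp add: mult_ac)
  qed simp
  have cB: "norm (c k) * r ^ k \<le> norm (mat 1 :: complex^3^3) * (inverse (fact k) * (norm X * K * r) ^ k)" if "r \<ge> 0" for r k
  proof -
    have "norm (c k) * r ^ k \<le> (norm (mat 1 :: complex^3^3) * (norm X * K) ^ k / fact k) * r ^ k"
      using pw[of k] that by (intro mult_right_mono) (auto simp: c_def divide_right_mono)
    then show ?thesis by (simp add: power_mult_distrib field_simps)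
  qed
  have sr: "summable (\<lambda>k. norm (c k) * r ^ k)" if "r \<ge> 0" for r
    by (rule summable_comparison_test'[OF summable_mult[OF summable_exp]]) (use cB that in auto)
  have sM: "summable (\<lambda>k. t ^ k *\<^sub>R c k)" for t :: real
    by (rule summable_norm_cancel) (use sr[of "\<bar>t\<bar>"] in \<open>simp add: power_abs mult.commute\<close>)
  have ex: "mat_exp (t *\<^sub>R X) = (\<Sum>k. t ^ k *\<^sub>R c k)" for t
    unfolding mat_exp_def c_def by (simp add: mat_pow_scaleR mult.commute)
  have sc: "summable (\<lambda>k. c k $ i $ j * z ^ k)" for i j z
  proof (rule summable_comparison_test'[OF sr[of "norm z"]])
    fix k
    have "norm (c k $ i $ j) \<le> norm (c k)" 
      by (rule order_trans[OF Finite_Cartesian_Product.norm_nth_le Finite_Cartesian_Product.norm_nth_le])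
    then show "norm (c k $ i $ j * z ^ k) \<le> norm (c k) * norm z ^ k"
      by (simp add: norm_mult norm_power mult_right_mono)
  qed simp
  have lin: "bounded_linear (\<lambda>A :: complex^3^3. A $ i $ j)" for i j
    by (rule bounded_linear_compose[OF bounded_linear_vec_nth bounded_linear_vec_nth])
  have comp: "mat_exp (t *\<^sub>R X) $ i $ j = (\<Sum>k. c k $ i $ j * of_real t ^ k)" for i j t
    unfolding ex bounded_linear.suminf[OF lin sM]
    by (simp add: scaleR_conv_of_real[where 'a=complex] mult.commute)
  have diffs: "diffs (\<lambda>k. c k $ i $ j) k = (\<Sum>l\<in>UNIV. X $ i $ l * c k $ l $ j)" for i j k
  proof -
    have "c (Suc k) = (1 / Suc k) *\<^sub>R (X ** c k)"
      by (simp add: c_def M.scaleR_right)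
    then have "Suc k *\<^sub>R c (Suc k) = X ** c k" by simp
    then have "(Suc k *\<^sub>R c (Suc k)) $ i $ j = (X ** c k) $ i $ j" by simp
    then show ?thesis by (simp add: diffs_def matrix_matrix_mult_def scaleR_conv_of_real[where 'a=complex])
  qed
  have entry: "((\<lambda>t. mat_exp (t *\<^sub>R X) $ i $ j) has_vector_derivative (X ** mat_exp (t *\<^sub>R X)) $ i $ j) (at t)" for i j
  proof -
    have "(\<Sum>k. diffs (\<lambda>k. c k $ i $ j) k * of_real t ^ k) = (\<Sum>k. \<Sum>l\<in>UNIV. X $ i $ l * (c k $ l $ j * of_real t ^ k))"
      unfolding diffs by (simp add: sum_distrib_right mult.assoc)
    also have "\<dots> = (\<Sum>l\<in>UNIV. \<Sum>k. X $ i $ l * (c k $ l $ j * of_real t ^ k))"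
      by (intro suminf_sum summable_mult sc)
    also have "\<dots> = (X ** mat_exp (t *\<^sub>R X)) $ i $ j"
      by (simp add: matrix_matrix_mult_def comp suminf_mult sc)
    finally have d: "(\<Sum>k. diffs (\<lambda>k. c k $ i $ j) k * of_real t ^ k) = (X ** mat_exp (t *\<^sub>R X)) $ i $ j" .
    have "((\<lambda>z. \<Sum>k. c k $ i $ j * z ^ k) has_field_derivative (X ** mat_exp (t *\<^sub>R X)) $ i $ j) (at (of_real t))"
      using termdiffs_strong_converges_everywhere[OF sc, of i j "of_real t"] by (simp only: d)
    from has_vector_derivative_real_field[OF this]
    show ?thesis by (simp add: comp)
  qed
  have "linear (\<lambda>z. axis i (axis j z) :: complex^3^3)" for i j
    by (rule linearI) (simp_all add: vec_eq_iff axis_def)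
  then have unit: "bounded_linear (\<lambda>z. axis i (axis j z) :: complex^3^3)" for i j
    by (simp add: linear_conv_bounded_linear)
  have "((\<lambda>t. \<Sum>i\<in>UNIV. \<Sum>j\<in>UNIV. axis i (axis j (mat_exp (t *\<^sub>R X) $ i $ j))) has_vector_derivative
      (\<Sum>i\<in>UNIV. \<Sum>j\<in>UNIV. axis i (axis j ((X ** mat_exp (t *\<^sub>R X)) $ i $ j)))) (at t)"
    by (intro has_vector_derivative_sum bounded_linear.has_vector_derivative[OF unit entry])
  moreover have "(\<Sum>i\<in>UNIV. \<Sum>j\<in>UNIV. axis i (axis j (A $ i $ j))) = A" for A :: "complex^3^3"
    by (simp add: vec_eq_iff forall_3 sum_3 axis_def)
  ultimately show ?thesis by simp
qed

lemma mat_exp_unitary: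
  assumes X: "adj X = - X"
  shows "adj (mat_exp (t *\<^sub>R X)) ** mat_exp (t *\<^sub>R X) = mat 1"
proof -
  interpret M: bounded_bilinear "(**) :: complex^3^3 \<Rightarrow> complex^3^3 \<Rightarrow> complex^3^3" by (rule matrix_mul_bilinear)
  have d: "((\<lambda>t. adj (mat_exp (t *\<^sub>R X)) ** mat_exp (t *\<^sub>R X)) has_vector_derivative 0) (at t)" for t
  proof -
    have "((\<lambda>t. adj (mat_exp (t *\<^sub>R X)) ** mat_exp (t *\<^sub>R X)) has_vector_derivative
      adj (mat_exp (t *\<^sub>R X)) ** (X ** mat_exp (t *\<^sub>R X)) + adj (X ** mat_exp (t *\<^sub>R X)) ** mat_exp (t *\<^sub>R X)) (at t)"
      by (rule M.has_vector_derivative[OF bounded_linear.has_vector_derivative[OF bounded_linear_adj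
          mat_exp_has_vector_derivative_at] mat_exp_has_vector_derivative_at])
    moreover have "adj (mat_exp (t *\<^sub>R X)) ** (X ** mat_exp (t *\<^sub>R X)) + adj (X ** mat_exp (t *\<^sub>R X)) ** mat_exp (t *\<^sub>R X) = 0"
      by (simp add: adj_simps X M.minus_right M.minus_left matrix_mul_assoc)
    ultimately show ?thesis by simp
  qed
  have "\<exists>c. \<forall>t\<in>UNIV. adj (mat_exp (t *\<^sub>R X)) ** mat_exp (t *\<^sub>R X) = c"
    by (rule has_derivative_zero_constant) (use d in \<open>auto simp: has_vector_derivative_def\<close>)
  then have "adj (mat_exp (t *\<^sub>R X)) ** mat_exp (t *\<^sub>R X) = adj (mat_exp (0 *\<^sub>R X)) ** mat_exp (0 *\<^sub>R X)"
    by (metis UNIV_I)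
  then show ?thesis by (simp add: mat_exp_0 adj_simps)
qed

lemma act_frame:
  "act (frame a b c) base_point = (a, vec.span {a, b})"
proof -
  have "(*v) (frame a b c) ` vec.span {axis 1 1, axis 2 1} = vec.span {a, b}"
  proof -
    have "frame a b c *v (x *s axis 1 1 + y *s axis 2 1) = x *s a + y *s b" for x y
      by (simp add: matrix_vec_simps frame_simps(2-4))
    then have "x *s a + y *s b \<in> (*v) (frame a b c) ` {x *s axis 1 1 + y *s axis 2 1 | x y. True}"
      "frame a b c *v (x *s axis 1 1 + y *s axis 2 1) \<in> {x *s a + y *s b | x y. True}" for x y
      by (metis (mono_tags, lifting) image_eqI mem_Collect_eq, blast)
    then show ?thesis unfolding span_pair by blast
  qed
  then show ?thesis by (simp add: act_def base_point_def frame_simps(2))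
qed

lemma fl_emb_act_unitary:
  assumes "adj g ** g = mat 1"
  shows "fl_emb (act g base_point) = (g *v axis 1 1, mat 1 - outer (g *v axis 3 1) (g *v axis 3 1))"
proof -
  let ?a = "g *v axis 1 1" and ?b = "g *v axis 2 1" and ?c = "g *v axis 3 1"
  have "fl_emb (act (frame ?a ?b ?c) base_point) = (?a, mat 1 - outer ?c ?c)"
    unfolding act_frame fl_emb_def using assms by (simp add: orthproj_plane frame_axes)
  then show ?thesis by (simp add: frame_axes)
qed

text \<open>Along the orbit the matrices stay unitary, so the plane of the flag is described by its unit normal, the image of
the third basis vector, and the projection can be differentiated without normalising anything.\<close>

lemma orbit_velocity_iff:
  assumes g: "g \<in> SU3" and X: "X \<in> su3"
  shows "orbit_velocity g X u \<longleftrightarrow>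
    u = (g *v (X *v axis 1 1),
      - (outer (g *v (X *v axis 3 1)) (g *v axis 3 1) + outer (g *v axis 3 1) (g *v (X *v axis 3 1))))"
    (is "_ \<longleftrightarrow> u = ?u")
proof -
  interpret V: bounded_bilinear "(*v) :: complex^3^3 \<Rightarrow> complex^3 \<Rightarrow> complex^3" by (rule bounded_bilinear_matrix_vec)
  have Xa: "adj X = - X" using X by (simp add: su3_def)
  define E where "E t = g ** mat_exp (t *\<^sub>R X)" for t :: real
  have "adj (E t) ** E t = mat 1" for t
  proof -
    have "adj (E t) ** E t = adj (mat_exp (t *\<^sub>R X)) ** (adj g ** g) ** mat_exp (t *\<^sub>R X)"
      by (simp add: E_def adj_simps matrix_mul_assoc)
    then show ?thesis using g mat_exp_unitary[OF Xa] by (simp add: SU3_def)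
  qed
  then have fl: "fl_emb (act (E t) base_point) = (E t *v axis 1 1, mat 1 - outer (E t *v axis 3 1) (E t *v axis 3 1))" for t
    by (rule fl_emb_act_unitary)
  have dE: "((\<lambda>t. E t *v w) has_vector_derivative g *v (X *v w)) (at 0)" for w
  proof -
    have "((\<lambda>t. g *v (mat_exp (t *\<^sub>R X) *v w)) has_vector_derivative g *v (X *v w)) (at 0)"
      by (intro bounded_linear.has_vector_derivative[OF V.bounded_linear_left]
        bounded_linear.has_vector_derivative[OF V.bounded_linear_right] mat_exp_has_vector_derivative)
    then show ?thesis by (simp add: E_def matrix_vector_mul_assoc)
  qed
  have E0: "E 0 = g" by (simp add: E_def mat_exp_0)
  have "((\<lambda>t. (E t *v axis 1 1, mat 1 - outer (E t *v axis 3 1) (E t *v axis 3 1))) has_vector_derivative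
     (g *v (X *v axis 1 1), 0 - (outer (E 0 *v axis 3 1) (g *v (X *v axis 3 1)) + outer (g *v (X *v axis 3 1)) (E 0 *v axis 3 1)))) (at 0)"
    by (intro has_vector_derivative_Pair has_vector_derivative_diff has_vector_derivative_const
        bounded_bilinear.has_vector_derivative[OF bounded_bilinear_outer] dE)
  then have d: "((\<lambda>t. fl_emb (act (E t) base_point)) has_vector_derivative ?u) (at 0)"
    by (simp add: fl E0 add.commute)
  then show ?thesis unfolding orbit_velocity_def E_def[symmetric]
    using vector_derivative_unique_at by blast
qed

text \<open>Each matrix \<open>Z\<close> is \<open>X + \<i> Y\<close> for unique skew-Hermitian \<open>X = (Z - Z*) / 2\<close> and \<open>Y = - \<i> (Z + Z*) / 2\<close>. This is \<open>X\<close> for the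
element of \<open>g1\<close> with parameters \<open>\<alpha>, \<beta>\<close>, and \<open>su3_imag_part\<close> is its \<open>Y\<close>.\<close>

definition su3_real_part :: "complex \<Rightarrow> complex \<Rightarrow> complex^3^3" where
  "su3_real_part \<alpha> \<beta> = vector [vector [0, - cnj \<alpha> / 2, \<alpha> / 2], vector [\<alpha> / 2, 0, - cnj \<beta> / 2], vector [- cnj \<alpha> / 2, \<beta> / 2, 0]]"

definition su3_imag_part :: "complex \<Rightarrow> complex \<Rightarrow> complex^3^3" where
  "su3_imag_part \<alpha> \<beta> = vector [vector [0, - \<i> * cnj \<alpha> / 2, - \<i> * \<alpha> / 2], vector [- \<i> * \<alpha> / 2, 0, - \<i> * cnj \<beta> / 2],
     vector [- \<i> * cnj \<alpha> / 2, - \<i> * \<beta> / 2, 0]]"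

lemma g1_skew_decomposition:
  "(X \<in> su3 \<and> Y \<in> su3 \<and> X + mat \<i> ** Y \<in> g1) \<longleftrightarrow> (\<exists>\<alpha> \<beta>. X = su3_real_part \<alpha> \<beta> \<and> Y = su3_imag_part \<alpha> \<beta>)"
proof
  assume XY: "X \<in> su3 \<and> Y \<in> su3 \<and> X + mat \<i> ** Y \<in> g1"
  then obtain \<alpha> \<beta> where Z: "X + mat \<i> ** Y = vector [vector [0, 0, \<alpha>], vector [\<alpha>, 0, 0], vector [0, \<beta>, 0]]"
    unfolding g1_explicit by blast
  define Z where "Z = X + mat \<i> ** Y"
  have "adj X = - X" "adj Y = - Y" using XY by (auto simp: su3_def)
  then have s: "cnj (X $ j $ i) = - X $ i $ j" "cnj (Y $ j $ i) = - Y $ i $ j" for i j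
    by (auto simp: adj_def vec_eq_iff)
  have z: "Z $ i $ j = X $ i $ j + \<i> * Y $ i $ j" for i j by (simp add: Z_def mat_mult_component)
  have z': "cnj (Z $ j $ i) = - X $ i $ j + \<i> * Y $ i $ j" for i j by (simp add: z s)
  have e: "X $ i $ j = (Z $ i $ j - cnj (Z $ j $ i)) / 2" "Y $ i $ j = - \<i> * (Z $ i $ j + cnj (Z $ j $ i)) / 2" for i j
    unfolding z' unfolding z by (simp_all add: algebra_simps)
  have "Z = vector [vector [0, 0, \<alpha>], vector [\<alpha>, 0, 0], vector [0, \<beta>, 0]]" by (simp add: Z_def Z)
  then have "X = su3_real_part \<alpha> \<beta> \<and> Y = su3_imag_part \<alpha> \<beta>"
    by (simp add: vec_eq_iff[of X] vec_eq_iff[of Y] forall_3 su3_real_part_def su3_imag_part_def e vec_eq_iff)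
  then show "\<exists>\<alpha> \<beta>. X = su3_real_part \<alpha> \<beta> \<and> Y = su3_imag_part \<alpha> \<beta>" by blast
next
  assume "\<exists>\<alpha> \<beta>. X = su3_real_part \<alpha> \<beta> \<and> Y = su3_imag_part \<alpha> \<beta>"
  then obtain \<alpha> \<beta> where e: "X = su3_real_part \<alpha> \<beta>" "Y = su3_imag_part \<alpha> \<beta>" by blast
  have "X + mat \<i> ** Y = vector [vector [0, 0, \<alpha>], vector [\<alpha>, 0, 0], vector [0, \<beta>, 0]]"
    by (simp add: vec_eq_iff mat_mult_component e forall_3 su3_real_part_def su3_imag_part_def)
  moreover have "X \<in> su3" "Y \<in> su3"
    by (simp_all add: e su3_def adj_def vec_eq_iff forall_3 su3_real_part_def su3_imag_part_def trace_def sum_3)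
  ultimately show "X \<in> su3 \<and> Y \<in> su3 \<and> X + mat \<i> ** Y \<in> g1" unfolding g1_explicit by auto
qed

text \<open>The bundle in terms of the columns \<open>a, b, c\<close> of the group element, the form in which it is used from here on. Read with
the imaginary unit of \<open>\<complex>\<^sup>3\<close>, the sum \<open>u + \<i> v\<close> has first component \<open>\<alpha> b\<close> and second component \<open>- \<alpha> a c* + \<beta> c b*\<close>.\<close>

lemma g1_bundle_iff:
  "(u, v) \<in> g1_bundle q \<longleftrightarrow> (\<exists>a b c \<alpha> \<beta>. frame a b c \<in> SU3 \<and> q = (a, vec.span {a, b}) \<and>
     u = ((1/2) *s (\<alpha> *s b - cnj \<alpha> *s c),
       - (outer ((1/2) *s (\<alpha> *s a - cnj \<beta> *s b)) c + outer c ((1/2) *s (\<alpha> *s a - cnj \<beta> *s b)))) \<and>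
     v = ((-\<i>/2) *s (\<alpha> *s b + cnj \<alpha> *s c),
       - (outer ((-\<i>/2) *s (\<alpha> *s a + cnj \<beta> *s b)) c + outer c ((-\<i>/2) *s (\<alpha> *s a + cnj \<beta> *s b)))))"
  (is "_ \<longleftrightarrow> (\<exists>a b c \<alpha> \<beta>. ?R a b c \<alpha> \<beta>)")
proof -
  have key: "(frame a b c \<in> SU3 \<and> act (frame a b c) base_point = q \<and>
      orbit_velocity (frame a b c) (su3_real_part \<alpha> \<beta>) u \<and> orbit_velocity (frame a b c) (su3_imag_part \<alpha> \<beta>) v) \<longleftrightarrow> ?R a b c \<alpha> \<beta>"
    for a b c \<alpha> \<beta>
  proof -
    have s: "su3_real_part \<alpha> \<beta> \<in> su3" "su3_imag_part \<alpha> \<beta> \<in> su3" using g1_skew_decomposition by blast+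
    have c1: "su3_real_part \<alpha> \<beta> *v axis 1 1 = vector [0, \<alpha> / 2, - cnj \<alpha> / 2]" "su3_real_part \<alpha> \<beta> *v axis 3 1 = vector [\<alpha> / 2, - cnj \<beta> / 2, 0]"
      "su3_imag_part \<alpha> \<beta> *v axis 1 1 = vector [0, - \<i> * \<alpha> / 2, - \<i> * cnj \<alpha> / 2]" "su3_imag_part \<alpha> \<beta> *v axis 3 1 = vector [- \<i> * \<alpha> / 2, - \<i> * cnj \<beta> / 2, 0]"
      by (simp_all add: matrix_vector_mult_def vec_eq_iff forall_3 sum_3 axis_def su3_real_part_def su3_imag_part_def)
    have f: "frame a b c *v (su3_real_part \<alpha> \<beta> *v axis 1 1) = (1/2) *s (\<alpha> *s b - cnj \<alpha> *s c)"
      "frame a b c *v (su3_real_part \<alpha> \<beta> *v axis 3 1) = (1/2) *s (\<alpha> *s a - cnj \<beta> *s b)"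
      "frame a b c *v (su3_imag_part \<alpha> \<beta> *v axis 1 1) = (-\<i>/2) *s (\<alpha> *s b + cnj \<alpha> *s c)"
      "frame a b c *v (su3_imag_part \<alpha> \<beta> *v axis 3 1) = (-\<i>/2) *s (\<alpha> *s a + cnj \<beta> *s b)"
      unfolding c1 frame_simps(1) by (simp_all add: vec_eq_iff algebra_simps)
    show ?thesis
    proof (cases "frame a b c \<in> SU3")
      case True
      show ?thesis unfolding orbit_velocity_iff[OF True s(1)] orbit_velocity_iff[OF True s(2)] f frame_simps(2-4) act_frame
        by (simp add: True eq_commute[of q])
    qed simp
  qed
  have "(u, v) \<in> g1_bundle q \<longleftrightarrow> (\<exists>g \<alpha> \<beta>. g \<in> SU3 \<and> act g base_point = q \<and>
      orbit_velocity g (su3_real_part \<alpha> \<beta>) u \<and> orbit_velocity g (su3_imag_part \<alpha> \<beta>) v)"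
  proof -
    have "(u, v) \<in> g1_bundle q \<longleftrightarrow> (\<exists>g X Y. g \<in> SU3 \<and> act g base_point = q \<and>
        (X \<in> su3 \<and> Y \<in> su3 \<and> X + mat \<i> ** Y \<in> g1) \<and> orbit_velocity g X u \<and> orbit_velocity g Y v)"
      unfolding g1_bundle_def by blast
    then show ?thesis unfolding g1_skew_decomposition by blast
  qed
  also have "\<dots> \<longleftrightarrow> (\<exists>a b c \<alpha> \<beta>. ?R a b c \<alpha> \<beta>)"
  proof -
    have "(\<exists>g. P g) \<longleftrightarrow> (\<exists>a b c. P (frame a b c))" for P by (metis frame_axes)
    then show ?thesis unfolding key[symmetric] .
  qed
  finally show ?thesis .
qed

section \<open>Legendrian patches\<close>

lemma pd_add_vec: "F differentiable (at z) \<Longrightarrow> pd (u + v) F z = pd u F z + pd v F z"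
  using linear_add[OF has_derivative_linear[OF has_derivative_pd]] by blast

lemma pd_scale_vec: "F differentiable (at z) \<Longrightarrow> pd (r *\<^sub>R v) F z = r *\<^sub>R pd v F z"
  using linear_scale[OF has_derivative_linear[OF has_derivative_pd]] by blast

lemma pd_complex_direction:
  assumes "F differentiable (at (z::complex))"
  shows "pd v F z = Re v *\<^sub>R pd 1 F z + Im v *\<^sub>R pd \<i> F z"
proof -
  have "v = Re v *\<^sub>R 1 + Im v *\<^sub>R \<i>" by (simp add: complex_eq_iff)
  then show ?thesis using pd_add_vec[OF assms] pd_scale_vec[OF assms] by metis
qed

definition lap :: "(complex \<Rightarrow> 'b::real_normed_vector) \<Rightarrow> complex \<Rightarrow> 'b" where
  "lap F z = pd 1 (pd 1 F) z + pd \<i> (pd \<i> F) z"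

definition d_z :: "(complex \<Rightarrow> complex^3) \<Rightarrow> complex \<Rightarrow> complex^3" where
  "d_z F z = (1/2) *s (pd 1 F z - \<i> *s pd \<i> F z)"

definition d_zbar :: "(complex \<Rightarrow> complex^3) \<Rightarrow> complex \<Rightarrow> complex^3" where
  "d_zbar F z = (1/2) *s (pd 1 F z + \<i> *s pd \<i> F z)"

lemma pd_eq_wirtinger: "pd 1 F z = d_z F z + d_zbar F z" "pd \<i> F z = \<i> *s (d_z F z - d_zbar F z)"
  by (simp_all add: d_z_def d_zbar_def vec_eq_iff algebra_simps)

lemma pd_d_zbar:
  assumes "smooth_on S F" "z \<in> S"
  shows "pd v (d_zbar F) z = (1/2) *s (pd v (pd 1 F) z + \<i> *s pd v (pd \<i> F) z)"
proof -
  note d = smooth_onD(1)[OF smooth_onD(2)[OF assms(1)] assms(2)]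
  show ?thesis unfolding d_zbar_def
    by (rule pd_eqI[OF bounded_linear.has_derivative[OF bounded_linear_cscale]])
       (intro has_derivative_add bounded_linear.has_derivative[OF bounded_linear_cscale] has_derivative_pd d)
qed

lemma pd_d_z:
  assumes "smooth_on S F" "z \<in> S"
  shows "pd v (d_z F) z = (1/2) *s (pd v (pd 1 F) z - \<i> *s pd v (pd \<i> F) z)"
proof -
  note d = smooth_onD(1)[OF smooth_onD(2)[OF assms(1)] assms(2)]
  show ?thesis unfolding d_z_def
    by (rule pd_eqI[OF bounded_linear.has_derivative[OF bounded_linear_cscale]])
       (intro has_derivative_diff bounded_linear.has_derivative[OF bounded_linear_cscale] has_derivative_pd d)
qed

lemma smooth_on_d_z: "open S \<Longrightarrow> smooth_on S F \<Longrightarrow> smooth_on S (d_z F)"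
proof -
  assume "open S" "smooth_on S F"
  then have "smooth_on S (\<lambda>z. (1/2) *s (pd 1 F z + (- \<i>) *s pd \<i> F z))"
    by (intro bounded_linear.smooth_on_linear[OF bounded_linear_cscale] smooth_on_add smooth_onD)
  moreover have "(\<lambda>z. (1/2) *s (pd 1 F z + (- \<i>) *s pd \<i> F z)) = d_z F"
    by (simp add: fun_eq_iff d_z_def vec_eq_iff)
  ultimately show ?thesis by simp
qed

lemma smooth_on_d_zbar: "open S \<Longrightarrow> smooth_on S F \<Longrightarrow> smooth_on S (d_zbar F)"
  unfolding d_zbar_def
  by (intro bounded_linear.smooth_on_linear[OF bounded_linear_cscale] smooth_on_add smooth_onD)

text \<open>Both orders of \<open>\<partial>\<close> and its conjugate give a quarter of the Laplacian; the factors \<open>1/2\<close> of the outer operators are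
left out here, which turns the quarter into a half.\<close>

lemma wirtinger_laplacian:
  assumes "open S" "smooth_on S F" "z \<in> S"
  shows "pd 1 (d_zbar F) z - \<i> *s pd \<i> (d_zbar F) z = (1/2) *s lap F z"
    and "pd 1 (d_z F) z + \<i> *s pd \<i> (d_z F) z = (1/2) *s lap F z"
  using pd_commute[OF assms(1,3,2), of 1 \<i>]
  by (simp_all add: pd_d_zbar[OF assms(2,3)] pd_d_z[OF assms(2,3)] lap_def vec_eq_iff algebra_simps)

definition conformal_at :: "(complex \<Rightarrow> 'b::real_inner) \<Rightarrow> complex \<Rightarrow> bool" where
  "conformal_at F z \<longleftrightarrow> pd 1 F z \<bullet> pd 1 F z = pd \<i> F z \<bullet> pd \<i> F z \<and> pd 1 F z \<bullet> pd \<i> F z = 0"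

text \<open>A horizontal map into the unit sphere, written in a coordinate. Its derivative may vanish, since the
projection of a primitive map may have branch points.\<close>

locale legendrian_patch =
  fixes \<Omega> :: "complex set" and F :: "complex \<Rightarrow> complex^3"
  assumes op: "open \<Omega>" and sm: "smooth_on \<Omega> F"
    and unit: "z \<in> \<Omega> \<Longrightarrow> herm (F z) (F z) = 1"
    and horiz: "z \<in> \<Omega> \<Longrightarrow> herm (pd v F z) (F z) = 0"
begin

abbreviation H :: "complex \<Rightarrow> complex^3^3" where "H \<equiv> \<lambda>z. outer (F z) (F z)"

lemmas df = smooth_onD(1)[OF sm] and ddf = smooth_onD(1)[OF smooth_onD(2)[OF sm]]

lemma horiz': "z \<in> \<Omega> \<Longrightarrow> herm (F z) (pd v F z) = 0"
  using horiz herm_eq_0_commute by blast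

text \<open>The derivative of the horizontality condition.\<close>

lemma second_derivative_vertical:
  assumes z: "z \<in> \<Omega>"
  shows "herm (pd u (pd v F) z) (F z) = - herm (pd v F z) (pd u F z)"
proof -
  have "pd u (\<lambda>x. herm (pd v F x) (F x)) z = 0"
    using pd_cong[OF op z, of "\<lambda>x. herm (pd v F x) (F x)" "\<lambda>x. 0" u] horiz by (simp add: pd_def)
  then show ?thesis
    using bounded_bilinear.pd_bilinear[OF bounded_bilinear_herm ddf[OF z] df[OF z], of u v]
    by (simp add: eq_neg_iff_add_eq_0 add.commute)
qed

text \<open>Second derivatives are symmetric, hence so is the right-hand side of the previous lemma: a Legendrian
surface projects to a Lagrangian one.\<close>

lemma herm_derivatives_commute:
  assumes z: "z \<in> \<Omega>"
  shows "herm (pd u F z) (pd v F z) = herm (pd v F z) (pd u F z)"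
  using second_derivative_vertical[OF z, of u v] second_derivative_vertical[OF z, of v u] pd_commute[OF op z sm, of u v]
  by simp

lemma herm_derivatives_real:
  assumes z: "z \<in> \<Omega>"
  shows "herm (pd u F z) (pd v F z) = of_real (pd u F z \<bullet> pd v F z)"
  using herm_derivatives_commute[OF z, of u v] cnj_herm[of "pd u F z" "pd v F z"]
  by (simp add: complex_eq_iff inner_eq_Re_herm)

lemma smooth_H: "smooth_on \<Omega> H"
  by (rule bounded_bilinear.smooth_on_bilinear[OF bounded_bilinear_outer op sm sm])

lemma pd_H: "z \<in> \<Omega> \<Longrightarrow> pd v H z = outer (F z) (pd v F z) + outer (pd v F z) (F z)"
  using bounded_bilinear.pd_bilinear[OF bounded_bilinear_outer df df] by blast

lemma inner_pd_H: "z \<in> \<Omega> \<Longrightarrow> pd u H z \<bullet> pd v H z = 2 * (pd u F z \<bullet> pd v F z)"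
  by (simp add: pd_H inner_add_right inner_outer matrix_vec_simps outer_mult_vec herm_simps unit horiz horiz'
      inner_eq_Re_herm herm_derivatives_commute[of z v u])

lemma conformal_H_iff: "z \<in> \<Omega> \<Longrightarrow> conformal_at H z \<longleftrightarrow> conformal_at F z"
  by (simp add: conformal_at_def inner_pd_H)

lemma kaehler_H: "z \<in> \<Omega> \<Longrightarrow> kaehler_form (H z) (pd u H z) (pd v H z) = 0"
proof -
  assume z: "z \<in> \<Omega>"
  interpret M: bounded_bilinear "(**) :: complex^3^3 \<Rightarrow> complex^3^3 \<Rightarrow> complex^3^3" by (rule matrix_mul_bilinear)
  have c: "pd u H z ** H z - H z ** pd u H z = outer (pd u F z) (F z) - outer (F z) (pd u F z)"
    using z by (simp add: pd_H M.add_left M.add_right matrix_mult_outer outer_mult_vec matrix_vec_simps unit horiz horiz' outer_simps)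
  have i: "mat \<i> ** (outer (pd u F z) (F z) - outer (F z) (pd u F z)) =
      outer (\<i> *s pd u F z) (F z) - outer (\<i> *s F z) (pd u F z)"
    by (simp add: M.diff_right matrix_mult_outer mat_mult_vec)
  then show ?thesis
    unfolding kaehler_form_def c i
    using z by (simp add: pd_H inner_add_right inner_outer matrix_vec_simps outer_mult_vec
        herm_simps unit horiz horiz' herm_derivatives_commute[of z v u])
qed

text \<open>For a Hermitian matrix \<open>A\<close> one has \<open>A \<bullet> (v w* + w v*) = 2 Re \<langle>A w, v\<rangle>\<close>. When the Laplacian of \<open>F F*\<close> is applied to \<open>F\<close>,
every term other than \<open>\<Delta>F\<close> vanishes or is a multiple of \<open>F\<close>, hence orthogonal to \<open>v\<close>.\<close>

lemma lap_H_tangent: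
  assumes z: "z \<in> \<Omega>" and v: "herm v (F z) = 0"
  shows "lap H z \<bullet> (outer v (F z) + outer (F z) v) = 2 * Re (herm (lap F z) v)"
proof -
  have v': "herm (F z) v = 0" by (rule herm_eq_0_commute[OF v])
  have dd: "pd u (pd u H) z = outer (F z) (pd u (pd u F) z) + 2 *\<^sub>R outer (pd u F z) (pd u F z)
      + outer (pd u (pd u F) z) (F z)" for u
  proof -
    have "pd u (pd u H) z = pd u (\<lambda>x. outer (F x) (pd u F x) + outer (pd u F x) (F x)) z"
      by (rule pd_cong[OF op z]) (rule pd_H)
    also have "\<dots> = pd u (\<lambda>x. outer (F x) (pd u F x)) z + pd u (\<lambda>x. outer (pd u F x) (F x)) z"
      by (intro pd_add bounded_bilinear.differentiable_bilinear[OF bounded_bilinear_outer] df ddf z)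
    also have "\<dots> = (outer (F z) (pd u (pd u F) z) + outer (pd u F z) (pd u F z)) +
      (outer (pd u F z) (pd u F z) + outer (pd u (pd u F) z) (F z))"
      by (simp add: bounded_bilinear.pd_bilinear[OF bounded_bilinear_outer] df ddf z)
    finally show ?thesis by (simp add: scaleR_2)
  qed
  have r: "Re (herm v (pd u (pd u F) z)) = Re (herm (pd u (pd u F) z) v)" for u
    unfolding cnj_herm[of v "pd u (pd u F) z", symmetric] by simp
  show ?thesis
    using z by (simp add: lap_def dd inner_add_right inner_outer matrix_vec_simps outer_mult_vec herm_simps
        unit horiz horiz' v v' r)
qed

lemma inner_derivative_zero:
  assumes z: "z \<in> \<Omega>" and w: "\<And>x. x \<in> \<Omega> \<Longrightarrow> pd u F x \<bullet> pd v F x = 0"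
  shows "herm (pd w (pd u F) z) (pd v F z) = - herm (pd u F z) (pd w (pd v F) z)"
proof -
  have "pd w (\<lambda>x. herm (pd u F x) (pd v F x)) z = pd w (\<lambda>x. 0) z"
    using herm_derivatives_real w by (intro pd_cong[OF op z]) simp
  then show ?thesis
    using bounded_bilinear.pd_bilinear[OF bounded_bilinear_herm ddf[OF z] ddf[OF z], of w u v]
    by (simp add: pd_def eq_neg_iff_add_eq_0 add.commute)
qed

lemma pd_energy:
  assumes z: "z \<in> \<Omega>"
  shows "pd v (\<lambda>x. pd u F x \<bullet> pd u F x) z = 2 * Re (herm (pd v (pd u F) z) (pd u F z))"
  using bounded_bilinear.pd_bilinear[OF bounded_bilinear_inner ddf[OF z] ddf[OF z], of v u u]
  by (simp add: inner_commute inner_eq_Re_herm[symmetric])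

text \<open>The classical fact that in conformal coordinates the Laplacian of a map is normal to the surface.\<close>

lemma lap_orthogonal:
  assumes z: "z \<in> \<Omega>" and c: "\<And>x. x \<in> \<Omega> \<Longrightarrow> conformal_at F x"
  shows "lap F z \<bullet> pd 1 F z = 0" "lap F z \<bullet> pd \<i> F z = 0"
proof -
  have o: "herm (pd w (pd 1 F) z) (pd \<i> F z) = - herm (pd 1 F z) (pd w (pd \<i> F) z)" for w
    by (rule inner_derivative_zero[OF z]) (use c in \<open>simp add: conformal_at_def\<close>)
  have "pd v (\<lambda>x. pd 1 F x \<bullet> pd 1 F x) z = pd v (\<lambda>x. pd \<i> F x \<bullet> pd \<i> F x) z" for v
    by (rule pd_cong[OF op z]) (use c in \<open>simp add: conformal_at_def\<close>)
  then have e: "pd v (pd 1 F) z \<bullet> pd 1 F z = pd v (pd \<i> F) z \<bullet> pd \<i> F z" for v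
    unfolding pd_energy[OF z] by (simp add: inner_eq_Re_herm)
  have o': "pd w (pd 1 F) z \<bullet> pd \<i> F z = - (pd 1 F z \<bullet> pd w (pd \<i> F) z)" for w
    using o[of w] by (simp add: inner_eq_Re_herm)
  show "lap F z \<bullet> pd 1 F z = 0" "lap F z \<bullet> pd \<i> F z = 0"
    using o'[of 1] o'[of \<i>] e[of 1] e[of \<i>] pd_commute[OF op z sm, of 1 \<i>]
    by (simp_all add: lap_def inner_add_left inner_add_right inner_commute)
qed

end

lemma orthogonal_expand:
  assumes o: "herm a b = 0" "herm a c = 0" "herm b c = 0" and n: "a \<noteq> 0" "b \<noteq> 0" "c \<noteq> 0"
  shows "w = (herm w a / herm a a) *s a + (herm w b / herm b b) *s b + (herm w c / herm c c) *s c"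
proof -
  define s where "s x = inverse (norm x) *\<^sub>R x" for x :: "complex^3"
  have u: "herm (s x) (s x) = 1" if "x \<noteq> 0" for x
    using that by (simp add: s_def herm_simps herm_self power2_norm_eq_inner[symmetric] power2_eq_square field_simps)
  have "adj (frame (s a) (s b) (s c)) ** frame (s a) (s b) (s c) = mat 1"
    unfolding unitary_frame_iff using u n o by (simp add: s_def herm_simps)
  note e = unitary_frame_expand[OF this, of w]
  have t: "herm w (s x) *s s x = (herm w x / herm x x) *s x" if "x \<noteq> 0" for x
    using that by (simp add: s_def herm_simps herm_self[of x] power2_norm_eq_inner[symmetric] power2_eq_square
        vec_eq_iff scaleR_conv_of_real[where 'a=complex] field_simps)
  show ?thesis using e unfolding t[OF n(1)] t[OF n(2)] t[OF n(3)] .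
qed

section \<open>Minimal Legendrian patches and the phase of their frames\<close>

text \<open>The Hermitian cross product. It turns the determinant into an iterated bilinear expression, to which the
product rule applies.\<close>

definition ccross :: "complex^3 \<Rightarrow> complex^3 \<Rightarrow> complex^3" where
  "ccross b c = vector [cnj (b$2 * c$3 - b$3 * c$2), cnj (b$3 * c$1 - b$1 * c$3), cnj (b$1 * c$2 - b$2 * c$1)]"

lemma det_frame_ccross: "det (frame a b c) = herm a (ccross b c)"
  by (simp add: det_frame ccross_def herm_def sum_3 algebra_simps)

lemma bounded_bilinear_ccross: "bounded_bilinear ccross"
  unfolding bilinear_conv_bounded_bilinear[symmetric] bilinear_def
  by (auto intro!: linearI simp: ccross_def vec_eq_iff forall_3 algebra_simps scaleR_conv_of_real[where 'a=complex])

lemma det_frame_substitute: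
  "det (frame (x *s b + y *s c) b c) = 0"
  "det (frame a (x *s a + y *s b + k *s c) c) = y * det (frame a b c)"
  "det (frame a b (x *s a + y *s b + k *s c)) = k * det (frame a b c)"
  by (simp_all add: det_frame algebra_simps)

lemma norm_det_unitary:
  assumes "adj g ** g = mat 1" shows "norm (det (g :: complex^3^3)) = 1"
proof -
  have "det (adj g) = cnj (det g)" by (simp add: det_3 adj_def algebra_simps)
  moreover have "det (adj g) * det g = 1" using assms det_mul[of "adj g" g] by simp
  ultimately have "(norm (det g))\<^sup>2 = 1"
    by (metis complex_norm_square mult.commute of_real_1 of_real_eq_iff)
  then have "norm (det g) = 1 \<or> norm (det g) = - 1" by (simp only: power2_eq_1_iff)
  then show ?thesis using norm_ge_zero[of "det g"] by linarith
qed

text \<open>For a conformal map this is the conformal factor of the induced metric.\<close>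

definition energy :: "(complex \<Rightarrow> complex^3) \<Rightarrow> complex \<Rightarrow> real" where
  "energy F = (\<lambda>z. pd 1 F z \<bullet> pd 1 F z)"

text \<open>For a conformal Legendrian immersion this is \<open>exp (i \<theta>)\<close> with \<open>\<theta>\<close> the Lagrangian angle.\<close>

definition frame_phase :: "(complex \<Rightarrow> complex^3) \<Rightarrow> complex \<Rightarrow> complex" where
  "frame_phase F = (\<lambda>z. det (frame (F z) (pd 1 F z) (pd \<i> F z)) / of_real (energy F z))"

text \<open>The projection onto the plane spanned by \<open>F\<close> and \<open>d_z F\<close>, written through its normal \<open>d_zbar F\<close>, whose
squared norm is half the energy. This form avoids the square root needed for unit vectors.\<close>

definition flag_projection :: "(complex \<Rightarrow> complex^3) \<Rightarrow> complex \<Rightarrow> complex^3^3" where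
  "flag_projection F = (\<lambda>z. mat 1 - inverse (energy F z / 2) *\<^sub>R outer (d_zbar F z) (d_zbar F z))"

locale minimal_legendrian_patch = legendrian_patch +
  assumes conformal: "z \<in> \<Omega> \<Longrightarrow> conformal_at F z"
    and immersed: "z \<in> \<Omega> \<Longrightarrow> pd 1 F z \<noteq> 0"
    and harmonic: "z \<in> \<Omega> \<Longrightarrow> lap F z = - (2 * (pd 1 F z \<bullet> pd 1 F z)) *\<^sub>R F z"
begin

lemma energy_pos: "z \<in> \<Omega> \<Longrightarrow> energy F z > 0"
  using immersed by (simp add: energy_def)

lemma herm_first:
  assumes z: "z \<in> \<Omega>"
  shows "herm (pd 1 F z) (pd 1 F z) = of_real (energy F z)" "herm (pd \<i> F z) (pd \<i> F z) = of_real (energy F z)"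
    "herm (pd 1 F z) (pd \<i> F z) = 0" "herm (pd \<i> F z) (pd 1 F z) = 0"
  using conformal[OF z] by (simp_all add: herm_derivatives_real[OF z] energy_def conformal_at_def inner_commute)

lemma herm_wirtinger:
  assumes z: "z \<in> \<Omega>"
  shows "herm (d_z F z) (d_z F z) = of_real (energy F z / 2)" "herm (d_zbar F z) (d_zbar F z) = of_real (energy F z / 2)"
    "herm (d_z F z) (d_zbar F z) = 0" "herm (d_zbar F z) (d_z F z) = 0"
    "herm (F z) (d_z F z) = 0" "herm (F z) (d_zbar F z) = 0" "herm (d_z F z) (F z) = 0" "herm (d_zbar F z) (F z) = 0"
  using horiz[OF z] horiz'[OF z] by (simp_all add: d_z_def d_zbar_def herm_simps herm_first[OF z] algebra_simps)

text \<open>Expanding second derivatives in the basis \<open>F, F\<^sub>x, F\<^sub>y\<close>, the logarithmic derivative of the determinant along \<open>v\<close>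
is \<open>(p + q) / |F\<^sub>x|\<^sup>2\<close> with \<open>p = \<langle>F\<^sub>x\<^sub>v, F\<^sub>x\<rangle>\<close> and \<open>q = \<langle>F\<^sub>y\<^sub>v, F\<^sub>y\<rangle>\<close>, while that of the energy is \<open>2 Re p / |F\<^sub>x|\<^sup>2\<close>. The two agree
because \<open>q\<close> is the conjugate of \<open>p\<close>: this follows from the derivatives of \<open>\<langle>F\<^sub>x, F\<^sub>y\<rangle> = 0\<close> and from the
harmonicity of \<open>F\<close>.\<close>

lemma frame_phase_stationary:
  assumes z: "z \<in> \<Omega>"
  shows "(frame_phase F has_derivative (\<lambda>v. 0)) (at z)"
proof -
  define D where "D = (\<lambda>x. herm (F x) (ccross (pd 1 F x) (pd \<i> F x)))"
  have dD: "(D has_derivative (\<lambda>v. pd v D z)) (at z)" unfolding D_def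
    by (intro has_derivative_pd bounded_bilinear.differentiable_bilinear[OF bounded_bilinear_herm]
      bounded_bilinear.differentiable_bilinear[OF bounded_bilinear_ccross] df ddf z)
  have "energy F differentiable at z" unfolding energy_def
    by (intro bounded_bilinear.differentiable_bilinear[OF bounded_bilinear_inner] ddf z)
  then have dL: "(energy F has_derivative (\<lambda>v. pd v (energy F) z)) (at z)" by (rule has_derivative_pd)
  have L0: "energy F z \<noteq> 0" using energy_pos[OF z] by simp
  have expand: "w = herm w (F z) *s F z + (herm w (pd 1 F z) / energy F z) *s pd 1 F z + (herm w (pd \<i> F z) / energy F z) *s pd \<i> F z" for w
  proof -
    have "F z \<noteq> 0" "pd 1 F z \<noteq> 0" "pd \<i> F z \<noteq> 0" using unit[OF z] herm_first[OF z] L0 by (auto simp: herm_simps)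
    from orthogonal_expand[OF horiz'[OF z] horiz'[OF z] herm_first(3)[OF z] this, of w]
    show ?thesis by (simp add: unit[OF z] herm_first[OF z])
  qed
  have key: "pd v D z * energy F z = D z * pd v (energy F) z" if v: "v = 1 \<or> v = \<i>" for v
  proof -
    define p q where "p = herm (pd v (pd 1 F) z) (pd 1 F z)" and "q = herm (pd v (pd \<i> F) z) (pd \<i> F z)"
    have "pd v D z = herm (F z) (ccross (pd 1 F z) (pd v (pd \<i> F) z) + ccross (pd v (pd 1 F) z) (pd \<i> F z))
        + herm (pd v F z) (ccross (pd 1 F z) (pd \<i> F z))"
      unfolding D_def bounded_bilinear.pd_bilinear[OF bounded_bilinear_ccross ddf[OF z] ddf[OF z], symmetric]
      by (rule bounded_bilinear.pd_bilinear[OF bounded_bilinear_herm df[OF z]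
          bounded_bilinear.differentiable_bilinear[OF bounded_bilinear_ccross ddf[OF z] ddf[OF z]]])
    also have "\<dots> = det (frame (F z) (pd 1 F z) (pd v (pd \<i> F) z)) + det (frame (F z) (pd v (pd 1 F) z) (pd \<i> F z))
        + det (frame (pd v F z) (pd 1 F z) (pd \<i> F z))"
      by (simp add: det_frame_ccross herm_simps)
    also have "det (frame (F z) (pd 1 F z) (pd v (pd \<i> F) z)) = q / energy F z * D z"
      by (subst expand[of "pd v (pd \<i> F) z"]) (simp only: det_frame_substitute, simp add: q_def D_def det_frame_ccross)
    also have "det (frame (F z) (pd v (pd 1 F) z) (pd \<i> F z)) = p / energy F z * D z"
      by (subst expand[of "pd v (pd 1 F) z"]) (simp only: det_frame_substitute, simp add: p_def D_def det_frame_ccross)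
    also have "det (frame (pd v F z) (pd 1 F z) (pd \<i> F z)) = 0"
      by (subst expand[of "pd v F z"]) (simp only: horiz[OF z] vector_smult_lzero add_0 det_frame_substitute)
    finally have 1: "pd v D z * energy F z = D z * (p + q)" using L0 by (simp add: field_simps)
    \<comment> \<open>minimality enters only through this orthogonality\<close>
    have lapo: "herm (lap F z) (pd w F z) = 0" for w
      by (simp add: harmonic[OF z] herm_simps horiz'[OF z])
    have s: "pd 1 (pd \<i> F) z = pd \<i> (pd 1 F) z" by (rule pd_commute[OF op z sm])
    have o: "herm (pd w (pd 1 F) z) (pd \<i> F z) = - herm (pd 1 F z) (pd w (pd \<i> F) z)" for w
      by (rule inner_derivative_zero[OF z]) (use conformal in \<open>simp add: conformal_at_def\<close>)
    have l: "herm (pd \<i> (pd \<i> F) z) (pd w F z) = - herm (pd 1 (pd 1 F) z) (pd w F z)" for w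
      using lapo[of w] by (simp add: lap_def herm_simps add_eq_0_iff)
    have "q = cnj p"
    proof (cases "v = 1")
      case True
      have "q = - herm (pd 1 F z) (pd \<i> (pd \<i> F) z)" using o[of \<i>] by (simp add: q_def True s)
      also have "\<dots> = - cnj (herm (pd \<i> (pd \<i> F) z) (pd 1 F z))" by (simp add: cnj_herm)
      also have "\<dots> = cnj p" by (simp add: l p_def True)
      finally show ?thesis .
    next
      case False
      then have v: "v = \<i>" using that by simp
      have "cnj p = herm (pd 1 F z) (pd 1 (pd \<i> F) z)" by (simp add: p_def v cnj_herm s)
      also have "\<dots> = - herm (pd 1 (pd 1 F) z) (pd \<i> F z)" by (simp add: o)
      also have "\<dots> = q" by (simp add: q_def v l)
      finally show ?thesis by simp
    qed
    moreover have "pd v (energy F) z = 2 * Re p" unfolding energy_def p_def by (rule pd_energy[OF z])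
    ultimately have "p + q = of_real (pd v (energy F) z)" by (simp add: complex_add_cnj)
    then show ?thesis using 1 by simp
  qed
  have dv: "D differentiable at z" "energy F differentiable at z" using dD dL differentiable_def by blast+
  have key: "pd v D z * energy F z = D z * pd v (energy F) z" for v
    using key[of 1] key[of \<i>]
    by (simp add: pd_complex_direction[OF dv(1), of v] pd_complex_direction[OF dv(2), of v] scaleR_conv_of_real algebra_simps)
  have "((\<lambda>x. D x / of_real (energy F x)) has_derivative
      (\<lambda>v. (pd v D z * of_real (energy F z) - D z * of_real (pd v (energy F) z)) / (of_real (energy F z) * of_real (energy F z)))) (at z)"
    using L0 by (intro has_derivative_divide' dD bounded_linear.has_derivative[OF bounded_linear_of_real] dL) simp
  moreover have "frame_phase F = (\<lambda>x. D x / of_real (energy F x))" by (simp add: fun_eq_iff frame_phase_def D_def det_frame_ccross)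
  ultimately show ?thesis by (simp add: key)
qed

lemma smooth_flag_projection: "smooth_on \<Omega> (flag_projection F)"
proof -
  have "smooth_on \<Omega> (\<lambda>z. inverse (energy F z / 2))"
  proof (rule smooth_on_inverse[OF op])
    have "smooth_on \<Omega> (\<lambda>z. energy F z * (1/2))" unfolding energy_def
      by (intro bounded_linear.smooth_on_linear[OF bounded_linear_mult_left]
          bounded_bilinear.smooth_on_bilinear[OF bounded_bilinear_inner] op smooth_onD(2) sm)
    then show "smooth_on \<Omega> (\<lambda>z. energy F z / 2)" by simp
  qed (use energy_pos in force)
  then have "smooth_on \<Omega> (\<lambda>z. mat 1 + - (inverse (energy F z / 2) *\<^sub>R outer (d_zbar F z) (d_zbar F z)))"
    by (intro smooth_on_add op smooth_on_const bounded_linear.smooth_on_linear[OF bounded_linear_minus[OF bounded_linear_ident]]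
        bounded_bilinear.smooth_on_bilinear[OF bounded_bilinear_scaleR] smooth_on_d_zbar
        bounded_bilinear.smooth_on_bilinear[OF bounded_bilinear_outer] sm)
  then show ?thesis unfolding flag_projection_def by simp
qed

context
  fixes z r
  assumes z: "z \<in> \<Omega>" and r: "r > 0" "r\<^sup>2 = energy F z / 2"
begin

lemma adapted_frame_unitary:
  "adj (frame (F z) ((1/r) *\<^sub>R d_z F z) (- (1/r) *\<^sub>R d_zbar F z)) ** frame (F z) ((1/r) *\<^sub>R d_z F z) (- (1/r) *\<^sub>R d_zbar F z) = mat 1"
proof -
  have "complex_of_real (energy F z / 2) = of_real r * of_real r" using r(2) by (metis of_real_mult power2_eq_square)
  then show ?thesis unfolding unitary_frame_iff using r(1)
    by (simp only: herm_simps herm_wirtinger[OF z] unit[OF z]) simp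
qed

lemma det_adapted_frame:
  "det (frame (F z) ((1/r) *\<^sub>R d_z F z) (- (1/r) *\<^sub>R d_zbar F z)) = - \<i> * frame_phase F z"
proof -
  have "energy F z = 2 * (r * r)" using r(2) by (simp add: power2_eq_square)
  then have e: "of_real (energy F z) = 2 * (complex_of_real r * complex_of_real r)" by simp
  show ?thesis using r(1) unfolding frame_phase_def e d_z_def d_zbar_def
    by (simp add: det_frame scaleR_conv_of_real[where 'a=complex] field_simps)
qed

text \<open>With \<open>N = d_zbar F\<close> and \<open>R = |N|\<^sup>2\<close>, the identity \<open>R Q = R - N N*\<close> is differentiated. By harmonicity \<open>d_z N = - R F\<close>, and
the component of \<open>d_zbar N\<close> along \<open>F\<close> vanishes; so \<open>d_zbar N = \<kappa> d_z F + \<mu> N\<close>. The contribution of \<open>\<mu>\<close> cancels against the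
derivative of \<open>R\<close>, and what is left has the form prescribed by \<open>g1\<close> with \<open>\<alpha> = r\<close>, the square root of \<open>R\<close>, and \<open>\<beta>\<close> the conjugate of \<open>\<kappa>\<close>.\<close>

lemma flag_projection_derivative:
  defines "a \<equiv> F z" and "b \<equiv> (1/r) *\<^sub>R d_z F z" and "c \<equiv> - (1/r) *\<^sub>R d_zbar F z"
  shows "\<exists>\<beta>. (1/2) *\<^sub>R pd 1 (flag_projection F) z =
       - (outer ((1/2) *s (of_real r *s a - cnj \<beta> *s b)) c + outer c ((1/2) *s (of_real r *s a - cnj \<beta> *s b))) \<and>
     (-1/2) *\<^sub>R pd \<i> (flag_projection F) z =
       - (outer ((-\<i>/2) *s (of_real r *s a + cnj \<beta> *s b)) c + outer c ((-\<i>/2) *s (of_real r *s a + cnj \<beta> *s b)))"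
proof -
  define R where "R = (\<lambda>x. energy F x / 2)"
  define N where "N = d_zbar F z"
  define G where "G = d_z F z"
  have smN: "smooth_on \<Omega> (d_zbar F)" by (rule smooth_on_d_zbar[OF op sm])
  note dN = smooth_onD(1)[OF smN z]
  have RN: "x \<in> \<Omega> \<Longrightarrow> d_zbar F x \<bullet> d_zbar F x = R x" for x
    by (simp only: inner_eq_Re_herm herm_wirtinger(2) R_def Re_complex_of_real)
  have dR: "pd v R z = 2 * Re (herm (pd v (d_zbar F) z) N)" for v
  proof -
    have "pd v R z = pd v (\<lambda>x. d_zbar F x \<bullet> d_zbar F x) z" by (rule pd_cong[OF op z]) (simp add: RN)
    also have "\<dots> = 2 * Re (herm (pd v (d_zbar F) z) N)"
      using bounded_bilinear.pd_bilinear[OF bounded_bilinear_inner dN dN, of v]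
      by (simp add: N_def inner_commute inner_eq_Re_herm[symmetric])
    finally show ?thesis .
  qed
  have R0: "R z = r * r" "r \<noteq> 0" using r by (simp_all add: R_def power2_eq_square)
  have difR: "R differentiable at z"
    unfolding differentiable_def
  proof
    show "(R has_derivative (\<lambda>v. d_zbar F z \<bullet> pd v (d_zbar F) z + pd v (d_zbar F) z \<bullet> d_zbar F z)) (at z)"
      by (rule has_derivative_transform_within_open[OF bounded_bilinear.FDERIV[OF bounded_bilinear_inner
        has_derivative_pd[OF dN] has_derivative_pd[OF dN]] op z]) (simp add: RN)
  qed
  have difQ: "flag_projection F differentiable at z" using smooth_onD(1)[OF smooth_flag_projection z] .
  have RQ: "R z *\<^sub>R pd v (flag_projection F) z =
      pd v R z *\<^sub>R (mat 1 - flag_projection F z) - (outer N (pd v (d_zbar F) z) + outer (pd v (d_zbar F) z) N)" for v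
  proof -
    have "pd v (\<lambda>x. R x *\<^sub>R flag_projection F x) z =
        pd v (\<lambda>x. R x *\<^sub>R mat 1 + (- 1) *\<^sub>R outer (d_zbar F x) (d_zbar F x)) z"
    proof (rule pd_cong[OF op z])
      fix x assume "x \<in> \<Omega>"
      then have "R x \<noteq> 0" using energy_pos[of x] by (simp add: R_def)
      then show "R x *\<^sub>R flag_projection F x = R x *\<^sub>R mat 1 + (- 1) *\<^sub>R outer (d_zbar F x) (d_zbar F x)"
        by (simp add: flag_projection_def R_def scaleR_diff_right)
    qed
    moreover have "pd v (\<lambda>x. R x *\<^sub>R flag_projection F x) z = R z *\<^sub>R pd v (flag_projection F) z + pd v R z *\<^sub>R flag_projection F z"
      by (rule bounded_bilinear.pd_bilinear[OF bounded_bilinear_scaleR difR difQ])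
    moreover have "pd v (\<lambda>x. R x *\<^sub>R mat 1 + (- 1) *\<^sub>R outer (d_zbar F x) (d_zbar F x)) z =
        pd v R z *\<^sub>R mat 1 + (- 1) *\<^sub>R (outer N (pd v (d_zbar F) z) + outer (pd v (d_zbar F) z) N)"
      unfolding N_def
      by (intro pd_eqI has_derivative_add bounded_linear.has_derivative[OF bounded_linear_scaleR_left]
        bounded_linear.has_derivative[OF bounded_linear_scaleR_right] bounded_bilinear.FDERIV[OF bounded_bilinear_outer]
        has_derivative_pd difR dN)
    ultimately show ?thesis by (simp add: algebra_simps)
  qed
  define M where "M = (1/2) *s (pd 1 (d_zbar F) z + \<i> *s pd \<i> (d_zbar F) z)"
  have l: "pd 1 (d_zbar F) z - \<i> *s pd \<i> (d_zbar F) z = - (2 * of_real (R z)) *s F z"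
    using wirtinger_laplacian(1)[OF op sm z] harmonic[OF z]
    by (simp add: R_def energy_def vec_eq_iff scaleR_conv_of_real[where 'a=complex])
  have RF: "of_real (R z) *s F z = (-1/2) *s (pd 1 (d_zbar F) z - \<i> *s pd \<i> (d_zbar F) z)"
    unfolding l by (simp add: vec_eq_iff)
  have N1: "pd 1 (d_zbar F) z = M - of_real (R z) *s F z" 
    and Ni: "pd \<i> (d_zbar F) z = (- \<i>) *s (M + of_real (R z) *s F z)"
    unfolding M_def RF by (simp_all add: vec_eq_iff field_simps)
  have vert: "herm (pd v (d_zbar F) z) (F z) = - herm N (pd v F z)" for v
  proof -
    have "pd v (\<lambda>x. herm (d_zbar F x) (F x)) z = pd v (\<lambda>x. 0) z"
      by (rule pd_cong[OF op z]) (simp add: herm_wirtinger)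
    then show ?thesis
      using bounded_bilinear.pd_bilinear[OF bounded_bilinear_herm dN df[OF z], of v]
      by (simp add: pd_def N_def eq_neg_iff_add_eq_0 add.commute)
  qed
  \<comment> \<open>here \<open>M = d_zbar N\<close>; this holds because \<open>d_z F\<close> and \<open>d_zbar F\<close> are orthogonal\<close>
  have MF: "herm M (F z) = 0"
  proof -
    have "herm M (F z) = - herm N (d_z F z)"
      by (simp add: M_def herm_simps vert d_z_def algebra_simps)
    then show ?thesis by (simp add: N_def herm_wirtinger[OF z])
  qed
  define \<kappa> \<mu> where "\<kappa> = herm M G / of_real (R z)" and "\<mu> = herm M N / of_real (R z)"
  have M: "M = \<kappa> *s G + \<mu> *s N"
  proof -
    have n: "F z \<noteq> 0" "G \<noteq> 0" "N \<noteq> 0" using unit[OF z] herm_wirtinger[OF z] energy_pos[OF z]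
      by (auto simp: herm_simps G_def N_def)
    show ?thesis
      using orthogonal_expand[OF _ _ _ n, of M] MF
      by (simp add: herm_wirtinger[OF z] G_def N_def \<kappa>_def \<mu>_def R_def)
  qed
  have MN: "herm M N = \<mu> * of_real (R z)" "herm (F z) N = 0" using R0 by (simp_all add: \<mu>_def N_def herm_wirtinger[OF z])
  have R1: "pd 1 R z = 2 * (Re \<mu> * R z)" "pd \<i> R z = 2 * (Im \<mu> * R z)"
    by (simp_all add: dR N1 Ni herm_simps MN)
  have Q: "mat 1 - flag_projection F z = inverse (R z) *\<^sub>R outer N N"
    by (simp add: flag_projection_def R_def N_def)
  have cm: "of_real (Re \<mu>) = (\<mu> + cnj \<mu>) / 2" "of_real (Im \<mu>) = (\<mu> - cnj \<mu>) / (2 * \<i>)"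
    by (simp_all add: complex_eq_iff)
  have "(1/2) *\<^sub>R pd 1 (flag_projection F) z = inverse (2 * R z) *\<^sub>R (R z *\<^sub>R pd 1 (flag_projection F) z)"
     "(-1/2) *\<^sub>R pd \<i> (flag_projection F) z = inverse (-2 * R z) *\<^sub>R (R z *\<^sub>R pd \<i> (flag_projection F) z)"
    using R0 by (simp_all add: field_simps)
  note e = this[unfolded RQ, unfolded Q R1 N1 Ni M, unfolded R0(1), folded a_def]
  show ?thesis
    using R0(2) unfolding e unfolding b_def c_def N_def[symmetric] G_def[symmetric]
    by (intro exI[of _ "cnj \<kappa>"])
      (simp add: vec_eq_iff outer_def scaleR_conv_of_real[where 'a=complex] cm field_simps)
qed

end

end

section \<open>Primitive maps in a coordinate\<close>

text \<open>Consequences of \<open>g1_bundle_iff\<close> at one point: \<open>G = d_z F = \<alpha> b\<close> and \<open>N = d_zbar F\<close> is minus the conjugate of \<open>\<alpha>\<close> times \<open>c\<close>,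
while the complexified derivative of \<open>Q\<close> sends \<open>c\<close> to \<open>- \<alpha> a\<close> and the conjugate derivative annihilates \<open>b\<close>.\<close>

lemma flag_patch_pointwise:
  fixes a b c F1 F2 :: "complex^3"
  assumes u: "adj (frame a b c) ** frame a b c = mat 1"
    and F1: "(1/2) *\<^sub>R F1 = (1/2) *s (\<alpha> *s b - cnj \<alpha> *s c)"
    and F2: "(-1/2) *\<^sub>R F2 = (-\<i>/2) *s (\<alpha> *s b + cnj \<alpha> *s c)"
    and Q1: "(1/2) *\<^sub>R Q1 = - (outer ((1/2) *s (\<alpha> *s a - cnj \<beta> *s b)) c + outer c ((1/2) *s (\<alpha> *s a - cnj \<beta> *s b)))"
    and Q2: "(-1/2) *\<^sub>R Q2 = - (outer ((-\<i>/2) *s (\<alpha> *s a + cnj \<beta> *s b)) c + outer c ((-\<i>/2) *s (\<alpha> *s a + cnj \<beta> *s b)))"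
    and Q: "Q = mat 1 - outer c c"
  defines "G \<equiv> (1/2) *s (F1 - \<i> *s F2)" and "N \<equiv> (1/2) *s (F1 + \<i> *s F2)"
  shows "herm F1 a = 0" "herm F2 a = 0" "F1 \<bullet> F1 = F2 \<bullet> F2" "F1 \<bullet> F2 = 0" 
    "Q *v G = G" "Q *v N = 0"
    "Q1 *v N - \<i> *s (Q2 *v N) = (2 * \<alpha> * cnj \<alpha>) *s a" "Q1 *v G + \<i> *s (Q2 *v G) = 0"
    "F1 \<bullet> F1 = 2 * (norm \<alpha>)\<^sup>2"
proof -
  have o: "herm a a = 1" "herm b b = 1" "herm c c = 1" "herm a b = 0" "herm a c = 0" "herm b c = 0"
    "herm b a = 0" "herm c a = 0" "herm c b = 0"
    using u unfolding unitary_frame_iff using herm_eq_0_commute by blast+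
  have f1: "F1 = \<alpha> *s b - cnj \<alpha> *s c"
    using arg_cong[OF F1, of "\<lambda>x. 2 *\<^sub>R x"] by (simp add: vec_eq_iff scaleR_conv_of_real[where 'a=complex])
  have f2: "F2 = \<i> *s (\<alpha> *s b + cnj \<alpha> *s c)"
    using arg_cong[OF F2, of "\<lambda>x. (-2) *\<^sub>R x"] by (simp add: vec_eq_iff scaleR_conv_of_real[where 'a=complex])
  have q1: "Q1 = (-2) *\<^sub>R (outer ((1/2) *s (\<alpha> *s a - cnj \<beta> *s b)) c + outer c ((1/2) *s (\<alpha> *s a - cnj \<beta> *s b)))"
    using arg_cong[OF Q1, of "\<lambda>x. 2 *\<^sub>R x"] unfolding scaleR_minus_right scaleR_minus_left by simp
  have q2: "Q2 = 2 *\<^sub>R (outer ((-\<i>/2) *s (\<alpha> *s a + cnj \<beta> *s b)) c + outer c ((-\<i>/2) *s (\<alpha> *s a + cnj \<beta> *s b)))"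
  proof -
    have "Q2 = (-2) *\<^sub>R ((-1/2) *\<^sub>R Q2)" by simp
    then show ?thesis unfolding Q2 by (simp only: scaleR_minus_left scaleR_minus_right minus_minus)
  qed
  have g: "G = \<alpha> *s b" "N = (- cnj \<alpha>) *s c" 
    by (simp_all add: G_def N_def f1 f2 vec_eq_iff algebra_simps)
  show "herm F1 a = 0" "herm F2 a = 0" by (simp_all add: f1 f2 herm_simps o)
  show "F1 \<bullet> F1 = F2 \<bullet> F2" "F1 \<bullet> F2 = 0" "F1 \<bullet> F1 = 2 * (norm \<alpha>)\<^sup>2"
    unfolding cmod_power2 by (simp_all add: inner_eq_Re_herm f1 f2 herm_simps o algebra_simps power2_eq_square)
  show "Q *v G = G" "Q *v N = 0" by (simp_all add: Q g matrix_vec_simps outer_mult_vec herm_simps o)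
  show "Q1 *v N - \<i> *s (Q2 *v N) = (2 * \<alpha> * cnj \<alpha>) *s a" "Q1 *v G + \<i> *s (Q2 *v G) = 0"
    by (simp_all add: q1 q2 g matrix_vec_simps outer_mult_vec herm_simps o vec_eq_iff algebra_simps scaleR_conv_of_real[where 'a=complex])
qed

text \<open>The derivative of \<open>Q (d_zbar F) = 0\<close> along \<open>z\<close> determines \<open>Q (d_z d_zbar F)\<close>, and the derivative of \<open>Q (d_z F) = d_z F\<close> along the conjugate of \<open>z\<close>
shows that \<open>d_z d_zbar F\<close> is fixed by \<open>Q\<close>. Only the smooth projection is differentiated here; the frames are chosen point by point.\<close>

lemma flag_patch_laplacian:
  fixes F :: "complex \<Rightarrow> complex^3" and Q :: "complex \<Rightarrow> complex^3^3"
  assumes op: "open \<Omega>" and sm: "smooth_on \<Omega> F" "smooth_on \<Omega> Q" and z: "z \<in> \<Omega>"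
    and G: "\<And>x. x \<in> \<Omega> \<Longrightarrow> Q x *v d_z F x = d_z F x" and N: "\<And>x. x \<in> \<Omega> \<Longrightarrow> Q x *v d_zbar F x = 0"
    and dN: "pd 1 Q z *v d_zbar F z - \<i> *s (pd \<i> Q z *v d_zbar F z) = k *s F z"
    and dG: "pd 1 Q z *v d_z F z + \<i> *s (pd \<i> Q z *v d_z F z) = 0"
  shows "lap F z = (- 2 * k) *s F z"
proof -
  note dQ = smooth_onD(1)[OF sm(2) z]
  note dn = smooth_onD(1)[OF smooth_on_d_zbar[OF op sm(1)] z] and dg = smooth_onD(1)[OF smooth_on_d_z[OF op sm(1)] z]
  have n: "Q z *v pd v (d_zbar F) z + pd v Q z *v d_zbar F z = 0" for v
    using bounded_bilinear.pd_bilinear[OF bounded_bilinear_matrix_vec dQ dn, of v]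
      pd_cong[OF op z, of "\<lambda>x. Q x *v d_zbar F x" "\<lambda>x. 0" v] N by (simp add: pd_def)
  have g: "Q z *v pd v (d_z F) z + pd v Q z *v d_z F z = pd v (d_z F) z" for v
    using bounded_bilinear.pd_bilinear[OF bounded_bilinear_matrix_vec dQ dg, of v]
      pd_cong[OF op z, of "\<lambda>x. Q x *v d_z F x" "d_z F" v] G by simp
  note w = wirtinger_laplacian[OF op sm(1) z]
  have "Q z *v ((1/2) *s lap F z) = - (k *s F z)"
  proof -
    have "Q z *v ((1/2) *s lap F z) = Q z *v pd 1 (d_zbar F) z - \<i> *s (Q z *v pd \<i> (d_zbar F) z)"
      unfolding w(1)[symmetric] by (simp add: matrix_vec_simps)
    also have "Q z *v pd 1 (d_zbar F) z = - (pd 1 Q z *v d_zbar F z)" using n[of 1] by (simp add: eq_neg_iff_add_eq_0)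
    also have "Q z *v pd \<i> (d_zbar F) z = - (pd \<i> Q z *v d_zbar F z)" using n[of \<i>] by (simp add: eq_neg_iff_add_eq_0)
    also have "- (pd 1 Q z *v d_zbar F z) - \<i> *s - (pd \<i> Q z *v d_zbar F z) = - (k *s F z)"
      unfolding dN[symmetric] by (simp add: vec_eq_iff)
    finally show ?thesis .
  qed
  moreover have "(1/2) *s lap F z = Q z *v ((1/2) *s lap F z)"
  proof -
    have "(1/2) *s lap F z = pd 1 (d_z F) z + \<i> *s pd \<i> (d_z F) z" by (simp only: w(2))
    also have "\<dots> = (Q z *v pd 1 (d_z F) z + pd 1 Q z *v d_z F z) + \<i> *s (Q z *v pd \<i> (d_z F) z + pd \<i> Q z *v d_z F z)"
      by (simp only: g)
    also have "\<dots> = Q z *v (pd 1 (d_z F) z + \<i> *s pd \<i> (d_z F) z) + (pd 1 Q z *v d_z F z + \<i> *s (pd \<i> Q z *v d_z F z))"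
      by (simp add: matrix_vec_simps vec_eq_iff algebra_simps)
    finally show ?thesis by (simp only: dG w(2) add_0_right)
  qed
  ultimately have "(1/2) *s lap F z = - (k *s F z)" by simp
  then show ?thesis by (simp add: vec_eq_iff field_simps)
qed

section \<open>Surfaces in charts\<close>

lemma chart_props:
  assumes "is_chart c"
  shows "open (fst c)" "open (snd c ` fst c)"
    "p \<in> fst c \<Longrightarrow> chart_inv c (snd c p) = p"
    "w \<in> snd c ` fst c \<Longrightarrow> snd c (chart_inv c w) = w"
    "w \<in> snd c ` fst c \<Longrightarrow> chart_inv c w \<in> fst c"
    "continuous_on (fst c) (snd c)"
  using assms by (auto simp: is_chart_def homeomorphism_def)

lemma open_chart_image:
  assumes c: "is_chart c" and V: "open V" "V \<subseteq> fst c"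
  shows "open (snd c ` V)"
proof -
  have h: "homeomorphism (fst c) (snd c ` fst c) (snd c) (chart_inv c)" using c by (simp add: is_chart_def)
  have "openin (top_of_set (snd c ` fst c)) (snd c ` V)"
    using homeomorphism_imp_open_map[OF h, of V] V by (simp add: openin_open_eq chart_props(1)[OF c])
  then show ?thesis using chart_props(2)[OF c] openin_open_trans by blast
qed

lemma dchart_eq_pd: "dchart c h p v = pd v (h \<circ> chart_inv c) (snd c p)"
  by (simp add: dchart_def pd_def)

lemma dchart_dchart:
  assumes c: "is_chart c" and p: "p \<in> fst c"
  shows "dchart c (\<lambda>q. dchart c h q u) p v = pd v (pd u (h \<circ> chart_inv c)) (snd c p)"
  unfolding dchart_eq_pd
  by (rule pd_cong[OF chart_props(2)[OF c]]) (use p chart_props[OF c] in auto)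

lemma lap_chart:
  assumes "is_chart c" "p \<in> fst c"
  shows "dx c (dx c h) p + dy c (dy c h) p = lap (h \<circ> chart_inv c) (snd c p)"
  by (simp add: dchart_dchart[OF assms] lap_def)

lemma conformal_chart_iff: "conformal_chart h c \<longleftrightarrow> (\<forall>p\<in>fst c. conformal_at (h \<circ> chart_inv c) (snd c p))"
  by (simp add: conformal_chart_def conformal_at_def dchart_eq_pd)

text \<open>If the differential vanishes at \<open>p\<close>, both sides are the closest point to \<open>0\<close> because division by zero gives zero.\<close>

lemma mean_curvature_conformal:
  assumes c: "is_chart c" "p \<in> fst c" and conf: "conformal_at (h \<circ> chart_inv c) (snd c p)"
  shows "mean_curvature N c h p =
    closest_point {n \<in> tangent_space N (h p). n \<bullet> dx c h p = 0 \<and> n \<bullet> dy c h p = 0}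
      ((1 / (2 * (dx c h p \<bullet> dx c h p))) *\<^sub>R lap (h \<circ> chart_inv c) (snd c p))"
proof -
  define E where "E = dx c h p \<bullet> dx c h p"
  have e: "dy c h p \<bullet> dy c h p = E" "dx c h p \<bullet> dy c h p = 0"
    using conf by (simp_all add: conformal_at_def E_def dchart_eq_pd)
  have "(1 / (2 * (E * E - 0\<^sup>2))) *\<^sub>R (E *\<^sub>R dx c (dx c h) p - (2 * 0) *\<^sub>R dx c (dy c h) p + E *\<^sub>R dy c (dy c h) p)
      = (1 / (2 * E)) *\<^sub>R (dx c (dx c h) p + dy c (dy c h) p)"
    by (cases "E = 0") (simp_all add: scaleR_add_right)
  then show ?thesis unfolding mean_curvature_def Let_def e E_def[symmetric] by (simp only: lap_chart[OF c])
qed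

lemma (in legendrian_patch) norm_pd_conformal:
  assumes z: "z \<in> \<Omega>" and c: "conformal_at F z"
  shows "pd v F z \<bullet> pd v F z = (norm v)\<^sup>2 * (pd 1 F z \<bullet> pd 1 F z)"
  using c unfolding conformal_at_def cmod_power2
  by (simp add: pd_complex_direction[OF df[OF z], of v] inner_add_left inner_add_right inner_commute power2_eq_square algebra_simps)

lemma legendrian_patchI:
  assumes op: "open \<Omega>" and sm: "smooth_on \<Omega> F" and unit: "\<And>z. z \<in> \<Omega> \<Longrightarrow> norm (F z) = 1"
    and hor: "\<And>z v. z \<in> \<Omega> \<Longrightarrow> pd v F z \<bullet> (\<i> *s F z) = 0"
  shows "legendrian_patch \<Omega> F"
proof
  fix z v assume z: "z \<in> \<Omega>"
  have "pd v (\<lambda>x. F x \<bullet> F x) z = pd v (\<lambda>x. 1) z"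
    using unit by (intro pd_cong[OF op z]) (simp flip: power2_norm_eq_inner)
  then have "pd v F z \<bullet> F z = 0"
    using bounded_bilinear.pd_bilinear[OF bounded_bilinear_inner smooth_onD(1)[OF sm z] smooth_onD(1)[OF sm z], of v]
    by (simp add: pd_def[of v "\<lambda>x. 1"] inner_commute)
  then show "herm (pd v F z) (F z) = 0"
    using hor[OF z, of v] by (simp add: complex_eq_iff inner_eq_Re_herm herm_simps)
qed (use assms in \<open>simp_all add: herm_self flip: power2_norm_eq_inner\<close>)

lemma orthproj_hopf: "w \<in> S5 \<Longrightarrow> orthproj (hopf w) = outer w w"
  unfolding hopf_def by (rule orthproj_line) (simp add: herm_self flip: power2_norm_eq_inner)

lemma S5_iff: "w \<in> S5 \<longleftrightarrow> herm w w = 1"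
  by (simp add: herm_self flip: power2_norm_eq_inner of_real_power) (simp add: power2_eq_1_iff add_eq_0_iff, 
   metis norm_ge_zero not_one_le_zero neg_0_le_iff_le)

lemma closest_point_lap_S5:
  assumes "w \<in> S5" "0 \<in> T" "T \<subseteq> tangent_space S5 w" "l = k *\<^sub>R w"
  shows "closest_point T (s *\<^sub>R l) = 0"
proof (rule closest_point_eq_0I)
  fix n assume "n \<in> T"
  then have "w \<bullet> n = 0" using assms(3) tangent_space_S5 by blast
  then show "(s *\<^sub>R l) \<bullet> n = 0" by (simp add: assms(4))
qed (rule assms)

lemma (in legendrian_patch) closest_point_lap_CP2:
  assumes z: "z \<in> \<Omega>" and T: "0 \<in> T" "T \<subseteq> tangent_space CP2_emb (H z)" and l: "lap F z = k *\<^sub>R F z"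
  shows "closest_point T (s *\<^sub>R lap H z) = 0"
proof (rule closest_point_eq_0I)
  fix n assume "n \<in> T"
  then obtain v where v: "n = outer v (F z) + outer (F z) v" "herm v (F z) = 0"
    using T(2) tangent_space_CP2[OF unit[OF z]] by auto
  then show "(s *\<^sub>R lap H z) \<bullet> n = 0"
    using lap_H_tangent[OF z v(2)] herm_eq_0_commute[OF v(2)] by (simp add: l herm_simps)
qed (rule T)

text \<open>All four assertions of the converse follow from one local fact: \<open>f\<close> is a conformal Legendrian map whose
Laplacian is a real multiple of \<open>f\<close>. The Laplacian is then orthogonal to the tangent spaces of the sphere, and by
\<open>lap_H_tangent\<close> the same holds for the induced map into \<open>\<complex>\<P>\<^sup>2\<close>.\<close>

lemma legendrian_harmonic_conclusion:
  fixes A :: "'m::topological_space chart set" and f :: "'m \<Rightarrow> complex^3"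
  assumes A: "complex_atlas A" and S5: "range f \<subseteq> S5"
    and patch: "\<And>c. c \<in> A \<Longrightarrow> legendrian_patch (snd c ` fst c) (f \<circ> chart_inv c)"
    and conf: "\<And>c p. c \<in> A \<Longrightarrow> p \<in> fst c \<Longrightarrow> conformal_at (f \<circ> chart_inv c) (snd c p)"
    and harm: "\<And>c p. c \<in> A \<Longrightarrow> p \<in> fst c \<Longrightarrow> \<exists>k. lap (f \<circ> chart_inv c) (snd c p) = k *\<^sub>R f p"
  defines "U \<equiv> {p. immersed_at A f p}"
  shows "minimal_legendrian_on A U f" "conformal_harmonic A S5 f"
    "minimal_lagrangian_on A U (hopf \<circ> f)" "conformal_harmonic A CP2_emb (orthproj \<circ> (hopf \<circ> f))"
proof -
  have ch: "is_chart c" if "c \<in> A" for c using A that by (auto simp: complex_atlas_def)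
  have cov: "\<exists>c\<in>A. p \<in> fst c" for p using A by (auto simp: complex_atlas_def)
  let ?h = "orthproj \<circ> (hopf \<circ> f)"
  have fS5: "f p \<in> S5" for p using S5 by blast
  have h: "?h \<circ> chart_inv c = (\<lambda>z. outer ((f \<circ> chart_inv c) z) ((f \<circ> chart_inv c) z))" for c
    using orthproj_hopf[OF fS5] by (simp add: fun_eq_iff)
  have hp: "?h p = outer (f p) (f p)" for p using orthproj_hopf[OF fS5] by simp
  have inv: "chart_inv c (snd c p) = p" if "c \<in> A" "p \<in> fst c" for c p using chart_props(3)[OF ch] that by blast
  have zin: "snd c p \<in> snd c ` fst c" if "p \<in> fst c" for c :: "'m chart" and p using that by blast
  have smf: "smooth_map A f" unfolding smooth_map_def using patch legendrian_patch.sm by blast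
  have smh: "smooth_map A ?h" unfolding smooth_map_def h using patch legendrian_patch.smooth_H by blast
  have rh: "range ?h \<subseteq> CP2_emb" using hp fS5[unfolded S5_iff] by (auto simp: CP2_emb_eq intro!: exI[of _ "f _"])
  have confh: "conformal_at (?h \<circ> chart_inv c) (snd c p)" if "c \<in> A" "p \<in> fst c" for c p
    unfolding h using legendrian_patch.conformal_H_iff[OF patch[OF that(1)] zin[OF that(2)]] conf[OF that] by simp
  have clS: "closest_point T (s *\<^sub>R lap (f \<circ> chart_inv c) (snd c p)) = 0"
    if cp: "c \<in> A" "p \<in> fst c" and T: "0 \<in> T" "T \<subseteq> tangent_space S5 (f p)" for c p s T
    using harm[OF cp] closest_point_lap_S5[OF fS5 T] by blast
  have clC: "closest_point T (s *\<^sub>R lap (?h \<circ> chart_inv c) (snd c p)) = 0"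
    if cp: "c \<in> A" "p \<in> fst c" and T: "0 \<in> T" "T \<subseteq> tangent_space CP2_emb (?h p)" for c p s T
  proof -
    obtain k where "lap (f \<circ> chart_inv c) (snd c p) = k *\<^sub>R (f \<circ> chart_inv c) (snd c p)"
      using harm[OF cp] inv[OF cp] by auto
    moreover have "T \<subseteq> tangent_space CP2_emb (outer ((f \<circ> chart_inv c) (snd c p)) ((f \<circ> chart_inv c) (snd c p)))"
      using T(2) unfolding hp by (simp add: inv[OF cp])
    ultimately show ?thesis unfolding h
      using legendrian_patch.closest_point_lap_CP2[OF patch[OF cp(1)] zin[OF cp(2)] T(1)] by blast
  qed
  have 0: "0 \<in> tangent_space S5 (f p)" "0 \<in> tangent_space CP2_emb (?h p)" for p
    using fS5 rh by (auto intro!: zero_in_tangent_space)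
  have horf: "horizontal A f" unfolding horizontal_def
  proof (intro ballI allI)
    fix c p v assume cp: "c \<in> A" "p \<in> fst c"
    have "herm (dchart c f p v) (f p) = 0"
      using legendrian_patch.horiz[OF patch[OF cp(1)] zin[OF cp(2)], of v] inv[OF cp] by (simp add: dchart_eq_pd)
    then show "dchart c f p v \<bullet> (\<i> *s f p) = 0" by (simp add: inner_eq_Re_herm herm_simps)
  qed
  have mcS: "mean_curvature S5 c f p = 0" if "c \<in> A" "p \<in> fst c" for c p
    unfolding mean_curvature_conformal[OF ch[OF that(1)] that(2) conf[OF that]]
    by (rule clS[OF that]) (use 0 in auto)
  have mcC: "mean_curvature CP2_emb c ?h p = 0" if "c \<in> A" "p \<in> fst c" for c p
    unfolding mean_curvature_conformal[OF ch[OF that(1)] that(2) confh[OF that]]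
    by (rule clC[OF that]) (use 0 in auto)
  show "minimal_legendrian_on A U f"
    unfolding minimal_legendrian_on_def minimal_immersion_on_def using smf S5 horf mcS by (auto simp: U_def)
  show "conformal_harmonic A S5 f"
    unfolding conformal_harmonic_def conformal_chart_iff
    using smf S5 conf clS[of _ _ "tangent_space S5 (f _)" 1] 0 by (auto simp: lap_chart ch)
  show "conformal_harmonic A CP2_emb ?h"
    unfolding conformal_harmonic_def conformal_chart_iff
    using smh rh confh clC[of _ _ "tangent_space CP2_emb (?h _)" 1] 0 by (auto simp: lap_chart ch)
  have imm: "immersed_at A ?h p" if p: "immersed_at A f p" for p
    unfolding immersed_at_def
  proof (intro ballI impI)
    fix c assume cp: "c \<in> A" "p \<in> fst c"
    note P = patch[OF cp(1)] and z = zin[OF cp(2)]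
    have i: "inj (dchart c f p)" using p cp by (simp add: immersed_at_def)
    have dh: "?h \<circ> chart_inv c differentiable at (snd c p)"
      unfolding h using smooth_onD(1)[OF legendrian_patch.smooth_H[OF P] z] .
    have lin: "linear (dchart c ?h p)"
      unfolding dchart_def using has_derivative_linear[OF dh[unfolded frechet_derivative_works]] by (simp add: linear_linear)
    show "inj (dchart c ?h p)" unfolding linear_injective_0[OF lin]
    proof (intro allI impI)
      fix v assume "dchart c ?h p v = 0"
      then have "pd v (f \<circ> chart_inv c) (snd c p) \<bullet> pd v (f \<circ> chart_inv c) (snd c p) = 0"
        using legendrian_patch.inner_pd_H[OF P z, of v v] unfolding dchart_eq_pd h by simp
      then have "pd v (f \<circ> chart_inv c) (snd c p) = pd 0 (f \<circ> chart_inv c) (snd c p)"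
        using pd_scale_vec[OF legendrian_patch.df[OF P z], of 0 0] by simp
      then show "v = 0" using i unfolding inj_def dchart_eq_pd by blast
    qed
  qed
  have "lagrangian A (hopf \<circ> f)" unfolding lagrangian_def
  proof (intro ballI allI)
    fix c p u v assume cp: "c \<in> A" "p \<in> fst c"
    show "kaehler_form (orthproj ((hopf \<circ> f) p)) (dchart c ?h p u) (dchart c ?h p v) = 0"
      using legendrian_patch.kaehler_H[OF patch[OF cp(1)] zin[OF cp(2)], of u v] hp[of p] inv[OF cp]
      unfolding dchart_eq_pd h by simp
  qed
  moreover have "range (hopf \<circ> f) \<subseteq> CP2" 
  proof -
    have "hopf (f p) \<in> CP2" for p
      unfolding CP2_iff hopf_def by (rule exI[of _ "f p"]) (use fS5[unfolded S5_iff] in simp)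
    then show ?thesis by auto
  qed
  ultimately show "minimal_lagrangian_on A U (hopf \<circ> f)"
    unfolding minimal_lagrangian_on_def minimal_immersion_on_def using smh rh mcC imm by (auto simp: U_def)
qed

lemma primitive_projects:
  fixes A :: "'m::topological_space chart set"
  assumes A: "complex_atlas A" and prim: "primitive A \<psi>"
  defines "f \<equiv> pr1 \<circ> \<psi>" and "U \<equiv> {p. immersed_at A (pr1 \<circ> \<psi>) p}"
  shows "minimal_legendrian_on A U f" "conformal_harmonic A S5 f"
    "minimal_lagrangian_on A U (hopf \<circ> f)" "conformal_harmonic A CP2_emb (orthproj \<circ> (hopf \<circ> f))"
proof -
  have ch: "is_chart c" if "c \<in> A" for c using A that by (auto simp: complex_atlas_def)
  have S5: "range f \<subseteq> S5"
  proof
    fix w assume "w \<in> range f"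
    then obtain p where "w = fst (\<psi> p)" by (auto simp: f_def pr1_def)
    moreover have "\<psi> p \<in> FL2" using prim by (auto simp: primitive_def)
    ultimately show "w \<in> S5" by (auto simp: FL2_def)
  qed
  have patch: "legendrian_patch (snd c ` fst c) (f \<circ> chart_inv c) \<and>
      (\<forall>z\<in>snd c ` fst c. conformal_at (f \<circ> chart_inv c) z \<and> (\<exists>k. lap (f \<circ> chart_inv c) z = k *\<^sub>R (f \<circ> chart_inv c) z))"
    if c: "c \<in> A" for c
  proof -
    define \<Omega> where "\<Omega> = snd c ` fst c"
    define F where "F = f \<circ> chart_inv c"
    define P where "P = fl_emb \<circ> \<psi> \<circ> chart_inv c"
    define Q where "Q = (\<lambda>z. snd (P z))"
    have op: "open \<Omega>" using chart_props(2)[OF ch[OF c]] by (simp add: \<Omega>_def)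
    have smP: "smooth_on \<Omega> P" using prim c by (auto simp: primitive_def smooth_map_def P_def \<Omega>_def)
    have F: "F = (\<lambda>z. fst (P z))" by (auto simp: F_def P_def f_def pr1_def fl_emb_def)
    have sm: "smooth_on \<Omega> F" "smooth_on \<Omega> Q" unfolding F Q_def
      by (intro bounded_linear.smooth_on_linear[OF bounded_linear_fst] bounded_linear.smooth_on_linear[OF bounded_linear_snd] op smP)+
    have dP: "pd v P z = (pd v F z, pd v Q z)" if "z \<in> \<Omega>" for v z
      unfolding F Q_def using bounded_linear.pd_linear[OF bounded_linear_fst smooth_onD(1)[OF smP that], of v]
        bounded_linear.pd_linear[OF bounded_linear_snd smooth_onD(1)[OF smP that], of v] by simp
    have pt: "\<exists>a b c' \<alpha> \<beta>. frame a b c' \<in> SU3 \<and> F z = a \<and> Q z = mat 1 - outer c' c' \<and>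
       (1/2) *\<^sub>R pd 1 F z = (1/2) *s (\<alpha> *s b - cnj \<alpha> *s c') \<and>
       (-1/2) *\<^sub>R pd \<i> F z = (-\<i>/2) *s (\<alpha> *s b + cnj \<alpha> *s c') \<and>
       (1/2) *\<^sub>R pd 1 Q z = - (outer ((1/2) *s (\<alpha> *s a - cnj \<beta> *s b)) c' + outer c' ((1/2) *s (\<alpha> *s a - cnj \<beta> *s b))) \<and>
       (-1/2) *\<^sub>R pd \<i> Q z = - (outer ((-\<i>/2) *s (\<alpha> *s a + cnj \<beta> *s b)) c' + outer c' ((-\<i>/2) *s (\<alpha> *s a + cnj \<beta> *s b)))"
      if z: "z \<in> \<Omega>" for z
    proof -
      obtain p where p: "p \<in> fst c" "z = snd c p" using z by (auto simp: \<Omega>_def)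
      have ip: "chart_inv c z = p" using chart_props(3)[OF ch[OF c] p(1)] p(2) by simp
      have "((1/2) *\<^sub>R dx c (fl_emb \<circ> \<psi>) p, (-1/2) *\<^sub>R dy c (fl_emb \<circ> \<psi>) p) \<in> g1_bundle (\<psi> p)"
        using prim c p(1) by (simp add: primitive_def)
      then have "((1/2) *\<^sub>R pd 1 P z, (-1/2) *\<^sub>R pd \<i> P z) \<in> g1_bundle (\<psi> p)"
        by (simp only: dchart_eq_pd P_def p(2))
      then obtain a b c' \<alpha> \<beta> where g: "frame a b c' \<in> SU3" "\<psi> p = (a, vec.span {a, b})"
        "(1/2) *\<^sub>R pd 1 P z = ((1/2) *s (\<alpha> *s b - cnj \<alpha> *s c'),
          - (outer ((1/2) *s (\<alpha> *s a - cnj \<beta> *s b)) c' + outer c' ((1/2) *s (\<alpha> *s a - cnj \<beta> *s b))))"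
        "(-1/2) *\<^sub>R pd \<i> P z = ((-\<i>/2) *s (\<alpha> *s b + cnj \<alpha> *s c'),
          - (outer ((-\<i>/2) *s (\<alpha> *s a + cnj \<beta> *s b)) c' + outer c' ((-\<i>/2) *s (\<alpha> *s a + cnj \<beta> *s b))))"
        unfolding g1_bundle_iff by blast
      have u: "adj (frame a b c') ** frame a b c' = mat 1" using g(1) by (simp add: SU3_def)
      have "F z = a" "Q z = mat 1 - outer c' c'"
        using g(2) orthproj_plane[OF u] by (simp_all add: F Q_def P_def ip fl_emb_def)
      then show ?thesis
        using g unfolding dP[OF z] scaleR_Pair prod.inject by (intro exI conjI) auto
    qed
    have loc: "herm (pd 1 F z) (F z) = 0 \<and> herm (pd \<i> F z) (F z) = 0 \<and> conformal_at F z \<and>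
        Q z *v d_z F z = d_z F z \<and> Q z *v d_zbar F z = 0 \<and>
        (\<exists>k. pd 1 Q z *v d_zbar F z - \<i> *s (pd \<i> Q z *v d_zbar F z) = of_real k *s F z) \<and>
        pd 1 Q z *v d_z F z + \<i> *s (pd \<i> Q z *v d_z F z) = 0" if z: "z \<in> \<Omega>" for z
    proof -
      obtain a b c' \<alpha> \<beta> where g: "frame a b c' \<in> SU3" "F z = a" "Q z = mat 1 - outer c' c'"
        "(1/2) *\<^sub>R pd 1 F z = (1/2) *s (\<alpha> *s b - cnj \<alpha> *s c')"
        "(-1/2) *\<^sub>R pd \<i> F z = (-\<i>/2) *s (\<alpha> *s b + cnj \<alpha> *s c')"
        "(1/2) *\<^sub>R pd 1 Q z = - (outer ((1/2) *s (\<alpha> *s a - cnj \<beta> *s b)) c' + outer c' ((1/2) *s (\<alpha> *s a - cnj \<beta> *s b)))"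
        "(-1/2) *\<^sub>R pd \<i> Q z = - (outer ((-\<i>/2) *s (\<alpha> *s a + cnj \<beta> *s b)) c' + outer c' ((-\<i>/2) *s (\<alpha> *s a + cnj \<beta> *s b)))"
        using pt[OF z] by blast
      have u: "adj (frame a b c') ** frame a b c' = mat 1" using g(1) by (simp add: SU3_def)
      note w = flag_patch_pointwise[OF u g(4-7,3)]
      have "2 * \<alpha> * cnj \<alpha> = of_real (2 * (norm \<alpha>)\<^sup>2)"
        using complex_norm_square[of \<alpha>] by simp
      then show ?thesis
        using w(1-8) unfolding conformal_at_def d_z_def d_zbar_def g(2) by metis
    qed
    have "legendrian_patch \<Omega> F"
    proof
      fix z v assume z: "z \<in> \<Omega>"
      show "herm (pd v F z) (F z) = 0"
        using loc[OF z] by (simp add: pd_complex_direction[OF smooth_onD(1)[OF sm(1) z], of v] herm_simps)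
      have "F z \<in> S5" using S5 unfolding F_def o_apply by blast
      then show "herm (F z) (F z) = 1" by (simp only: S5_iff)
    qed (rule op sm)+
    moreover have "\<exists>k. lap F z = k *\<^sub>R F z" if z: "z \<in> \<Omega>" for z
    proof -
      obtain k where k: "pd 1 Q z *v d_zbar F z - \<i> *s (pd \<i> Q z *v d_zbar F z) = of_real k *s F z" using loc[OF z] by blast
      have "lap F z = (- 2 * of_real k) *s F z"
        by (rule flag_patch_laplacian[OF op sm z _ _ k]) (use loc z in auto)
      then have "lap F z = (- 2 * k) *\<^sub>R F z" by (simp add: vec_eq_iff scaleR_conv_of_real[where 'a=complex])
      then show ?thesis ..
    qed
    ultimately show ?thesis using loc unfolding \<Omega>_def F_def by blast
  qed
  have "\<exists>k. lap (f \<circ> chart_inv c) (snd c p) = k *\<^sub>R f p" if "c \<in> A" "p \<in> fst c" for c p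
    using patch[OF that(1)] that(2) chart_props(3)[OF ch[OF that(1)] that(2)] by fastforce
  then show "minimal_legendrian_on A U f" "conformal_harmonic A S5 f"
    "minimal_lagrangian_on A U (hopf \<circ> f)" "conformal_harmonic A CP2_emb (orthproj \<circ> (hopf \<circ> f))"
    unfolding U_def f_def[symmetric]
    using legendrian_harmonic_conclusion[OF A S5] patch by blast+
qed

section \<open>The flag lift of a minimal Lagrangian surface\<close>

lemma bounded_bilinear_cscale: "bounded_bilinear ((*s) :: complex \<Rightarrow> complex^3 \<Rightarrow> complex^3)"
  unfolding bilinear_conv_bounded_bilinear[symmetric] bilinear_def
  by (auto intro!: linearI simp: vec_eq_iff algebra_simps)

text \<open>Vanishing mean curvature in \<open>\<complex>\<P>\<^sup>2\<close> says that the Laplacian of \<open>F\<close> is orthogonal to every horizontal \<open>v\<close> that is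
normal to the surface. For a Lagrangian surface \<open>\<i> F\<^sub>x\<close> and \<open>\<i> F\<^sub>y\<close> are such vectors; together with \<open>lap_orthogonal\<close> the
Laplacian is Hermitian orthogonal to \<open>F\<^sub>x\<close> and \<open>F\<^sub>y\<close>, so only its component along \<open>F\<close> survives.\<close>

lemma (in legendrian_patch) harmonic_of_minimal:
  assumes z: "z \<in> \<Omega>" and conf: "\<And>x. x \<in> \<Omega> \<Longrightarrow> conformal_at F x" and imm: "pd 1 F z \<noteq> 0" and s: "s \<noteq> 0"
    and cl: "closest_point {n \<in> tangent_space CP2_emb (H z). n \<bullet> pd 1 H z = 0 \<and> n \<bullet> pd \<i> H z = 0} (s *\<^sub>R lap H z) = 0"
  shows "lap F z = - (2 * (pd 1 F z \<bullet> pd 1 F z)) *\<^sub>R F z"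
proof -
  let ?T = "{n \<in> tangent_space CP2_emb (H z). n \<bullet> pd 1 H z = 0 \<and> n \<bullet> pd \<i> H z = 0}"
  note T = tangent_space_CP2[OF unit[OF z]]
  define L where "L = pd 1 F z \<bullet> pd 1 F z"
  have sub: "subspace ?T"
  proof (rule subspaceI)
    show "0 \<in> ?T" unfolding T by (auto intro!: exI[of _ 0] simp: outer_simps herm_simps)
  next
    fix x y assume xy: "x \<in> ?T" "y \<in> ?T"
    then obtain u v where uv: "x = outer u (F z) + outer (F z) u" "herm u (F z) = 0"
      "y = outer v (F z) + outer (F z) v" "herm v (F z) = 0" unfolding T by auto
    have "x + y = outer (u + v) (F z) + outer (F z) (u + v)" "herm (u + v) (F z) = 0"
      using uv by (simp_all add: outer_simps herm_simps)
    then have "x + y \<in> tangent_space CP2_emb (H z)" unfolding T by blast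
    then show "x + y \<in> ?T" using xy by (simp add: inner_add_left)
  next
    fix x and k :: real assume x: "x \<in> ?T"
    then obtain u where u: "x = outer u (F z) + outer (F z) u" "herm u (F z) = 0" unfolding T by auto
    have "k *\<^sub>R x = outer (k *\<^sub>R u) (F z) + outer (F z) (k *\<^sub>R u)" "herm (k *\<^sub>R u) (F z) = 0"
      using u by (simp_all add: outer_simps herm_simps scaleR_add_right)
    then have "k *\<^sub>R x \<in> tangent_space CP2_emb (H z)" unfolding T by blast
    then show "k *\<^sub>R x \<in> ?T" using x by simp
  qed
  have nrm: "Re (herm (lap F z) v) = 0" if v: "herm v (F z) = 0" "v \<bullet> pd 1 F z = 0" "v \<bullet> pd \<i> F z = 0" for v
  proof -
    let ?n = "outer v (F z) + outer (F z) v"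
    have "pd w H z \<bullet> ?n = 2 * (v \<bullet> pd w F z)" for w
    proof -
      have "pd w H z \<bullet> ?n = Re (herm (pd w F z) v) + Re (herm v (pd w F z))"
        by (simp add: pd_H[OF z] inner_add_right inner_outer matrix_vec_simps outer_mult_vec herm_simps unit[OF z]
            horiz[OF z] horiz'[OF z] v(1))
      then show ?thesis by (simp flip: inner_eq_Re_herm add: inner_commute)
    qed
    then have "?n \<bullet> pd w H z = 2 * (v \<bullet> pd w F z)" for w by (simp only: inner_commute[of ?n])
    then have "?n \<in> ?T" using v unfolding T by auto
    from closest_point_eq_0D[OF sub cl this] have "lap H z \<bullet> ?n = 0" using s by simp
    then show ?thesis using lap_H_tangent[OF z v(1)] by simp
  qed
  have f: "herm (pd 1 F z) (pd 1 F z) = of_real L" "herm (pd \<i> F z) (pd \<i> F z) = of_real L"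
    "herm (pd 1 F z) (pd \<i> F z) = 0" "herm (pd \<i> F z) (pd 1 F z) = 0"
    using conf[OF z] by (simp_all add: herm_derivatives_real[OF z] L_def conformal_at_def inner_commute)
  have L0: "L \<noteq> 0" using imm by (simp add: L_def)
  have tan: "herm (lap F z) (pd w F z) = 0" if w: "w = 1 \<or> w = \<i>" for w
  proof -
    \<comment> \<open>\<open>\<i> F\<^sub>w\<close> is normal to the surface because the Hermitian products of first derivatives are real\<close>
    have "Re (herm (lap F z) (\<i> *s pd w F z)) = 0"
      using w by (intro nrm) (auto simp: inner_eq_Re_herm herm_simps horiz[OF z] f)
    moreover have "Re (herm (lap F z) (pd w F z)) = 0"
      using lap_orthogonal[OF z conf] w by (auto simp: inner_eq_Re_herm)
    ultimately show ?thesis by (simp add: herm_simps complex_eq_iff)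
  qed
  have "herm (lap F z) (F z) = - of_real (2 * L)"
    using second_derivative_vertical[OF z, of 1 1] second_derivative_vertical[OF z, of \<i> \<i>]
    by (simp add: lap_def herm_simps f)
  moreover have "F z \<noteq> 0" "pd 1 F z \<noteq> 0" "pd \<i> F z \<noteq> 0" using unit[OF z] f L0 by (auto simp: herm_simps)
  note orthogonal_expand[OF horiz'[OF z] horiz'[OF z] f(3) this, of "lap F z"]
  ultimately have "lap F z = (- of_real (2 * L)) *s F z" using tan by (simp add: unit[OF z])
  then show ?thesis by (simp add: L_def vec_eq_iff scaleR_conv_of_real[where 'a=complex])
qed

lemma dchart_change:
  assumes c: "is_chart c" and d: "is_chart d" and hol: "transition d c holomorphic_on snd d ` (fst d \<inter> fst c)"
    and p: "p \<in> fst c" "p \<in> fst d" and h: "(h \<circ> chart_inv c) differentiable (at (snd c p))"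
  shows "\<exists>\<tau>. \<forall>v. dchart d h p v = dchart c h p (\<tau> * v)"
proof -
  let ?W = "snd d ` (fst d \<inter> fst c)"
  have W: "open ?W" using open_chart_image[OF d, of "fst d \<inter> fst c"] chart_props(1)[OF c] chart_props(1)[OF d] by blast
  have pW: "snd d p \<in> ?W" using p by blast
  obtain \<tau> where "(transition d c has_field_derivative \<tau>) (at (snd d p))"
    using hol pW W by (meson holomorphic_on_open)
  then have t: "(transition d c has_derivative (\<lambda>v. \<tau> * v)) (at (snd d p))" by (simp add: has_field_derivative_def)
  have tp: "transition d c (snd d p) = snd c p" by (simp add: transition_def chart_props(3)[OF d p(2)])
  have "((\<lambda>x. (h \<circ> chart_inv c) (transition d c x)) has_derivative (\<lambda>v. pd (\<tau> * v) (h \<circ> chart_inv c) (snd c p))) (at (snd d p))"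
    by (rule has_derivative_compose[OF t, where g = "h \<circ> chart_inv c"]) (unfold tp, rule has_derivative_pd[OF h])
  then have "((h \<circ> chart_inv d) has_derivative (\<lambda>v. pd (\<tau> * v) (h \<circ> chart_inv c) (snd c p))) (at (snd d p))"
  proof (rule has_derivative_transform_within_open[OF _ W pW])
    fix x assume "x \<in> ?W"
    then obtain q where "q \<in> fst d" "q \<in> fst c" "x = snd d q" by blast
    then show "(h \<circ> chart_inv c) (transition d c x) = (h \<circ> chart_inv d) x"
      by (simp add: transition_def chart_props(3)[OF d] chart_props(3)[OF c])
  qed
  then have "dchart d h p v = dchart c h p (\<tau> * v)" for v
    unfolding dchart_eq_pd by (rule pd_eqI)
  then show ?thesis by blast
qed

definition chart_phase :: "('m \<Rightarrow> complex^3) \<Rightarrow> 'm chart \<Rightarrow> 'm \<Rightarrow> complex" where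
  "chart_phase f c p = frame_phase (f \<circ> chart_inv c) (snd c p)"

lemma det_frame_rotate:
  "det (frame a (x *\<^sub>R b + y *\<^sub>R c) ((- y) *\<^sub>R b + x *\<^sub>R c)) = of_real (x\<^sup>2 + y\<^sup>2) * det (frame a b c)"
  by (simp add: det_frame scaleR_conv_of_real[where 'a=complex] power2_eq_square algebra_simps)

text \<open>A horizontal lift of a minimal Lagrangian surface, as seen in the charts of the induced complex structure.\<close>

locale minimal_lagrangian_lift =
  fixes A :: "'m::topological_space chart set" and \<phi> :: "'m \<Rightarrow> (complex^3) set" and f :: "'m \<Rightarrow> complex^3"
  assumes A: "complex_atlas A"
    and patch: "c \<in> A \<Longrightarrow> minimal_legendrian_patch (snd c ` fst c) (f \<circ> chart_inv c)"
    and S5: "range f \<subseteq> S5"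
    and lift: "hopf (f p) = \<phi> p"
begin

lemma atlas_chart: "c \<in> A \<Longrightarrow> is_chart c" using A by (auto simp: complex_atlas_def)

lemma cover: "\<exists>c\<in>A. p \<in> fst c" using A by (auto simp: complex_atlas_def)

lemma chart_inv_coordinate: "c \<in> A \<Longrightarrow> p \<in> fst c \<Longrightarrow> chart_inv c (snd c p) = p" using chart_props(3)[OF atlas_chart] by blast

lemma legendrian: "c \<in> A \<Longrightarrow> legendrian_patch (snd c ` fst c) (f \<circ> chart_inv c)"
  using patch minimal_legendrian_patch.axioms(1) by blast

lemma lift_in_S5: "f p \<in> S5" using S5 by blast

lemma unit_lift: "herm (f p) (f p) = 1" using lift_in_S5 by (simp only: S5_iff)

lemma change_of_chart:
  assumes "c \<in> A" "d \<in> A" "p \<in> fst c" "p \<in> fst d"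
  obtains \<tau> where "\<And>v. dchart d f p v = dchart c f p (\<tau> * v)"
proof -
  have "transition d c holomorphic_on snd d ` (fst d \<inter> fst c)" using A assms by (auto simp: complex_atlas_def)
  moreover have "(f \<circ> chart_inv c) differentiable (at (snd c p))"
    using legendrian_patch.df[OF legendrian[OF assms(1)]] assms(3) by blast
  ultimately show ?thesis using dchart_change[OF atlas_chart atlas_chart] assms that by blast
qed

lemma dchart_direction:
  assumes "c \<in> A" "p \<in> fst c"
  shows "dchart c f p v = Re v *\<^sub>R dx c f p + Im v *\<^sub>R dy c f p"
  unfolding dchart_eq_pd
  by (rule pd_complex_direction) (use legendrian_patch.df[OF legendrian[OF assms(1)]] assms(2) in blast)

text \<open>A holomorphic change of coordinate acts on \<open>(f\<^sub>x, f\<^sub>y)\<close> by a rotation and a dilation, which multiplies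
the determinant and the energy by the same factor.\<close>

lemma phase_chart_independent:
  assumes cd: "c \<in> A" "d \<in> A" "p \<in> fst c" "p \<in> fst d"
  shows "chart_phase f d p = chart_phase f c p"
proof -
  obtain \<tau> where t: "\<And>v. dchart d f p v = dchart c f p (\<tau> * v)" using change_of_chart[OF cd] by blast
  define x y where "x = Re \<tau>" and "y = Im \<tau>"
  let ?b = "pd 1 (f \<circ> chart_inv c) (snd c p)" and ?e = "pd \<i> (f \<circ> chart_inv c) (snd c p)"
  have 1: "pd 1 (f \<circ> chart_inv d) (snd d p) = x *\<^sub>R ?b + y *\<^sub>R ?e"
    and i: "pd \<i> (f \<circ> chart_inv d) (snd d p) = (- y) *\<^sub>R ?b + x *\<^sub>R ?e"
    using t[of 1] t[of \<i>] dchart_direction[OF cd(1,3), of \<tau>] dchart_direction[OF cd(1,3), of "\<tau> * \<i>"]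
    by (simp_all add: dchart_eq_pd x_def y_def)
  have "conformal_at (f \<circ> chart_inv c) (snd c p)"
    using minimal_legendrian_patch.conformal[OF patch[OF cd(1)]] cd(3) by blast
  then have L: "(x *\<^sub>R ?b + y *\<^sub>R ?e) \<bullet> (x *\<^sub>R ?b + y *\<^sub>R ?e) = (x\<^sup>2 + y\<^sup>2) * (?b \<bullet> ?b)"
    by (simp add: conformal_at_def inner_add_left inner_add_right inner_commute power2_eq_square algebra_simps)
  have "pd 1 (f \<circ> chart_inv d) (snd d p) \<noteq> 0"
    using minimal_legendrian_patch.immersed[OF patch[OF cd(2)]] cd(4) by blast
  then have "x\<^sup>2 + y\<^sup>2 \<noteq> 0" unfolding 1 by (auto simp: sum_power2_eq_zero_iff)
  then have n: "complex_of_real (x\<^sup>2 + y\<^sup>2) \<noteq> 0" by (simp only: of_real_eq_0_iff not_False_eq_True)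
  show ?thesis unfolding chart_phase_def frame_phase_def energy_def 1 i L det_frame_rotate
    using n by (simp only: o_apply chart_inv_coordinate[OF cd(1,3)] chart_inv_coordinate[OF cd(2,4)] of_real_mult mult_divide_mult_cancel_left_if if_False)
qed

lemma phase_constant:
  assumes conn: "connected (UNIV :: 'm set)" and c: "c \<in> A" "p \<in> fst c" and d: "d \<in> A" "q \<in> fst d"
  shows "chart_phase f d q = chart_phase f c p"
proof -
  \<comment> \<open>by chart independence the phase in an arbitrarily chosen chart is a function on the surface\<close>
  define C where "C p = (SOME c. c \<in> A \<and> p \<in> fst c)" for p
  have C: "C p \<in> A" "p \<in> fst (C p)" for p
  proof -
    have "C p \<in> A \<and> p \<in> fst (C p)" 
      using someI_ex[of "\<lambda>c. c \<in> A \<and> p \<in> fst c"] cover[of p] unfolding C_def by blast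
    then show "C p \<in> A" "p \<in> fst (C p)" by auto
  qed
  define ph where "ph p = chart_phase f (C p) p" for p
  have ph: "ph p = chart_phase f c p" if "c \<in> A" "p \<in> fst c" for c p
    unfolding ph_def by (rule phase_chart_independent[OF that(1) C(1) that(2) C(2)])
  have loc: "\<forall>\<^sub>F b in at a within UNIV. ph a = ph b" for a
  proof -
    let ?c = "C a" and ?F = "f \<circ> chart_inv (C a)"
    let ?\<Omega> = "snd ?c ` fst ?c"
    have op: "open ?\<Omega>" using chart_props(2)[OF atlas_chart[OF C(1)]] .
    have "snd ?c a \<in> ?\<Omega>" using C(2) by blast
    then obtain r where r: "r > 0" "ball (snd ?c a) r \<subseteq> ?\<Omega>" using op open_contains_ball by blast
    have "\<exists>k. \<forall>x\<in>ball (snd ?c a) r. frame_phase ?F x = k"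
    proof (rule has_derivative_zero_constant)
      fix x assume "x \<in> ball (snd ?c a) r"
      then have "x \<in> ?\<Omega>" using r(2) by blast
      from minimal_legendrian_patch.frame_phase_stationary[OF patch[OF C(1)] this]
      show "(frame_phase ?F has_derivative (\<lambda>h. 0)) (at x within ball (snd ?c a) r)"
        by (rule has_derivative_at_withinI)
    qed simp
    then obtain k where k: "\<And>x. x \<in> ball (snd ?c a) r \<Longrightarrow> frame_phase ?F x = k" by blast
    let ?V = "fst ?c \<inter> snd ?c -` ball (snd ?c a) r"
    have V: "open ?V" by (rule continuous_open_preimage[OF chart_props(6,1)]) (use atlas_chart[OF C(1)] in auto)
    have "a \<in> ?V" using C(2) r(1) by simp
    then have "\<forall>\<^sub>F b in at a. b \<in> ?V" using V eventually_at_topological by blast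
    moreover have "ph b = k" if "b \<in> ?V" for b
      using that k ph[OF C(1)[of a], of b] by (simp add: chart_phase_def)
    ultimately show ?thesis using \<open>a \<in> ?V\<close> by (auto elim: eventually_mono)
  qed
  have "ph q = ph p" by (rule connected_local_const[OF conn]) (use loc in auto)
  then show ?thesis using ph c d by simp
qed

lemma norm_phase:
  assumes c: "c \<in> A" "p \<in> fst c"
  shows "norm (chart_phase f c p) = 1"
proof -
  interpret P: minimal_legendrian_patch "snd c ` fst c" "f \<circ> chart_inv c" by (rule patch[OF c(1)])
  have z: "snd c p \<in> snd c ` fst c" using c(2) by blast
  define r where "r = sqrt (energy (f \<circ> chart_inv c) (snd c p) / 2)"
  have r: "r > 0" "r\<^sup>2 = energy (f \<circ> chart_inv c) (snd c p) / 2" using P.energy_pos[OF z] by (simp_all add: r_def)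
  show ?thesis using norm_det_unitary[OF P.adapted_frame_unitary[OF z r]]
    unfolding P.det_adapted_frame[OF z r] by (simp add: chart_phase_def norm_mult)
qed

text \<open>A local section of the tautological bundle is \<open>k f\<close> for a function \<open>k\<close>, and the term of its derivative that contains
the derivative of \<open>k\<close> is killed by the projection; another coordinate only multiplies \<open>d_z f\<close> by the
derivative of the transition map.\<close>

lemma ell1_eq:
  assumes c: "c \<in> A" "p \<in> fst c"
  shows "ell1 A \<phi> p = vec.span {d_z (f \<circ> chart_inv c) (snd c p)}"
proof -
  let ?g = "d_z (f \<circ> chart_inv c) (snd c p)"
  have P: "orthproj (ell0 \<phi> p) = outer (f p) (f p)"
    using orthproj_hopf[OF lift_in_S5, of p] lift[of p] by (simp add: ell0_def)
  have proj: "(mat 1 - outer (f p) (f p)) *v (k *s w + m *s f p) = k *s w" if "herm w (f p) = 0" for k m w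
    using that by (simp add: matrix_vec_simps outer_mult_vec herm_simps unit_lift mat_mult_vec)
  have vert: "herm (d_z (f \<circ> chart_inv d) (snd d p)) (f p) = 0" if "d \<in> A" "p \<in> fst d" for d
    using minimal_legendrian_patch.herm_wirtinger(7)[OF patch[OF that(1)], of "snd d p"] that chart_inv_coordinate[OF that] by simp
  have dz: "dz d s p = d_z (s \<circ> chart_inv d) (snd d p)" for d s by (simp add: dz_def d_z_def dchart_eq_pd)
  let ?G = "{(mat 1 - orthproj (ell0 \<phi> p)) *v dz c s p | c V s. c \<in> A \<and> p \<in> V \<and> local_section c \<phi> V s}"
  have "?g \<in> ?G"
  proof -
    have "local_section c \<phi> (fst c) f"
      using chart_props(1)[OF atlas_chart[OF c(1)]] legendrian_patch.sm[OF legendrian[OF c(1)]]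
      by (auto simp: local_section_def ell0_def hopf_def vec.span_base simp flip: lift)
    moreover have "(mat 1 - orthproj (ell0 \<phi> p)) *v dz c f p = ?g"
      using proj[OF vert[OF c], of 1 0] by (simp add: P dz)
    ultimately show ?thesis
      using c(1) by (intro CollectI exI[of _ c] exI[of _ "fst c"] exI[of _ f] conjI c) (simp_all only:)
  qed
  have "w \<in> vec.span {?g}" if w: "w \<in> ?G" for w
  proof -
    obtain d V s where d: "d \<in> A" "p \<in> V" "local_section d \<phi> V s" "w = (mat 1 - orthproj (ell0 \<phi> p)) *v dz d s p"
      using w by blast
    have V: "open V" "V \<subseteq> fst d" "smooth_on (snd d ` V) (s \<circ> chart_inv d)" "\<And>q. q \<in> V \<Longrightarrow> s q \<in> ell0 \<phi> q"
      using d(3) by (auto simp: local_section_def)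
    have pd': "p \<in> fst d" using d(2) V(2) by blast
    let ?F = "f \<circ> chart_inv d" and ?z = "snd d p"
    have oV: "open (snd d ` V)" by (rule open_chart_image[OF atlas_chart[OF d(1)] V(1,2)])
    have z: "?z \<in> snd d ` V" "?z \<in> snd d ` fst d" using d(2) pd' by auto
    define k where "k = (\<lambda>x. herm ((s \<circ> chart_inv d) x) (?F x))"
    have dF: "?F differentiable at ?z" using legendrian_patch.df[OF legendrian[OF d(1)] z(2)] .
    have dk: "k differentiable at ?z" unfolding k_def
      by (intro bounded_bilinear.differentiable_bilinear[OF bounded_bilinear_herm] dF smooth_onD(1)[OF V(3) z(1)])
    have "pd v (s \<circ> chart_inv d) ?z = pd v (\<lambda>x. k x *s ?F x) ?z" for v
    proof (rule pd_cong[OF oV z(1)])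
      fix x assume "x \<in> snd d ` V"
      then obtain q where q: "q \<in> V" "x = snd d q" by blast
      have iq: "chart_inv d x = q" using chart_inv_coordinate[OF d(1)] q V(2) by auto
      obtain m where "s q = m *s f q" using V(4)[OF q(1)] by (auto simp: ell0_def hopf_def vec.span_singleton simp flip: lift)
      then show "(s \<circ> chart_inv d) x = k x *s ?F x" by (simp add: k_def iq herm_simps unit_lift)
    qed
    then have ps: "pd v (s \<circ> chart_inv d) ?z = k ?z *s pd v ?F ?z + pd v k ?z *s ?F ?z" for v
      using bounded_bilinear.pd_bilinear[OF bounded_bilinear_cscale dk dF, of v] by simp
    have "dz d s p = k ?z *s d_z ?F ?z + ((1/2) * (pd 1 k ?z - \<i> * pd \<i> k ?z)) *s f p"
      unfolding dz d_z_def ps using chart_inv_coordinate[OF d(1) pd'] by (simp add: vec_eq_iff algebra_simps)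
    then have "w = k ?z *s d_z ?F ?z" unfolding d(4) P using proj[OF vert[OF d(1) pd']] by simp
    moreover obtain \<tau> where t: "\<And>v. dchart d f p v = dchart c f p (\<tau> * v)" using change_of_chart[OF c(1) d(1) c(2) pd'] by blast
    have "d_z ?F ?z = \<tau> *s ?g"
    proof -
      define x y where "x = Re \<tau>" and "y = Im \<tau>"
      have xy: "\<tau> = of_real x + \<i> * of_real y" by (simp add: x_def y_def complex_eq)
      have dd: "pd 1 ?F ?z = x *\<^sub>R pd 1 (f \<circ> chart_inv c) (snd c p) + y *\<^sub>R pd \<i> (f \<circ> chart_inv c) (snd c p)"
        "pd \<i> ?F ?z = (- y) *\<^sub>R pd 1 (f \<circ> chart_inv c) (snd c p) + x *\<^sub>R pd \<i> (f \<circ> chart_inv c) (snd c p)"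
        using t[of 1] t[of \<i>] dchart_direction[OF c, of \<tau>] dchart_direction[OF c, of "\<tau> * \<i>"]
        by (simp_all add: dchart_eq_pd x_def y_def)
      show ?thesis unfolding d_z_def xy dd
        by (simp add: vec_eq_iff scaleR_conv_of_real[where 'a=complex] field_simps)
    qed
    ultimately have "w = (k ?z * \<tau>) *s ?g" by simp
    then show ?thesis by (auto simp: vec.span_singleton)
  qed
  then have "?G \<subseteq> vec.span {?g}" by blast
  then have "vec.span ?G \<subseteq> vec.span {?g}" by (rule vec.span_minimal) (rule vec.subspace_span)
  moreover have "vec.span {?g} \<subseteq> vec.span ?G" using \<open>?g \<in> ?G\<close> by (intro vec.span_mono) simp
  ultimately show ?thesis unfolding ell1_def by blast
qed

lemma psi2_eq:
  assumes c: "c \<in> A" "p \<in> fst c" and r: "r \<noteq> 0"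
  shows "psi2 A \<phi> f p = (f p, vec.span {f p, (1/r) *\<^sub>R d_z (f \<circ> chart_inv c) (snd c p)})"
proof -
  let ?g = "d_z (f \<circ> chart_inv c) (snd c p)"
  have "{u + v | u v. u \<in> vec.span {f p} \<and> v \<in> vec.span {?g}} = vec.span {f p, (1/r) *\<^sub>R ?g}"
  proof (intro set_eqI iffI)
    fix w assume "w \<in> {u + v | u v. u \<in> vec.span {f p} \<and> v \<in> vec.span {?g}}"
    then obtain x y where w: "w = x *s f p + y *s ?g" by (auto simp: vec.span_singleton)
    have "y *s ?g = (y * of_real r) *s ((1/r) *\<^sub>R ?g)" using r by (simp add: vec_eq_iff scaleR_conv_of_real[where 'a=complex])
    then have "w = x *s f p + (y * of_real r) *s ((1/r) *\<^sub>R ?g)" using w by simp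
    then show "w \<in> vec.span {f p, (1/r) *\<^sub>R ?g}" unfolding span_pair by blast
  next
    fix w assume "w \<in> vec.span {f p, (1/r) *\<^sub>R ?g}"
    then obtain x y where w: "w = x *s f p + y *s ((1/r) *\<^sub>R ?g)" by (auto simp: span_pair)
    have "y *s ((1/r) *\<^sub>R ?g) = (y * of_real (1/r)) *s ?g" by (simp add: vec_eq_iff scaleR_conv_of_real[where 'a=complex])
    then have "w = x *s f p + (y * of_real (1/r)) *s ?g" using w by simp
    moreover have "k *s a \<in> vec.span {a}" for k and a :: "complex^3" by (simp add: vec.span_scale vec.span_base)
    ultimately show "w \<in> {u + v | u v. u \<in> vec.span {f p} \<and> v \<in> vec.span {?g}}" by blast
  qed
  then show ?thesis by (simp add: psi2_def ell1_eq[OF c] ell0_def hopf_def flip: lift)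
qed

lemma primitive_psi2:
  assumes ph: "\<And>c p. c \<in> A \<Longrightarrow> p \<in> fst c \<Longrightarrow> chart_phase f c p = \<i>"
  shows "primitive A (psi2 A \<phi> f)"
proof -
  have main: "psi2 A \<phi> f p \<in> FL2 \<and>
      (fl_emb \<circ> psi2 A \<phi> f) p = (f p, flag_projection (f \<circ> chart_inv c) (snd c p)) \<and>
      (\<exists>r>0. r\<^sup>2 = energy (f \<circ> chart_inv c) (snd c p) / 2 \<and>
        frame (f p) ((1/r) *\<^sub>R d_z (f \<circ> chart_inv c) (snd c p)) (- (1/r) *\<^sub>R d_zbar (f \<circ> chart_inv c) (snd c p)) \<in> SU3 \<and>
        psi2 A \<phi> f p = (f p, vec.span {f p, (1/r) *\<^sub>R d_z (f \<circ> chart_inv c) (snd c p)}))"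
    if c: "c \<in> A" "p \<in> fst c" for c p
  proof -
    interpret P: minimal_legendrian_patch "snd c ` fst c" "f \<circ> chart_inv c" by (rule patch[OF c(1)])
    let ?z = "snd c p"
    have z: "?z \<in> snd c ` fst c" using c(2) by blast
    define r where "r = sqrt (energy (f \<circ> chart_inv c) ?z / 2)"
    have r: "r > 0" "r\<^sup>2 = energy (f \<circ> chart_inv c) ?z / 2" using P.energy_pos[OF z] by (simp_all add: r_def)
    define b where "b = (1/r) *\<^sub>R d_z (f \<circ> chart_inv c) ?z"
    define e where "e = - (1/r) *\<^sub>R d_zbar (f \<circ> chart_inv c) ?z"
    have Fp: "(f \<circ> chart_inv c) ?z = f p" using chart_inv_coordinate[OF c] by simp
    have u: "adj (frame (f p) b e) ** frame (f p) b e = mat 1"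
      using P.adapted_frame_unitary[OF z r] unfolding Fp b_def e_def .
    have "det (frame (f p) b e) = 1"
      using P.det_adapted_frame[OF z r] ph[OF c] unfolding Fp b_def e_def chart_phase_def by simp
    then have SU: "frame (f p) b e \<in> SU3" using u by (simp add: SU3_def)
    have psi: "psi2 A \<phi> f p = (f p, vec.span {f p, b})" unfolding b_def by (rule psi2_eq[OF c]) (use r in simp)
    note o = u[unfolded unitary_frame_iff]
    have "f p \<notin> vec.span {b}"
    proof
      assume "f p \<in> vec.span {b}"
      then obtain k where k: "f p = k *s b" by (auto simp: vec.span_singleton)
      have "herm (f p) (f p) = k * herm b (f p)" by (subst (1) k) (simp only: herm_simps)
      then show False using o herm_eq_0_commute[of "f p" b] by simp
    qed
    moreover have "b \<noteq> 0" using o by (auto simp: herm_simps)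
    ultimately have ind: "vec.independent {f p, b}" "f p \<noteq> b"
      by (auto simp: vec.independent_insert vec.span_base)
    then have "vec.dim (vec.span {f p, b}) = 2" by (simp add: vec.dim_eq_card_independent)
    then have FL: "psi2 A \<phi> f p \<in> FL2" using lift_in_S5[of p] by (auto simp: psi FL2_def vec.span_base)
    have "outer e e = (1/r\<^sup>2) *\<^sub>R outer (d_zbar (f \<circ> chart_inv c) ?z) (d_zbar (f \<circ> chart_inv c) ?z)"
      unfolding e_def outer_simps(9,10) by (simp add: power2_eq_square)
    then have "fl_emb (psi2 A \<phi> f p) = (f p, flag_projection (f \<circ> chart_inv c) ?z)"
      unfolding psi fl_emb_def by (simp add: orthproj_plane[OF u] flag_projection_def r(2) inverse_eq_divide)
    then show ?thesis using FL SU psi r unfolding b_def e_def by auto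
  qed
  have emb: "(fl_emb \<circ> psi2 A \<phi> f) (chart_inv c x) = ((f \<circ> chart_inv c) x, flag_projection (f \<circ> chart_inv c) x)"
    if "c \<in> A" "x \<in> snd c ` fst c" for c x
    using main[of c "chart_inv c x"] chart_props(4,5)[OF atlas_chart[OF that(1)] that(2)] that(1) by simp
  have pdE: "pd v (fl_emb \<circ> psi2 A \<phi> f \<circ> chart_inv c) z =
      (pd v (f \<circ> chart_inv c) z, pd v (flag_projection (f \<circ> chart_inv c)) z) \<and>
      (fl_emb \<circ> psi2 A \<phi> f \<circ> chart_inv c) differentiable at z"
    if c: "c \<in> A" "z \<in> snd c ` fst c" for c z v
  proof -
    interpret P: minimal_legendrian_patch "snd c ` fst c" "f \<circ> chart_inv c" by (rule patch[OF c(1)])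
    have d: "((\<lambda>x. ((f \<circ> chart_inv c) x, flag_projection (f \<circ> chart_inv c) x)) has_derivative (\<lambda>v. (pd v (f \<circ> chart_inv c) z, pd v (flag_projection (f \<circ> chart_inv c)) z))) (at z)"
      by (intro has_derivative_Pair has_derivative_pd P.df c smooth_onD(1)[OF P.smooth_flag_projection])
    have "((fl_emb \<circ> psi2 A \<phi> f \<circ> chart_inv c) has_derivative (\<lambda>v. (pd v (f \<circ> chart_inv c) z, pd v (flag_projection (f \<circ> chart_inv c)) z))) (at z)"
      by (rule has_derivative_transform_within_open[OF d P.op c(2)]) (use emb[OF c(1)] in simp)
    then show ?thesis using pd_eqI differentiable_def by blast
  qed
  have "smooth_map A (fl_emb \<circ> psi2 A \<phi> f)" unfolding smooth_map_def
  proof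
    fix c assume c: "c \<in> A"
    interpret P: minimal_legendrian_patch "snd c ` fst c" "f \<circ> chart_inv c" by (rule patch[OF c])
    show "smooth_on (snd c ` fst c) (fl_emb \<circ> psi2 A \<phi> f \<circ> chart_inv c)"
      using smooth_on_cong[OF P.op, of "fl_emb \<circ> psi2 A \<phi> f \<circ> chart_inv c" "\<lambda>x. ((f \<circ> chart_inv c) x, flag_projection (f \<circ> chart_inv c) x)"]
        emb[OF c] smooth_on_Pair[OF P.op P.sm P.smooth_flag_projection] by simp
  qed
  moreover have "immersed_at A (fl_emb \<circ> psi2 A \<phi> f) p" for p unfolding immersed_at_def
  proof (intro ballI impI)
    fix c assume c: "c \<in> A" "p \<in> fst c"
    interpret P: minimal_legendrian_patch "snd c ` fst c" "f \<circ> chart_inv c" by (rule patch[OF c(1)])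
    have z: "snd c p \<in> snd c ` fst c" using c(2) by blast
    note dE = pdE[OF c(1) z]
    have lin: "linear (dchart c (fl_emb \<circ> psi2 A \<phi> f) p)"
      unfolding dchart_def using has_derivative_linear[OF dE[THEN conjunct2, unfolded frechet_derivative_works]] by (simp add: linear_linear)
    show "inj (dchart c (fl_emb \<circ> psi2 A \<phi> f) p)" unfolding linear_injective_0[OF lin]
    proof (intro allI impI)
      fix v assume "dchart c (fl_emb \<circ> psi2 A \<phi> f) p v = 0"
      then have "pd v (f \<circ> chart_inv c) (snd c p) = 0" using dE[of v] by (simp add: dchart_eq_pd zero_prod_def)
      then show "v = 0" using P.norm_pd_conformal[OF z P.conformal[OF z], of v] P.immersed[OF z] by simp
    qed
  qed
  moreover have "((1/2) *\<^sub>R dx c (fl_emb \<circ> psi2 A \<phi> f) p, (-1/2) *\<^sub>R dy c (fl_emb \<circ> psi2 A \<phi> f) p) \<in> g1_bundle (psi2 A \<phi> f p)"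
    if c: "c \<in> A" "p \<in> fst c" for c p
  proof -
    interpret P: minimal_legendrian_patch "snd c ` fst c" "f \<circ> chart_inv c" by (rule patch[OF c(1)])
    let ?z = "snd c p"
    have z: "?z \<in> snd c ` fst c" using c(2) by blast
    have Fp: "(f \<circ> chart_inv c) ?z = f p" using chart_inv_coordinate[OF c] by simp
    obtain r where r: "r > 0" "r\<^sup>2 = energy (f \<circ> chart_inv c) ?z / 2" and
      SU: "frame (f p) ((1/r) *\<^sub>R d_z (f \<circ> chart_inv c) ?z) (- (1/r) *\<^sub>R d_zbar (f \<circ> chart_inv c) ?z) \<in> SU3" and
      psi: "psi2 A \<phi> f p = (f p, vec.span {f p, (1/r) *\<^sub>R d_z (f \<circ> chart_inv c) ?z})"
      using main[OF c] by blast
    obtain \<beta> where \<beta>: "(1/2) *\<^sub>R pd 1 (flag_projection (f \<circ> chart_inv c)) ?z =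
       - (outer ((1/2) *s (of_real r *s f p - cnj \<beta> *s ((1/r) *\<^sub>R d_z (f \<circ> chart_inv c) ?z))) (- (1/r) *\<^sub>R d_zbar (f \<circ> chart_inv c) ?z)
        + outer (- (1/r) *\<^sub>R d_zbar (f \<circ> chart_inv c) ?z) ((1/2) *s (of_real r *s f p - cnj \<beta> *s ((1/r) *\<^sub>R d_z (f \<circ> chart_inv c) ?z))))"
      "(-1/2) *\<^sub>R pd \<i> (flag_projection (f \<circ> chart_inv c)) ?z =
       - (outer ((-\<i>/2) *s (of_real r *s f p + cnj \<beta> *s ((1/r) *\<^sub>R d_z (f \<circ> chart_inv c) ?z))) (- (1/r) *\<^sub>R d_zbar (f \<circ> chart_inv c) ?z)
        + outer (- (1/r) *\<^sub>R d_zbar (f \<circ> chart_inv c) ?z) ((-\<i>/2) *s (of_real r *s f p + cnj \<beta> *s ((1/r) *\<^sub>R d_z (f \<circ> chart_inv c) ?z))))"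
      using P.flag_projection_derivative[OF z r] unfolding Fp by blast
    have w: "(1/2) *\<^sub>R pd 1 (f \<circ> chart_inv c) ?z = (1/2) *s (of_real r *s ((1/r) *\<^sub>R d_z (f \<circ> chart_inv c) ?z)
          - cnj (of_real r) *s (- (1/r) *\<^sub>R d_zbar (f \<circ> chart_inv c) ?z))"
      "(-1/2) *\<^sub>R pd \<i> (f \<circ> chart_inv c) ?z = (-\<i>/2) *s (of_real r *s ((1/r) *\<^sub>R d_z (f \<circ> chart_inv c) ?z)
          + cnj (of_real r) *s (- (1/r) *\<^sub>R d_zbar (f \<circ> chart_inv c) ?z))"
      using r(1) unfolding pd_eq_wirtinger by (simp_all add: vec_eq_iff scaleR_conv_of_real[where 'a=complex] field_simps)
    show ?thesis unfolding g1_bundle_iff dchart_eq_pd pdE[OF c(1) z, THEN conjunct1] scaleR_Pair \<beta> w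
      using SU psi by blast
  qed
  moreover have "range (psi2 A \<phi> f) \<subseteq> FL2" using main cover by blast
  ultimately show ?thesis by (simp add: primitive_def)
qed

end

lemma horizontal_lift_rotate:
  assumes lift: "horizontal_lift S \<phi> f" and ch: "\<And>c. c \<in> S \<Longrightarrow> is_chart c" and u: "norm u = 1"
  shows "horizontal_lift S \<phi> (\<lambda>p. u *s f p)"
proof -
  have comp: "(\<lambda>p. u *s f p) \<circ> chart_inv c = (\<lambda>z. u *s (f \<circ> chart_inv c) z)" for c by auto
  have uu: "u * cnj u = 1" using u by (simp add: complex_norm_square[symmetric])
  have sm: "smooth_on (snd c ` fst c) (f \<circ> chart_inv c)" if "c \<in> S" for c
    using lift that by (simp add: horizontal_lift_def smooth_map_def)
  have "smooth_map S (\<lambda>p. u *s f p)" unfolding smooth_map_def comp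
    using bounded_linear.smooth_on_linear[OF bounded_linear_cscale chart_props(2)[OF ch] sm] by blast
  moreover have "range (\<lambda>p. u *s f p) \<subseteq> S5"
  proof -
    have "f p \<in> S5" for p using lift unfolding horizontal_lift_def by blast
    moreover have "herm (u *s f p) (u *s f p) = (u * cnj u) * herm (f p) (f p)" for p by (simp add: herm_simps)
    ultimately have "herm (u *s f p) (u *s f p) = 1" for p unfolding uu S5_iff by simp
    then show ?thesis using S5_iff by blast
  qed
  moreover have "hopf (u *s f p) = \<phi> p" for p
  proof -
    have u0: "u \<noteq> 0" using u by auto
    have "hopf (u *s f p) = hopf (f p)" unfolding hopf_def vec.span_singleton
    proof (intro set_eqI iffI)
      fix x assume "x \<in> range (\<lambda>k. k *s f p)"
      then obtain k where "x = k *s f p" by blast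
      then have "x = (k / u) *s (u *s f p)" using u0 by simp
      then show "x \<in> range (\<lambda>k. k *s (u *s f p))" by blast
    qed auto
    then show ?thesis using lift by (simp add: horizontal_lift_def)
  qed
  moreover have "horizontal S (\<lambda>p. u *s f p)" unfolding horizontal_def
  proof (intro ballI allI)
    fix c p v assume c: "c \<in> S" "p \<in> fst c"
    have "dchart c (\<lambda>p. u *s f p) p v = u *s dchart c f p v"
      unfolding dchart_eq_pd comp
      by (rule bounded_linear.pd_linear[OF bounded_linear_cscale smooth_onD(1)[OF sm[OF c(1)]]]) (use c in blast)
    moreover have "dchart c f p v \<bullet> (\<i> *s f p) = 0" using lift c by (simp add: horizontal_lift_def horizontal_def)
    moreover have "herm (u *s dchart c f p v) (\<i> *s (u *s f p)) = (u * cnj u) * herm (dchart c f p v) (\<i> *s f p)"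
      by (simp add: herm_simps)
    ultimately show "dchart c (\<lambda>p. u *s f p) p v \<bullet> (\<i> *s (u *s f p)) = 0" by (simp add: inner_eq_Re_herm uu)
  qed
  ultimately show ?thesis by (simp add: horizontal_lift_def)
qed

lemma minimal_lagrangian_liftI:
  assumes min: "minimal_lagrangian_on S UNIV \<phi>" and ind: "induced_complex_structure S (orthproj \<circ> \<phi>) A"
    and lift: "horizontal_lift S \<phi> f"
  shows "minimal_lagrangian_lift A \<phi> f"
proof (rule minimal_lagrangian_lift.intro)
  show A: "complex_atlas A" using ind by (simp add: induced_complex_structure_def)
  have AS: "A \<subseteq> S" using ind by (simp add: induced_complex_structure_def)
  show S5: "range f \<subseteq> S5" and hl: "\<And>p. hopf (f p) = \<phi> p" using lift by (auto simp: horizontal_lift_def)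
  fix c assume c: "c \<in> A"
  have ch: "is_chart c" using A c by (auto simp: complex_atlas_def)
  let ?F = "f \<circ> chart_inv c" and ?h = "orthproj \<circ> \<phi>"
  have cS: "c \<in> S" using AS c by blast
  interpret L: legendrian_patch "snd c ` fst c" "f \<circ> chart_inv c"
  proof (rule legendrian_patchI)
    show "open (snd c ` fst c)" by (rule chart_props(2)[OF ch])
    show "smooth_on (snd c ` fst c) ?F" using lift cS by (simp add: horizontal_lift_def smooth_map_def)
    show "norm (?F z) = 1" for z using S5 by (auto simp: image_subset_iff)
    fix z v assume "z \<in> snd c ` fst c"
    then obtain p where p: "p \<in> fst c" "z = snd c p" by blast
    then have "dchart c f p v \<bullet> (\<i> *s f p) = 0" using lift cS by (simp add: horizontal_lift_def horizontal_def)
    then show "pd v ?F z \<bullet> (\<i> *s ?F z) = 0" using p chart_props(3)[OF ch p(1)] by (simp add: dchart_eq_pd)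
  qed
  have h: "?h \<circ> chart_inv c = L.H"
  proof
    fix x show "(?h \<circ> chart_inv c) x = L.H x"
      using orthproj_hopf[of "f (chart_inv c x)"] S5 hl[of "chart_inv c x"] by (auto simp: image_subset_iff)
  qed
  have conf: "conformal_at ?F z" if "z \<in> snd c ` fst c" for z
  proof -
    have "conformal_at L.H z" using ind c that unfolding induced_complex_structure_def conformal_chart_iff h[symmetric] by auto
    then show ?thesis using L.conformal_H_iff[OF that] by simp
  qed
  have imm: "pd 1 ?F z \<noteq> 0" if "z \<in> snd c ` fst c" for z
  proof
    assume 0: "pd 1 ?F z = 0"
    obtain p where p: "p \<in> fst c" "z = snd c p" using \<open>z \<in> snd c ` fst c\<close> by blast
    have "inj (dchart c ?h p)" using min cS p by (simp add: minimal_lagrangian_on_def minimal_immersion_on_def immersed_at_def)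
    moreover have "pd 0 L.H z = 0" using pd_scale_vec[OF smooth_onD(1)[OF L.smooth_H that], of 0 0] by simp
    then have "dchart c ?h p 1 = dchart c ?h p 0"
      unfolding dchart_eq_pd h p(2)[symmetric] using L.pd_H[OF that, of 1] 0 by (simp add: outer_simps)
    ultimately show False using injD by fastforce
  qed
  show "minimal_legendrian_patch (snd c ` fst c) ?F"
  proof
    fix z assume z: "z \<in> snd c ` fst c"
    show "conformal_at ?F z" "pd 1 ?F z \<noteq> 0" using conf imm z by auto
    obtain p where p: "p \<in> fst c" "z = snd c p" using z by blast
    have "mean_curvature CP2_emb c ?h p = 0"
      using min cS p by (simp add: minimal_lagrangian_on_def minimal_immersion_on_def)
    moreover have ch': "conformal_at (?h \<circ> chart_inv c) (snd c p)" unfolding h using L.conformal_H_iff[OF z] conf[OF z] p by simp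
    ultimately have "closest_point {n \<in> tangent_space CP2_emb (?h p). n \<bullet> dx c ?h p = 0 \<and> n \<bullet> dy c ?h p = 0}
      ((1 / (2 * (dx c ?h p \<bullet> dx c ?h p))) *\<^sub>R lap (?h \<circ> chart_inv c) (snd c p)) = 0"
      using mean_curvature_conformal[OF ch p(1) ch', of CP2_emb] by simp
    moreover have "?h p = L.H z" using fun_cong[OF h, of z] p chart_props(3)[OF ch p(1)] by simp
    ultimately have cl: "closest_point {n \<in> tangent_space CP2_emb (L.H z). n \<bullet> pd 1 L.H z = 0 \<and> n \<bullet> pd \<i> L.H z = 0}
      ((1 / (2 * (pd 1 L.H z \<bullet> pd 1 L.H z))) *\<^sub>R lap L.H z) = 0"
      unfolding dchart_eq_pd h p(2)[symmetric] by simp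
    have "1 / (2 * (pd 1 L.H z \<bullet> pd 1 L.H z)) \<noteq> 0" using imm[OF z] unfolding L.inner_pd_H[OF z] by simp
    from L.harmonic_of_minimal[OF z conf imm[OF z] this cl]
    show "lap ?F z = - (2 * (pd 1 ?F z \<bullet> pd 1 ?F z)) *\<^sub>R ?F z" .
  qed
qed

lemma phase_rotate:
  assumes "minimal_lagrangian_lift A \<phi> f" "minimal_lagrangian_lift A \<phi> (\<lambda>p. u *s f p)" and u: "norm u = 1"
    and c: "c \<in> A" "p \<in> fst c"
  shows "chart_phase (\<lambda>p. u *s f p) c p = u ^ 3 * chart_phase f c p"
proof -
  interpret M: minimal_lagrangian_lift A \<phi> f by fact
  interpret R: minimal_lagrangian_lift A \<phi> "\<lambda>p. u *s f p" by fact
  have comp: "(\<lambda>p. u *s f p) \<circ> chart_inv c = (\<lambda>z. u *s (f \<circ> chart_inv c) z)" by auto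
  have d: "pd v (\<lambda>z. u *s (f \<circ> chart_inv c) z) (snd c p) = u *s pd v (f \<circ> chart_inv c) (snd c p)" for v
    by (rule bounded_linear.pd_linear[OF bounded_linear_cscale legendrian_patch.df[OF M.legendrian[OF c(1)]]]) (use c in blast)
  have "(u *s w) \<bullet> (u *s w) = w \<bullet> w" for w :: "complex^3"
  proof -
    have "(u *s w) \<bullet> (u *s w) = Re ((u * cnj u) * herm w w)"
      unfolding inner_eq_Re_herm herm_simps(7,8) by (simp only: mult_ac)
    also have "u * cnj u = 1" using u by (simp add: complex_norm_square[symmetric])
    finally show ?thesis by (simp add: inner_eq_Re_herm)
  qed
  moreover have "det (frame (u *s a) (u *s b) (u *s e)) = u ^ 3 * det (frame a b e)" for a b e
    by (simp add: det_frame power3_eq_cube algebra_simps)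
  ultimately show ?thesis unfolding chart_phase_def frame_phase_def energy_def comp d by simp
qed

theorem proposition2:
  shows
    "(\<forall>(S :: 'm::{t2_space,second_countable_topology} chart set) A \<phi> f.
        connected (UNIV :: 'm set) \<and> oriented_surface S \<and>
        minimal_lagrangian_on S UNIV \<phi> \<and>
        induced_complex_structure S (orthproj \<circ> \<phi>) A \<and>
        horizontal_lift S \<phi> f \<longrightarrow>
        (\<exists>f'. horizontal_lift S \<phi> f' \<and> primitive A (psi2 A \<phi> f')))
     \<and>
     (\<forall>(A :: 'm chart set) \<psi>.
        complex_atlas A \<and> primitive A \<psi> \<longrightarrow>
        (let f = pr1 \<circ> \<psi>; U = {p. immersed_at A f p} in
           minimal_legendrian_on A U f \<and>
           conformal_harmonic A S5 f \<and>
           minimal_lagrangian_on A U (hopf \<circ> f) \<and>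
           conformal_harmonic A CP2_emb (orthproj \<circ> (hopf \<circ> f))))"
proof (intro conjI allI impI)
  fix S :: "'m chart set" and A \<phi> f
  assume asm: "connected (UNIV :: 'm set) \<and> oriented_surface S \<and> minimal_lagrangian_on S UNIV \<phi> \<and>
        induced_complex_structure S (orthproj \<circ> \<phi>) A \<and> horizontal_lift S \<phi> f"
  then have conn: "connected (UNIV :: 'm set)" and min: "minimal_lagrangian_on S UNIV \<phi>"
    and ind: "induced_complex_structure S (orthproj \<circ> \<phi>) A" and lift: "horizontal_lift S \<phi> f"
    and chS: "\<And>c. c \<in> S \<Longrightarrow> is_chart c"
    by (auto simp: oriented_surface_def)
  interpret M: minimal_lagrangian_lift A \<phi> f by (rule minimal_lagrangian_liftI[OF min ind lift])
  obtain c0 where c0: "c0 \<in> A" "undefined \<in> fst c0" using M.cover by blast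
  define D where "D = chart_phase f c0 undefined"
  have nD: "norm D = 1" unfolding D_def by (rule M.norm_phase[OF c0])
  \<comment> \<open>a cube root of \<open>i / D\<close>, so that the rotated lift has phase \<open>i\<close> and its frame has determinant \<open>-i * i = 1\<close>\<close>
  define u where "u = cis (Arg (\<i> / D) / 3)"
  have "u ^ 3 = cis (Arg (\<i> / D))" unfolding u_def Complex.DeMoivre by simp
  also have "\<dots> = \<i> / D" using nD by (subst cis_Arg) (auto simp: sgn_eq norm_divide)
  finally have u3: "u ^ 3 * D = \<i>" using nD by auto
  have nu: "norm u = 1" by (simp add: u_def)
  note lift' = horizontal_lift_rotate[OF lift chS nu]
  interpret R: minimal_lagrangian_lift A \<phi> "\<lambda>p. u *s f p" by (rule minimal_lagrangian_liftI[OF min ind lift'])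
  have "chart_phase (\<lambda>p. u *s f p) c p = \<i>" if "c \<in> A" "p \<in> fst c" for c p
    using phase_rotate[OF M.minimal_lagrangian_lift_axioms R.minimal_lagrangian_lift_axioms nu that]
      M.phase_constant[OF conn c0 that] u3 by (simp add: D_def)
  then have "primitive A (psi2 A \<phi> (\<lambda>p. u *s f p))" by (rule R.primitive_psi2)
  then show "\<exists>f'. horizontal_lift S \<phi> f' \<and> primitive A (psi2 A \<phi> f')" using lift' by blast
next
  fix A :: "'m chart set" and \<psi>
  assume "complex_atlas A \<and> primitive A \<psi>"
  then show "let f = pr1 \<circ> \<psi>; U = {p. immersed_at A f p} in
           minimal_legendrian_on A U f \<and> conformal_harmonic A S5 f \<and> minimal_lagrangian_on A U (hopf \<circ> f) \<and>
           conformal_harmonic A CP2_emb (orthproj \<circ> (hopf \<circ> f))"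
    using primitive_projects[of A \<psi>] by (simp add: Let_def)
qed

end
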